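(* Let $(\Omega,\mathcal{H},\hat{\mathbb{E}})$ be a sublinear expectation space (with $\hat{\mathbb{E}}$ countably sub-additive), and let $\{X_n,n\ge 1\}$ be a sequence of independent random variables in $\mathcal{H}$, each identically distributed as $X$. Let $r>1$, $p>\tfrac12$, $\beta$ real with $\beta+p>0$, and in the case $\tfrac12<p\le 1$ assume additionally $\hat{\mathbb{E}}[X]=-\hat{\mathbb{E}}[-X]=0$. Let $\{a_{ni}:0\le i\le n-1,\ n\ge 1\}$ be a triangular array of real numbers with $a_{ni}\approx ((n-i)/n)^{\beta}(1/n)^{p}$. Then the following are equivalent: (i) $C_{\mathbb{V}}\big(|X|^{(r-1)/(p+\beta)}\big)<\infty$ if $-p<\beta<-p/r$; $C_{\mathbb{V}}\big(|X|^{r/p}\ln(1+|X|)\big)<\infty$ if $\beta=-p/r$; $C_{\mathbb{V}}\big(|X|^{r/p}\big)<\infty$ if $\beta>-p/r$. (ii) For every $\epsilon>0$, $$\sum_{n=1}^{\infty}n^{r-2}\,\mathbb{V}\Big(\max_{0\le j\le n-1}\Big|\sum_{i=1}^{j}a_{ni}X_i\Big|>\epsilon\Big)<\infty.$$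
   Context: Sublinear expectation space: $(\Omega,\mathcal{F})$ is a measurable space and $\mathcal{H}$ a set of random variables on it containing all indicators $I_A$, $A\in\mathcal{F}$, and closed under $(X_1,\dots,X_n)\mapsto\varphi(X_1,\dots,X_n)$ for every locally Lipschitz $\varphi$ with $|\varphi(x)-\varphi(y)|\le C(1+|x|^m+|y|^m)|x-y|$. A sublinear expectation $\hat{\mathbb{E}}:\mathcal{H}\to[-\infty,\infty]$ is monotone, constant preserving ($\hat{\mathbb{E}}[c]=c$), positively homogeneous ($\hat{\mathbb{E}}[\lambda X]=\lambda\hat{\mathbb{E}}[X]$ for $\lambda\ge0$), and sub-additive ($\hat{\mathbb{E}}[X+Y]\le\hat{\mathbb{E}}[X]+\hat{\mathbb{E}}[Y]$ when the right side is not $\infty-\infty$). It is assumed countably sub-additive: $\hat{\mathbb{E}}[X]\le\sum_n\hat{\mathbb{E}}[X_n]$ whenever $0\le X\le\sum_n X_n$, $X_n\ge0$. Capacity: $\mathbb{V}(A)=\inf\{\hat{\mathbb{E}}[\xi]: I_A\le\xi,\ \xi\in\mathcal{H}\}$. Choquet expectation: $C_{\mathbb{V}}(X)=\int_0^\infty\mathbb{V}(X>x)\,dx+\int_{-\infty}^0(\mathbb{V}(X>x)-1)\,dx$. Independence: a random vector $\mathbf{Y}$ is independent of $\mathbf{X}$ if $\hat{\mathbb{E}}[\psi(\mathbf{X},\mathbf{Y})]=\hat{\mathbb{E}}\big[\hat{\mathbb{E}}[\psi(\mathbf{x},\mathbf{Y})]|_{\mathbf{x}=\mathbf{X}}\big]$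 for every Borel $\psi$ with $\psi(\mathbf{X},\mathbf{Y}),\psi(\mathbf{x},\mathbf{Y})\in\mathcal{H}$, whenever $\bar\psi(\mathbf{x}):=\hat{\mathbb{E}}[|\psi(\mathbf{x},\mathbf{Y})|]<\infty$ for all $\mathbf{x}$ and $\hat{\mathbb{E}}[|\bar\psi(\mathbf{X})|]<\infty$; $\{X_n\}$ is independent if $X_{n+1}$ is independent of $(X_1,\dots,X_n)$ for each $n$. Identically distributed: $\hat{\mathbb{E}}[\psi(X_i)]=\hat{\mathbb{E}}[\psi(X)]$ for every Borel $\psi$ for which these are defined and finite. Notation: $a_{ni}\approx b_{ni}$ means there are constants $0<c\le C<\infty$, independent of $i,n$, with $c\,b_{ni}\le a_{ni}\le C\,b_{ni}$. *)

theory Defs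
  imports "HOL-Analysis.Analysis" "HOL-Probability.Probability"
begin

definition lnorm :: "real list \<Rightarrow> real" where
  "lnorm x = sqrt (\<Sum>v\<leftarrow>x. v ^ 2)"

definition ldiff :: "real list \<Rightarrow> real list \<Rightarrow> real list" where
  "ldiff x y = map2 (-) x y"

definition loc_lip :: "nat \<Rightarrow> (real list \<Rightarrow> real) \<Rightarrow> bool" where
  "loc_lip n \<phi> \<longleftrightarrow> (\<exists>C (m::nat). \<forall>x y. length x = n \<longrightarrow> length y = n \<longrightarrow>
      \<bar>\<phi> x - \<phi> y\<bar> \<le> C * (1 + lnorm x ^ m + lnorm y ^ m) * lnorm (ldiff x y))"

text \<open>The measurable space (UNIV, F) as a measure (only its sigma-algebra matters).\<close>
definition msp :: "'a set set \<Rightarrow> 'a measure" where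
  "msp F = measure_of UNIV F (\<lambda>_. 0)"

definition sublinear_space ::
  "'a set set \<Rightarrow> ('a \<Rightarrow> real) set \<Rightarrow> (('a \<Rightarrow> real) \<Rightarrow> ereal) \<Rightarrow> bool" where
  "sublinear_space F H E \<longleftrightarrow>
     sigma_algebra UNIV F \<and>
     H \<subseteq> borel_measurable (msp F) \<and>
     (\<forall>A\<in>F. indicator A \<in> H) \<and>
     (\<forall>n \<phi> Xs. loc_lip n \<phi> \<longrightarrow> length Xs = n \<longrightarrow> set Xs \<subseteq> H \<longrightarrow>
          (\<lambda>\<omega>. \<phi> (map (\<lambda>X. X \<omega>) Xs)) \<in> H) \<and>
     (\<forall>X\<in>H. \<forall>Y\<in>H. (\<forall>\<omega>. X \<omega> \<le> Y \<omega>) \<longrightarrow> E X \<le> E Y) \<and>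
     (\<forall>c. E (\<lambda>_. c) = ereal c) \<and>
     (\<forall>X\<in>H. \<forall>c::real. c \<ge> 0 \<longrightarrow> E (\<lambda>\<omega>. c * X \<omega>) = ereal c * E X) \<and>
     (\<forall>X\<in>H. \<forall>Y\<in>H. \<not> (E X = \<infinity> \<and> E Y = -\<infinity>) \<longrightarrow> \<not> (E X = -\<infinity> \<and> E Y = \<infinity>) \<longrightarrow>
          E (\<lambda>\<omega>. X \<omega> + Y \<omega>) \<le> E X + E Y) \<and>
     (\<forall>X Xn. X \<in> H \<longrightarrow> (\<forall>n. Xn n \<in> H) \<longrightarrow> (\<forall>n \<omega>. Xn n \<omega> \<ge> 0) \<longrightarrow> (\<forall>\<omega>. X \<omega> \<ge> 0) \<longrightarrow>
          (\<forall>\<omega>. ereal (X \<omega>) \<le> (\<Sum>n. ereal (Xn n \<omega>))) \<longrightarrow>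
          E X \<le> (\<Sum>n. E (Xn n)))"

definition cap :: "('a \<Rightarrow> real) set \<Rightarrow> (('a \<Rightarrow> real) \<Rightarrow> ereal) \<Rightarrow> 'a set \<Rightarrow> ereal" where
  "cap H E A = Inf {E \<xi> | \<xi>. \<xi> \<in> H \<and> (\<forall>\<omega>. indicator A \<omega> \<le> \<xi> \<omega>)}"

text \<open>Choquet expectation
  C_V(X) = int_0^oo V(X > x) dx + int_{-oo}^0 (V(X > x) - 1) dx
  (both integrands have constant sign, so the integrals are taken as
  nonnegative Lebesgue integrals).\<close>
definition choquet :: "('a \<Rightarrow> real) set \<Rightarrow> (('a \<Rightarrow> real) \<Rightarrow> ereal) \<Rightarrow> ('a \<Rightarrow> real) \<Rightarrow> ereal" where
  "choquet H E X =
     enn2ereal (\<integral>\<^sup>+ x. indicator {0..} x * e2ennreal (cap H E {\<omega>. X \<omega> > x}) \<partial>lborel)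
   - enn2ereal (\<integral>\<^sup>+ x. indicator {..<0} x * e2ennreal (1 - cap H E {\<omega>. X \<omega> > x}) \<partial>lborel)"

definition indep_vec ::
  "('a \<Rightarrow> real) set \<Rightarrow> (('a \<Rightarrow> real) \<Rightarrow> ereal) \<Rightarrow> (nat \<Rightarrow> 'a \<Rightarrow> real) \<Rightarrow> nat set \<Rightarrow> ('a \<Rightarrow> real) \<Rightarrow> bool" where
  "indep_vec H E Xs I Y \<longleftrightarrow>
    (\<forall>\<psi> :: (nat \<Rightarrow> real) \<Rightarrow> real \<Rightarrow> real.
      let Xv = (\<lambda>\<omega>. restrict (\<lambda>i. Xs i \<omega>) I);
          \<psi>bar = (\<lambda>x. real_of_ereal (E (\<lambda>\<omega>. \<bar>\<psi> x (Y \<omega>)\<bar>)))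
      in
      case_prod \<psi> \<in> borel_measurable (PiM I (\<lambda>_. borel) \<Otimes>\<^sub>M borel) \<longrightarrow>
      (\<lambda>\<omega>. \<psi> (Xv \<omega>) (Y \<omega>)) \<in> H \<longrightarrow>
      (\<forall>x \<in> PiE I (\<lambda>_. UNIV). (\<lambda>\<omega>. \<psi> x (Y \<omega>)) \<in> H) \<longrightarrow>
      (\<forall>x \<in> PiE I (\<lambda>_. UNIV). E (\<lambda>\<omega>. \<bar>\<psi> x (Y \<omega>)\<bar>) < \<infinity>) \<longrightarrow>
      (\<lambda>\<omega>. \<psi>bar (Xv \<omega>)) \<in> H \<longrightarrow>
      E (\<lambda>\<omega>. \<bar>\<psi>bar (Xv \<omega>)\<bar>) < \<infinity> \<longrightarrow>
      (\<lambda>\<omega>. real_of_ereal (E (\<lambda>\<omega>'. \<psi> (Xv \<omega>) (Y \<omega>')))) \<in> H \<longrightarrow>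
      E (\<lambda>\<omega>. \<psi> (Xv \<omega>) (Y \<omega>)) = E (\<lambda>\<omega>. real_of_ereal (E (\<lambda>\<omega>'. \<psi> (Xv \<omega>) (Y \<omega>')))))"

definition indep_seq ::
  "('a \<Rightarrow> real) set \<Rightarrow> (('a \<Rightarrow> real) \<Rightarrow> ereal) \<Rightarrow> (nat \<Rightarrow> 'a \<Rightarrow> real) \<Rightarrow> bool" where
  "indep_seq H E Xs \<longleftrightarrow> (\<forall>n\<ge>1. indep_vec H E Xs {1..n} (Xs (Suc n)))"

definition ident_distr ::
  "('a \<Rightarrow> real) set \<Rightarrow> (('a \<Rightarrow> real) \<Rightarrow> ereal) \<Rightarrow> ('a \<Rightarrow> real) \<Rightarrow> ('a \<Rightarrow> real) \<Rightarrow> bool" where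
  "ident_distr H E Y X \<longleftrightarrow>
    (\<forall>\<psi> :: real \<Rightarrow> real. \<psi> \<in> borel_measurable borel \<longrightarrow>
       (\<lambda>\<omega>. \<psi> (Y \<omega>)) \<in> H \<longrightarrow> (\<lambda>\<omega>. \<psi> (X \<omega>)) \<in> H \<longrightarrow>
       \<bar>E (\<lambda>\<omega>. \<psi> (Y \<omega>))\<bar> < \<infinity> \<longrightarrow> \<bar>E (\<lambda>\<omega>. \<psi> (X \<omega>))\<bar> < \<infinity> \<longrightarrow>
       E (\<lambda>\<omega>. \<psi> (Y \<omega>)) = E (\<lambda>\<omega>. \<psi> (X \<omega>)))"

end

theory Submission
  imports Defs "HOL-Real_Asymp.Real_Asymp"
begin

text \<open>
  With \<open>v\<close> the tail of \<open>\<bar>X\<bar>\<close> under the capacity and \<open>\<gamma> = p + \<beta>\<close>, both conditions are equivalent to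
  the convergence of \<open>\<Sum>\<^sub>n n\<^bsup>r-2\<^esup> \<Sum>\<^bsub>k<n\<^esub> v (\<kappa> n\<^bsup>\<gamma>\<^esup> k\<^bsup>-\<beta>\<^esup>)\<close>, the weighted sum of the tails of the
  individual summands. Cutting \<open>k\<close> at \<open>2\<^bsup>b\<^esup>\<close> and \<open>n\<close> at \<open>2\<^bsup>b+d\<^esup>\<close> turns this into
  \<open>\<Sum>\<^bsub>b,d\<^esub> 2\<^bsup>rb + (r-1)d\<^esup> v (2\<^bsup>pb + \<gamma>d\<^esup>)\<close>, which is symmetric in \<open>(r, p)\<close> and \<open>(r - 1, \<gamma>)\<close>. The larger of the
  ratios \<open>r / p\<close> and \<open>(r - 1) / \<gamma>\<close> is the moment of \<open>\<bar>X\<bar>\<close> that decides convergence, and a tie produces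
  the logarithm.

  From (ii) to tails: independence gives \<open>1 - V(\<Union>A\<^sub>i) = \<Prod>(1 - V(A\<^sub>i))\<close> for the events that the \<open>i\<close>-th summand
  is large, and each summand is at most twice the maximal partial sum. From tails to (ii): truncate the summands at
  \<open>\<delta>\<close>, and apply a Doob type maximal inequality to \<open>exp (t S\<^sub>j)\<close> with \<open>t\<close> a multiple of \<open>ln n\<close>. For some
  \<open>s \<le> 2\<close> with \<open>ps > 1\<close> the \<open>s\<close>-th moment exists, so the truncated means and variances sum to \<open>O(n\<^bsup>-\<eta>\<^esup>)\<close>, and
  the maximal inequality yields \<open>O(n\<^bsup>-r\<^esup>)\<close>.
\<close>

section \<open>Dyadic double sums and moments\<close>

text \<open>Since \<open>E\<close> is only sub-additive and may be infinite, most probabilistic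
  steps stay inside the bounded members of \<open>H\<close>, where \<open>e\<close> is real and
  constants come out exactly. Independence is then used in one form: the new object is g(past) +
  h(past) k(newest) with g, h, k nonnegative. Unions of events and stopped exponential products both
  have it, so the two directions share one conditioning lemma. Nothing is centred at its mean. X and
  - X need separate bounds, and a truncated mean is small either because a moment of order s \<le> 1
  exists (used for p > 1) or because truncation moves a mean-zero variable only slightly (s \<ge> 1,
  used for p \<le> 1). The truncation level \<delta> is a fixed small multiple of \<epsilon>. With t
  of order ln n it makes exp (t \<delta>) a small power of n, which the decay of the sums of s-th
  powers of the weights outweighs. The constants c, C, \<epsilon> and \<delta> only rescale the
  argument of the tail. A scale \<kappa> is therefore carried through the analytic lemmas in place
  of a separate proof that the moments are scale invariant.\<close>

definition dyadic_bounded :: "real \<Rightarrow> real \<Rightarrow> real \<Rightarrow> real \<Rightarrow> (real \<Rightarrow> real) \<Rightarrow> bool" where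
  "dyadic_bounded r p s g v \<longleftrightarrow> (\<exists>K. \<forall>N.
     (\<Sum>b<N. \<Sum>d<N. 2 powr (r * real b + s * real d) * v (2 powr (p * real b + g * real d))) \<le> K)"

lemma dyadic_bounded_swap: "dyadic_bounded s g r p v \<longleftrightarrow> dyadic_bounded r p s g v"
proof -
  have "(\<Sum>b<N. \<Sum>d<N. 2 powr (s * real b + r * real d) * v (2 powr (g * real b + p * real d)))
      = (\<Sum>b<N. \<Sum>d<N. 2 powr (r * real b + s * real d) * v (2 powr (p * real b + g * real d)))" for N :: nat
    by (subst sum.swap) (simp add: add.commute)
  then show ?thesis unfolding dyadic_bounded_def by simp
qed

locale tail_function =
  fixes v :: "real \<Rightarrow> real"
  assumes v_nonneg: "0 \<le> v x" and v_le_1: "v x \<le> 1" and v_antimono: "x \<le> y \<Longrightarrow> v y \<le> v x"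
begin

text \<open>For fixed d, an index shift by about gd/p turns the sum over b into a part of the single
  series. What remains is a geometric factor of ratio 2^(s - rg/p), which is below 1 because s/g <
  r/p.\<close>

lemma dyadic_bounded_of_single_sum:
  assumes pos: "p > 0" "g > 0" "r > 0" and less: "s * p < r * g"
    and sm: "summable (\<lambda>j. 2 powr (r * real j) * v (2 powr (p * real j)))"
  shows "dyadic_bounded r p s g v"
proof -
  define u where "u j = 2 powr (r * real j) * v (2 powr (p * real j))" for j :: nat
  define K where "K = suminf u"
  have u0: "u j \<ge> 0" for j by (simp add: u_def v_nonneg)
  have smu: "summable u" using sm by (simp add: u_def[abs_def])
  have K: "sum u A \<le> K" if "finite A" for A
    unfolding K_def using smu u0 that by (intro sum_le_suminf) auto
  have K0: "K \<ge> 0" using K[of "{}"] by simp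
  define x where "x = 2 powr (s - r * g / p)"
  have x: "0 < x" "x < 1"
  proof -
    have "s - r * g / p < 0" using less pos by (simp add: field_simps)
    then show "x < 1" unfolding x_def using powr_less_cancel_iff[of 2 "s - r * g / p" 0] by simp
  qed (simp add: x_def)
  have inner: "(\<Sum>b<N. 2 powr (r * real b + s * real d) * v (2 powr (p * real b + g * real d)))
      \<le> 2 powr r * K * x ^ d" for N d :: nat
  proof -
    \<comment> \<open>Rounding down keeps the shifted argument below the true one, as antitonicity
      of \<open>v\<close> requires; the error of less than one unit in the shift costs the factor
      \<open>2 powr r\<close>.\<close>
    define m where "m = nat \<lfloor>g * real d / p\<rfloor>"
    have q0: "g * real d / p \<ge> 0" using pos by simp
    have m1: "real m \<le> g * real d / p" using q0 unfolding m_def by simp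
    have m2: "g * real d / p \<le> real m + 1" using q0 unfolding m_def by linarith
    have pm: "p * real m \<le> g * real d" using m1 pos by (simp add: field_simps)
    have rm: "r * (g * real d / p) \<le> r * (real m + 1)" using m2 pos by (intro mult_left_mono) auto
    have "2 powr (r * real b + s * real d) * v (2 powr (p * real b + g * real d))
        \<le> 2 powr (s * real d - r * real m) * u (b + m)" for b :: nat
    proof -
      have "v (2 powr (p * real b + g * real d)) \<le> v (2 powr (p * real (b + m)))"
        using pm by (intro v_antimono) (simp add: algebra_simps)
      moreover have "2 powr (r * real b + s * real d) = 2 powr (s * real d - r * real m) * 2 powr (r * real (b + m))"
        by (simp add: powr_add[symmetric] algebra_simps)
      ultimately show ?thesis by (simp add: u_def mult.assoc mult_left_mono)
    qed
    then have "(\<Sum>b<N. 2 powr (r * real b + s * real d) * v (2 powr (p * real b + g * real d)))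
        \<le> (\<Sum>b<N. 2 powr (s * real d - r * real m) * u (b + m))" by (intro sum_mono)
    also have "\<dots> = 2 powr (s * real d - r * real m) * (\<Sum>b<N. u (b + m))" by (simp add: sum_distrib_left)
    also have "(\<Sum>b<N. u (b + m)) = sum u ((\<lambda>b. b + m) ` {..<N})" by (subst sum.reindex) auto
    also have "2 powr (s * real d - r * real m) * \<dots> \<le> 2 powr (r + (s - r * g / p) * real d) * K"
      using rm K K0 u0 by (intro mult_mono powr_mono sum_nonneg) (auto simp: algebra_simps)
    also have "2 powr (r + (s - r * g / p) * real d) = 2 powr r * x ^ d"
      unfolding x_def by (simp add: powr_add powr_powr[symmetric] powr_realpow)
    finally show ?thesis by (simp add: algebra_simps)
  qed
  have "(\<Sum>b<N. \<Sum>d<N. 2 powr (r * real b + s * real d) * v (2 powr (p * real b + g * real d)))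
      \<le> 2 powr r * K * (1 / (1 - x))" for N :: nat
  proof -
    have "(\<Sum>b<N. \<Sum>d<N. 2 powr (r * real b + s * real d) * v (2 powr (p * real b + g * real d)))
      \<le> (\<Sum>d<N. 2 powr r * K * x ^ d)"
      by (subst sum.swap) (intro sum_mono inner)
    also have "\<dots> = 2 powr r * K * (\<Sum>d<N. x ^ d)" by (simp add: sum_distrib_left)
    also have "(\<Sum>d<N. x ^ d) \<le> (\<Sum>d. x ^ d)" using x by (intro sum_le_suminf summable_geometric) auto
    also have "(\<Sum>d. x ^ d) = 1 / (1 - x)" using x by (intro suminf_geometric) auto
    finally show ?thesis using K0 by (simp add: mult_left_mono)
  qed
  then show ?thesis unfolding dyadic_bounded_def by blast
qed

text \<open>The terms with d = 0 of the double sum are the single series.\<close>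

lemma single_sum_of_dyadic_bounded:
  assumes "dyadic_bounded r p s g v"
  shows "summable (\<lambda>j. 2 powr (r * real j) * v (2 powr (p * real j)))"
proof -
  obtain K where K: "(\<Sum>b<N. \<Sum>d<N. 2 powr (r * real b + s * real d) * v (2 powr (p * real b + g * real d))) \<le> K" for N
    using assms unfolding dyadic_bounded_def by blast
  show ?thesis
  proof (rule summableI_nonneg_bounded[where x = K])
    fix N :: nat
    have "2 powr (r * real b) * v (2 powr (p * real b))
      \<le> (\<Sum>d<N. 2 powr (r * real b + s * real d) * v (2 powr (p * real b + g * real d)))" if "b < N" for b
      using that member_le_sum[of 0 "{..<N}" "\<lambda>d. 2 powr (r * real b + s * real d) * v (2 powr (p * real b + g * real d))"]
      by (simp add: v_nonneg)
    then show "(\<Sum>j<N. 2 powr (r * real j) * v (2 powr (p * real j))) \<le> K"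
      by (intro order.trans[OF sum_mono K]) auto
  qed (simp add: v_nonneg)
qed

text \<open>At a tie s/g = r/p the geometric factor becomes 1 and the shifted columns are no longer
  damped. The value \<open>u j\<close> is then met once for every d whose shift is at most j, and
  the number of these d is of order j. This count is the source of the logarithm.\<close>

lemma dyadic_bounded_of_weighted_sum:
  assumes pos: "p > 0" "g > 0" "r > 0" and eq: "s * p = r * g" and gp: "g \<le> p"
    and sm: "summable (\<lambda>j. (real j + 1) * (2 powr (r * real j) * v (2 powr (p * real j))))"
  shows "dyadic_bounded r p s g v"
proof -
  define u where "u j = 2 powr (r * real j) * v (2 powr (p * real j))" for j :: nat
  define m where "m d = nat \<lfloor>g * real d / p\<rfloor>" for d :: nat
  define c where "c = p / g + 1"
  have u0: "u j \<ge> 0" for j by (simp add: u_def v_nonneg)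
  have m1: "p * real (m d) \<le> g * real d" and m2: "g * real d \<le> p * (real (m d) + 1)" and m3: "m d \<le> d" for d
  proof -
    have q0: "g * real d / p \<ge> 0" using pos by simp
    have "real (m d) \<le> g * real d / p" using q0 unfolding m_def by simp
    then show "p * real (m d) \<le> g * real d" using pos by (simp add: field_simps)
    then have "p * real (m d) \<le> p * real d" using gp by (meson order.trans mult_right_mono of_nat_0_le_iff)
    then show "m d \<le> d" using pos by simp
    have "g * real d / p \<le> real (m d) + 1" using q0 unfolding m_def by linarith
    then show "g * real d \<le> p * (real (m d) + 1)" using pos by (simp add: field_simps)
  qed
  have s: "s = r * g / p" using eq pos by (simp add: field_simps)
  have tm: "2 powr (r * real b + s * real d) * v (2 powr (p * real b + g * real d)) \<le> 2 powr r * u (b + m d)" for b d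
  proof -
    have "v (2 powr (p * real b + g * real d)) \<le> v (2 powr (p * real (b + m d)))"
      using m1[of d] by (intro v_antimono) (simp add: algebra_simps)
    moreover have "s * real d \<le> r * (real (m d) + 1)"
      using mult_left_mono[OF m2[of d], of "r / p"] pos by (simp add: s)
    then have "2 powr (r * real b + s * real d) \<le> 2 powr r * 2 powr (r * real (b + m d))"
      by (simp add: powr_add[symmetric] algebra_simps)
    ultimately show ?thesis unfolding u_def mult.assoc[symmetric]
      by (intro mult_mono) (auto simp: v_nonneg)
  qed
  \<comment> \<open>The bound \<open>m d \<le> d\<close>, which comes from g \<le> p, keeps all
    shifted indices of the N by N square below 2N.\<close>
  have inner: "(\<Sum>b<N. u (b + m d)) \<le> (\<Sum>j<2*N. if m d \<le> j then u j else 0)" if "d < N" for d N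
  proof -
    have "(\<Sum>b<N. u (b + m d)) = sum u ((\<lambda>b. b + m d) ` {..<N})" by (subst sum.reindex) auto
    also have "\<dots> \<le> sum u {j\<in>{..<2*N}. m d \<le> j}"
      using that m3[of d] u0 by (intro sum_mono2) auto
    also have "\<dots> = (\<Sum>j<2*N. if m d \<le> j then u j else 0)" by (rule sum.inter_filter) simp
    finally show ?thesis .
  qed
  have cnt: "(\<Sum>d<N. if m d \<le> j then u j else 0) \<le> c * ((real j + 1) * u j)" for N j
  proof -
    have "{d\<in>{..<N}. m d \<le> j} \<subseteq> {..nat \<lfloor>p * (real j + 1) / g\<rfloor>}"
    proof
      fix d assume "d \<in> {d\<in>{..<N}. m d \<le> j}"
      then have "p * (real (m d) + 1) \<le> p * (real j + 1)" using pos by (intro mult_left_mono) auto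
      then have "g * real d \<le> p * (real j + 1)" using m2[of d] by linarith
      then have "real d \<le> p * (real j + 1) / g" using pos by (simp add: field_simps)
      then show "d \<in> {..nat \<lfloor>p * (real j + 1) / g\<rfloor>}" by (simp add: le_nat_iff le_floor_iff)
    qed
    then have "card {d\<in>{..<N}. m d \<le> j} \<le> card {..nat \<lfloor>p * (real j + 1) / g\<rfloor>}"
      by (intro card_mono) auto
    then have "real (card {d\<in>{..<N}. m d \<le> j}) \<le> real (nat \<lfloor>p * (real j + 1) / g\<rfloor>) + 1"
      by simp
    also have "\<dots> \<le> p * (real j + 1) / g + 1" using pos by simp
    also have "\<dots> \<le> c * (real j + 1)" using pos by (simp add: c_def algebra_simps add_divide_distrib)
    finally have "real (card {d\<in>{..<N}. m d \<le> j}) * u j \<le> c * (real j + 1) * u j"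
      using u0 by (intro mult_right_mono)
    moreover have "(\<Sum>d<N. if m d \<le> j then u j else 0) = real (card {d\<in>{..<N}. m d \<le> j}) * u j"
      by (subst sum.inter_filter[symmetric]) auto
    ultimately show ?thesis by (simp add: mult.assoc)
  qed
  define K where "K = (\<Sum>j. (real j + 1) * u j)"
  have c0: "c \<ge> 0" using pos by (simp add: c_def)
  have "(\<Sum>b<N. \<Sum>d<N. 2 powr (r * real b + s * real d) * v (2 powr (p * real b + g * real d)))
      \<le> 2 powr r * (c * K)" for N :: nat
  proof -
    have "(\<Sum>b<N. \<Sum>d<N. 2 powr (r * real b + s * real d) * v (2 powr (p * real b + g * real d)))
      \<le> (\<Sum>b<N. \<Sum>d<N. 2 powr r * u (b + m d))" by (intro sum_mono tm)
    also have "\<dots> = 2 powr r * (\<Sum>d<N. \<Sum>b<N. u (b + m d))"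
      by (subst sum.swap) (simp add: sum_distrib_left)
    also have "(\<Sum>d<N. \<Sum>b<N. u (b + m d)) \<le> (\<Sum>d<N. \<Sum>j<2*N. if m d \<le> j then u j else 0)"
      by (intro sum_mono inner) auto
    also have "\<dots> = (\<Sum>j<2*N. \<Sum>d<N. if m d \<le> j then u j else 0)" by (rule sum.swap)
    also have "\<dots> \<le> (\<Sum>j<2*N. c * ((real j + 1) * u j))" by (intro sum_mono cnt)
    also have "\<dots> = c * (\<Sum>j<2*N. (real j + 1) * u j)" by (simp add: sum_distrib_left)
    also have "(\<Sum>j<2*N. (real j + 1) * u j) \<le> K"
      unfolding K_def using sm u0 by (intro sum_le_suminf) (auto simp: u_def)
    finally show ?thesis using c0 by (simp add: mult_left_mono)
  qed
  then show ?thesis unfolding dyadic_bounded_def by blast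
qed

text \<open>Reverse count: for each of the j + 1 values d \<le> j the pair (j - m d, d) contributes
  at least \<open>2 powr (- r) * u j\<close>. The shift is rounded up here, so that the arguments of
  \<open>v\<close> compare in the other direction.\<close>

lemma weighted_sum_of_dyadic_bounded:
  assumes pos: "p > 0" "g > 0" "r > 0" and eq: "s * p = r * g" and gp: "g \<le> p"
    and D: "dyadic_bounded r p s g v"
  shows "summable (\<lambda>j. (real j + 1) * (2 powr (r * real j) * v (2 powr (p * real j))))"
proof -
  define u where "u j = 2 powr (r * real j) * v (2 powr (p * real j))" for j :: nat
  define T where "T b d = 2 powr (r * real b + s * real d) * v (2 powr (p * real b + g * real d))" for b d :: nat
  define m where "m d = nat \<lceil>g * real d / p\<rceil>" for d :: nat
  have u0: "u j \<ge> 0" and T0: "T b d \<ge> 0" for j b d by (simp_all add: u_def T_def v_nonneg)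
  obtain K where K: "(\<Sum>b<N. \<Sum>d<N. T b d) \<le> K" for N
    using D unfolding dyadic_bounded_def T_def by blast
  have m1: "g * real d \<le> p * real (m d)" and m2: "p * (real (m d) - 1) \<le> g * real d" and m3: "m d \<le> d" for d
  proof -
    have q0: "g * real d / p \<ge> 0" using pos by simp
    have a: "g * real d / p \<le> real (m d)" unfolding m_def by linarith
    then show "g * real d \<le> p * real (m d)" using pos by (simp add: field_simps)
    have "real (m d) - 1 \<le> g * real d / p" using q0 unfolding m_def by linarith
    then show "p * (real (m d) - 1) \<le> g * real d" using pos by (simp add: field_simps)
    have "g * real d / p \<le> real d" using gp pos by (simp add: field_simps mult_right_mono)
    then show "m d \<le> d" unfolding m_def by (simp add: ceiling_le_iff)
  qed
  have s: "s = r * g / p" using eq pos by (simp add: field_simps)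
  have tm: "u j \<le> 2 powr r * T (j - m d) d" if "d \<le> j" for j d
  proof -
    have j: "real (j - m d) = real j - real (m d)" using that m3[of d] by simp
    have "v (2 powr (p * real j)) \<le> v (2 powr (p * real (j - m d) + g * real d))"
      using m1[of d] by (intro v_antimono) (simp add: algebra_simps j)
    moreover have "r * (real (m d) - 1) \<le> s * real d"
      using mult_left_mono[OF m2[of d], of "r / p"] pos by (simp add: s)
    then have "2 powr (r * real j) \<le> 2 powr r * 2 powr (r * real (j - m d) + s * real d)"
      by (simp add: powr_add[symmetric] algebra_simps j)
    ultimately show ?thesis unfolding u_def T_def mult.assoc[symmetric]
      by (intro mult_mono) (auto simp: v_nonneg)
  qed
  have inner: "(\<Sum>j\<in>{d..<N}. u j) \<le> 2 powr r * (\<Sum>b<N. T b d)" for d N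
  proof -
    have "(\<Sum>j\<in>{d..<N}. u j) \<le> (\<Sum>j\<in>{d..<N}. 2 powr r * T (j - m d) d)"
      by (intro sum_mono tm) auto
    also have "\<dots> = 2 powr r * (\<Sum>j\<in>{d..<N}. T (j - m d) d)" by (simp add: sum_distrib_left)
    \<comment> \<open>For j \<ge> d the subtraction on naturals is not cut off, since m d \<le> d,
      so the reindexing is injective.\<close>
    also have "(\<Sum>j\<in>{d..<N}. T (j - m d) d) = (\<Sum>b\<in>(\<lambda>j. j - m d) ` {d..<N}. T b d)"
      using m3[of d] by (subst sum.reindex) (auto simp: inj_on_def)
    also have "\<dots> \<le> (\<Sum>b<N. T b d)" using T0 by (intro sum_mono2) auto
    finally show ?thesis by simp
  qed
  show ?thesis unfolding u_def[symmetric]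
  proof (rule summableI_nonneg_bounded[where x = "2 powr r * K"])
    fix N :: nat
    have "(\<Sum>j<N. (real j + 1) * u j) = (\<Sum>j<N. \<Sum>d\<le>j. u j)" by (simp add: add.commute)
    also have "\<dots> = (\<Sum>j<N. \<Sum>d<N. if d \<le> j then u j else 0)"
    proof (rule sum.cong[OF refl])
      fix j assume "j \<in> {..<N}"
      then have "{d\<in>{..<N}. d \<le> j} = {..j}" by auto
      then show "(\<Sum>d\<le>j. u j) = (\<Sum>d<N. if d \<le> j then u j else 0)"
        using sum.inter_filter[of "{..<N}" "\<lambda>_. u j" "\<lambda>d. d \<le> j"] by simp
    qed
    also have "\<dots> = (\<Sum>d<N. \<Sum>j<N. if d \<le> j then u j else 0)" by (rule sum.swap)
    also have "\<dots> = (\<Sum>d<N. \<Sum>j\<in>{d..<N}. u j)"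
    proof (rule sum.cong[OF refl])
      fix d
      have "{j\<in>{..<N}. d \<le> j} = {d..<N}" by auto
      then show "(\<Sum>j<N. if d \<le> j then u j else 0) = (\<Sum>j\<in>{d..<N}. u j)"
        using sum.inter_filter[of "{..<N}" u "\<lambda>j. d \<le> j"] by simp
    qed
    also have "\<dots> \<le> (\<Sum>d<N. 2 powr r * (\<Sum>b<N. T b d))" by (intro sum_mono inner)
    also have "\<dots> = 2 powr r * (\<Sum>b<N. \<Sum>d<N. T b d)" by (subst sum.swap) (simp add: sum_distrib_left)
    also have "\<dots> \<le> 2 powr r * K" by (intro mult_left_mono K) simp
    finally show "(\<Sum>j<N. (real j + 1) * u j) \<le> 2 powr r * K" .
  qed (simp add: u0)
qed

end

section \<open>Tail integrals and series along level sequences\<close>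

lemma summable_levels_of_integral:
  fixes c w z :: "_ \<Rightarrow> real"
  assumes fin: "(\<integral>\<^sup>+ t. indicator {0..} t * ennreal (c t) \<partial>lborel) < \<infinity>"
    and z: "mono z" "z 0 \<ge> 0" and c: "\<And>t. 0 \<le> c t" and w: "\<And>j. 0 \<le> w j"
    and wc: "\<And>j t. t < z (Suc j) \<Longrightarrow> w (Suc j) \<le> c t"
  shows "summable (\<lambda>j::nat. (z (Suc j) - z j) * w (Suc j))"
proof -
  define J where "J = (\<integral>\<^sup>+ t. indicator {0..} t * ennreal (c t) \<partial>lborel)"
  have zm: "z i \<le> z j" if "i \<le> j" for i j using z(1) that by (simp add: monoD)
  have z0: "0 \<le> z j" for j using z(2) zm[of 0 j] by simp
  \<comment> \<open>Lower step function: the intervals [z j, z (j+1)) are disjoint, so at most one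
    summand is nonzero at t, and there c t dominates the value taken at the right end.\<close>
  have pw: "(\<Sum>j<N. indicator {z j..<z (Suc j)} t * ennreal (w (Suc j))) \<le> indicator {0..} t * ennreal (c t)"
    for N :: nat and t
  proof (cases "\<exists>i. t \<in> {z i..<z (Suc i)}")
    case True
    then obtain i where i: "z i \<le> t" "t < z (Suc i)" by auto
    have "indicator {z j..<z (Suc j)} t * ennreal (w (Suc j)) = (if j = i then ennreal (w (Suc i)) else 0)" for j
    proof (cases "j = i")
      case False
      then have "Suc j \<le> i \<or> Suc i \<le> j" by auto
      then have "t \<notin> {z j..<z (Suc j)}" using i zm[of "Suc j" i] zm[of "Suc i" j] by fastforce
      then show ?thesis using False by simp
    qed (use i in simp)
    then have "(\<Sum>j<N. indicator {z j..<z (Suc j)} t * ennreal (w (Suc j))) \<le> ennreal (w (Suc i))" by simp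
    also have "\<dots> \<le> ennreal (c t)" using wc i by (intro ennreal_leI) auto
    also have "\<dots> = indicator {0..} t * ennreal (c t)" using i z0[of i] by simp
    finally show ?thesis .
  next
    case False
    then have "indicator {z j..<z (Suc j)} t = (0::ennreal)" for j by (auto simp: indicator_def)
    then show ?thesis by simp
  qed
  show ?thesis
  proof (rule summableI_nonneg_bounded[where x = "enn2real J"])
    fix N :: nat
    have "ennreal (\<Sum>j<N. (z (Suc j) - z j) * w (Suc j)) = (\<Sum>j<N. ennreal ((z (Suc j) - z j) * w (Suc j)))"
      using zm w by (subst sum_ennreal) auto
    also have "\<dots> = (\<Sum>j<N. \<integral>\<^sup>+ t. indicator {z j..<z (Suc j)} t * ennreal (w (Suc j)) \<partial>lborel)"
      using zm w by (intro sum.cong refl) (simp add: nn_integral_multc ennreal_mult)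
    also have "\<dots> = (\<integral>\<^sup>+ t. (\<Sum>j<N. indicator {z j..<z (Suc j)} t * ennreal (w (Suc j))) \<partial>lborel)"
      by (subst nn_integral_sum) auto
    also have "\<dots> \<le> J" unfolding J_def by (intro nn_integral_mono pw)
    finally show "(\<Sum>j<N. (z (Suc j) - z j) * w (Suc j)) \<le> enn2real J"
      using fin unfolding J_def[symmetric]
      by (metis ennreal_enn2real ennreal_le_iff enn2real_nonneg infinity_ennreal_def)
  qed (use zm w in auto)
qed

lemma integral_of_summable_levels:
  fixes c w z :: "_ \<Rightarrow> real"
  assumes sm: "summable (\<lambda>j::nat. (z (Suc j) - z j) * w j)"
    and z: "mono z" "z 0 \<ge> 0" "filterlim z at_top sequentially"
    and c: "\<And>t. c t \<le> 1" and w: "\<And>j. 0 \<le> w j"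
    and wc: "\<And>j t. z j \<le> t \<Longrightarrow> c t \<le> w j"
  shows "(\<integral>\<^sup>+ t. indicator {0..} t * ennreal (c t) \<partial>lborel) < \<infinity>"
proof -
  have zm: "z i \<le> z j" if "i \<le> j" for i j using z(1) that by (simp add: monoD)
  \<comment> \<open>Upper step function: below z 0 the bound c \<le> 1 suffices, and every later t
    lies in the interval that ends at the first level above it.\<close>
  have pw: "indicator {0..} t * ennreal (c t) \<le> 
      indicator {0..<z 0} t + (\<Sum>j. indicator {z j..<z (Suc j)} t * ennreal (w j))" for t
  proof (cases "t < z 0")
    case True
    then show ?thesis using c[of t] by (cases "0 \<le> t") (auto intro!: add_increasing2 simp: ennreal_le_1)
  next
    case False
    have single_le: "G i \<le> suminf G" for G :: "nat \<Rightarrow> ennreal" and i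
      using sum_le_suminf[of G "{i}"] by simp
    have "\<exists>j. t < z j" using z(3) by (auto simp: filterlim_at_top_dense eventually_sequentially)
    define n where "n = (LEAST j. t < z j)"
    have n: "t < z n" unfolding n_def using \<open>\<exists>j. t < z j\<close> by (metis LeastI)
    then obtain j where j: "n = Suc j" using False by (cases n) auto
    have j': "z j \<le> t" using not_less_Least[of j "\<lambda>j. t < z j"] j unfolding n_def by simp
    have "indicator {0..} t * ennreal (c t) \<le> indicator {z j..<z (Suc j)} t * ennreal (w j)"
      using j' n j wc[OF j'] z(2) False by (simp add: ennreal_leI)
    also have "\<dots> \<le> (\<Sum>i. indicator {z i..<z (Suc i)} t * ennreal (w i))"
      by (rule single_le)
    finally show ?thesis by (simp add: add_increasing)
  qed
  have "(\<integral>\<^sup>+ t. indicator {0..} t * ennreal (c t) \<partial>lborel)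
      \<le> (\<integral>\<^sup>+ t. indicator {0..<z 0} t + (\<Sum>j. indicator {z j..<z (Suc j)} t * ennreal (w j)) \<partial>lborel)"
    by (intro nn_integral_mono pw)
  also have "\<dots> = (\<integral>\<^sup>+ t. indicator {0..<z 0} t \<partial>lborel)
      + (\<integral>\<^sup>+ t. (\<Sum>j. indicator {z j..<z (Suc j)} t * ennreal (w j)) \<partial>lborel)"
    by (subst nn_integral_add) auto
  also have "(\<integral>\<^sup>+ t. indicator {0..<z 0} t \<partial>lborel) = ennreal (z 0)"
    using z(2) by simp
  also have "(\<integral>\<^sup>+ t. (\<Sum>j. indicator {z j..<z (Suc j)} t * ennreal (w j)) \<partial>lborel)
      = (\<Sum>j. ennreal ((z (Suc j) - z j) * w j))"
    using zm w by (subst nn_integral_suminf) (auto simp: nn_integral_multc ennreal_mult)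
  also have "\<dots> = ennreal (\<Sum>j. (z (Suc j) - z j) * w j)"
    using sm zm w by (intro suminf_ennreal2) auto
  also have "ennreal (z 0) + ennreal (\<Sum>j. (z (Suc j) - z j) * w j) < \<infinity>" by simp
  finally show ?thesis .
qed

text \<open>Concavity of ln between 1 and 1 + y gives ln (1 + \<kappa> y) \<ge> \<kappa> ln (1 + y),
  which removes the scale. Then ln (1 + y) is at least both ln 2 and \<pi> j ln 2, and the larger of
  1 and \<pi> j is at least a fixed multiple of j + 1.\<close>

lemma ln_one_plus_powr_ge:
  fixes \<kappa> \<pi> :: real
  assumes "0 < \<kappa>" "\<kappa> \<le> 1" "\<pi> > 0"
  shows "(real j + 1) * (\<kappa> * ln 2 * min 1 \<pi> / 2) \<le> ln (1 + \<kappa> * 2 powr (\<pi> * real j))"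
proof -
  define y where "y = (2::real) powr (\<pi> * real j)"
  have y: "y \<ge> 1" unfolding y_def using assms by (intro ge_one_powr_ge_zero) auto
  have "(real j + 1) * (min 1 \<pi> / 2) \<le> max 1 (\<pi> * real j)"
  proof -
    have "(real j + 1) * min 1 \<pi> = real j * min 1 \<pi> + min 1 \<pi>" by (simp add: algebra_simps)
    also have "\<dots> \<le> \<pi> * real j + 1" using mult_left_mono[of "min 1 \<pi>" \<pi> "real j"] by (simp add: mult.commute)
    also have "\<dots> \<le> 2 * max 1 (\<pi> * real j)" by simp
    finally show ?thesis by simp
  qed
  then have "(real j + 1) * (min 1 \<pi> / 2) * ln 2 \<le> max 1 (\<pi> * real j) * ln 2"
    by (intro mult_right_mono) auto
  also have "\<dots> \<le> ln (1 + y)"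
  proof -
    have "ln y = \<pi> * real j * ln 2" unfolding y_def by (simp add: ln_powr)
    moreover have "ln y \<le> ln (1 + y)" "ln 2 \<le> ln (1 + y)" using y by auto
    ultimately show ?thesis by (simp add: max_def)
  qed
  finally have 1: "(real j + 1) * (min 1 \<pi> / 2) * ln 2 \<le> ln (1 + y)" .
  have "\<kappa> * ln (1 + y) \<le> ln (1 + \<kappa> * y)"
  proof -
    have "\<kappa> * ln (1 + y) + (1 - \<kappa>) * ln 1 \<le> ln (\<kappa> * (1 + y) + (1 - \<kappa>) * 1)"
      using concave_onD[OF ln_concave, of "1 - \<kappa>" "1 + y" 1] assms y by (simp add: add.commute)
    then show ?thesis by (simp add: algebra_simps)
  qed
  moreover have "\<kappa> * ((real j + 1) * (min 1 \<pi> / 2) * ln 2) \<le> \<kappa> * ln (1 + y)"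
    using 1 assms by (intro mult_left_mono) auto
  ultimately show ?thesis unfolding y_def by (simp add: mult_ac)
qed

lemma ln_one_plus_powr_le:
  fixes \<pi> :: real
  assumes "\<pi> > 0"
  shows "ln (1 + 2 powr (\<pi> * real j)) \<le> (1 + \<pi>) * (real j + 1)"
proof -
  have "ln (1 + 2 powr (\<pi> * real j)) \<le> ln (2 * 2 powr (\<pi> * real j))"
    using assms by (simp add: ge_one_powr_ge_zero add_pos_pos)
  also have "\<dots> = ln 2 * (1 + \<pi> * real j)" by (simp add: ln_mult ln_powr algebra_simps)
  also have "\<dots> \<le> 1 * (1 + \<pi> * real j)" using assms ln2_le_25_over_36 by (intro mult_right_mono) auto
  also have "\<dots> \<le> (1 + \<pi>) * (real j + 1)" using assms by (simp add: algebra_simps)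
  finally show ?thesis .
qed

text \<open>\<open>c\<close> plays the role of the tail of \<open>f \<bar>X\<bar>\<close> when \<open>v\<close> is the tail of \<open>\<bar>X\<bar>\<close>.\<close>
definition transformed_tail :: "(real \<Rightarrow> real) \<Rightarrow> (real \<Rightarrow> real) \<Rightarrow> (real \<Rightarrow> real) \<Rightarrow> bool" where
  "transformed_tail v f c \<longleftrightarrow> (\<forall>t. 0 \<le> c t \<and> c t \<le> 1) \<and>
     (\<forall>y\<ge>0. \<forall>t. (t < f y \<longrightarrow> v y \<le> c t) \<and> (f y \<le> t \<longrightarrow> c t \<le> v y))"

context tail_function
begin

text \<open>The levels are the images of \<kappa> 2^(\<pi> j) under the power function. They form a
  geometric sequence, so their gaps are proportional to 2^(\<rho> (j+1)).\<close>

lemma power_levels_of_integral: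
  assumes tt: "transformed_tail v (\<lambda>x. x powr (\<rho> / \<pi>)) c" and pos: "\<rho> > 0" "\<pi> > 0" "\<kappa> > 0"
    and fin: "(\<integral>\<^sup>+ t. indicator {0..} t * ennreal (c t) \<partial>lborel) < \<infinity>"
  shows "summable (\<lambda>j. 2 powr (\<rho> * real j) * v (\<kappa> * 2 powr (\<pi> * real j)))"
proof -
  define z where "z j = \<kappa> powr (\<rho> / \<pi>) * 2 powr (\<rho> * real j)" for j
  have z: "z j = (\<kappa> * 2 powr (\<pi> * real j)) powr (\<rho> / \<pi>)" for j
    using pos by (simp add: z_def powr_mult powr_powr mult.commute)
  have "summable (\<lambda>j. (z (Suc j) - z j) * v (\<kappa> * 2 powr (\<pi> * real (Suc j))))"
  proof (rule summable_levels_of_integral[OF fin])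
    show "mono z" unfolding z_def mono_def using pos by (auto intro!: mult_left_mono)
    show "v (\<kappa> * 2 powr (\<pi> * real (Suc j))) \<le> c t" if "t < z (Suc j)" for j t
      using tt pos that unfolding transformed_tail_def z by force
  qed (use tt in \<open>auto simp: z_def v_nonneg transformed_tail_def\<close>)
  moreover have "(z (Suc j) - z j) = \<kappa> powr (\<rho> / \<pi>) * (1 - 2 powr (- \<rho>)) * 2 powr (\<rho> * real (Suc j))" for j
    by (simp add: z_def powr_diff powr_add powr_minus algebra_simps divide_simps)
  ultimately have "summable (\<lambda>j. \<kappa> powr (\<rho> / \<pi>) * (1 - 2 powr (- \<rho>)) * (2 powr (\<rho> * real (Suc j)) * v (\<kappa> * 2 powr (\<pi> * real (Suc j)))))"
    by (simp add: mult.assoc)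
  moreover have "(2::real) powr (-\<rho>) < 1" using pos powr_less_cancel_iff[of 2 "-\<rho>" 0] by simp
  ultimately have "summable (\<lambda>j. 2 powr (\<rho> * real (Suc j)) * v (\<kappa> * 2 powr (\<pi> * real (Suc j))))"
    using pos by (subst (asm) summable_cmult_iff) auto
  then show ?thesis by (subst (asm) summable_Suc_iff)
qed

lemma integral_of_power_levels:
  assumes tt: "transformed_tail v (\<lambda>x. x powr (\<rho> / \<pi>)) c" and pos: "\<rho> > 0" "\<pi> > 0"
    and sm: "summable (\<lambda>j. 2 powr (\<rho> * real j) * v (2 powr (\<pi> * real j)))"
  shows "(\<integral>\<^sup>+ t. indicator {0..} t * ennreal (c t) \<partial>lborel) < \<infinity>"
proof -
  define z where "z j = (2::real) powr (\<rho> * real j)" for j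
  have z: "z j = (2 powr (\<pi> * real j)) powr (\<rho> / \<pi>)" for j
    using pos by (simp add: z_def powr_powr mult.commute)
  have lim: "filterlim z at_top sequentially" unfolding z_def using pos by real_asymp
  show ?thesis
  proof (rule integral_of_summable_levels[where z = z and w = "\<lambda>j. v (2 powr (\<pi> * real j))"])
    have "z (Suc j) - z j = (2 powr \<rho> - 1) * 2 powr (\<rho> * real j)" for j
      by (simp add: z_def powr_add algebra_simps)
    then show "summable (\<lambda>j. (z (Suc j) - z j) * v (2 powr (\<pi> * real j)))"
      using summable_mult[OF sm, of "2 powr \<rho> - 1"] by (simp add: mult.assoc)
    show "mono z" unfolding z_def mono_def using pos by (auto intro!: mult_left_mono)
    show "c t \<le> v (2 powr (\<pi> * real j))" if "z j \<le> t" for j t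
      using tt pos that unfolding transformed_tail_def z by force
  qed (use tt in \<open>auto simp: z_def[abs_def] v_nonneg transformed_tail_def intro: lim[unfolded z_def[abs_def]]\<close>)
qed

lemma log_levels_of_integral:
  assumes tt: "transformed_tail v (\<lambda>x. x powr (\<rho> / \<pi>) * ln (1 + x)) c"
    and pos: "\<rho> > 0" "\<pi> > 0" "\<kappa> > 0" "\<kappa> \<le> 1"
    and fin: "(\<integral>\<^sup>+ t. indicator {0..} t * ennreal (c t) \<partial>lborel) < \<infinity>"
  shows "summable (\<lambda>j. (real j + 1) * (2 powr (\<rho> * real j) * v (\<kappa> * 2 powr (\<pi> * real j))))"
proof -
  define y where "y j = \<kappa> * 2 powr (\<pi> * real j)" for j
  define z where "z j = y j powr (\<rho> / \<pi>) * ln (1 + y j)" for j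
  \<comment> \<open>The last division by 2 pays for the comparison of j + 2 with j + 1.\<close>
  define C where "C = \<kappa> powr (\<rho> / \<pi>) * (1 - 2 powr (- \<rho>)) * (\<kappa> * ln 2 * min 1 \<pi> / 2) / 2"
  have y0: "y j > 0" for j using pos by (simp add: y_def)
  have ym: "y i \<le> y j" if "i \<le> j" for i j using pos that by (simp add: y_def)
  have yp: "y j powr (\<rho> / \<pi>) = \<kappa> powr (\<rho> / \<pi>) * 2 powr (\<rho> * real j)" for j
    using pos by (simp add: y_def powr_mult powr_powr mult.commute)
  have zm: "mono z" unfolding mono_def z_def
    using ym y0 pos by (auto intro!: mult_mono powr_mono2 simp: add_pos_pos less_imp_le)
  have sm: "summable (\<lambda>j. (z (Suc j) - z j) * v (y (Suc j)))"
  proof (rule summable_levels_of_integral[OF fin zm])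
    show "v (y (Suc j)) \<le> c t" if "t < z (Suc j)" for j t
      using tt y0[of "Suc j"] that unfolding transformed_tail_def z_def by force
    show "z 0 \<ge> 0" using y0[of 0] by (simp add: z_def less_imp_le)
  qed (use tt in \<open>auto simp: v_nonneg transformed_tail_def\<close>)
  have \<rho>1: "(2::real) powr (-\<rho>) < 1" using pos powr_less_cancel_iff[of 2 "-\<rho>" 0] by simp
  have C: "C > 0" unfolding C_def using \<rho>1 pos by auto
  have diff: "C * ((real (Suc j) + 1) * 2 powr (\<rho> * real (Suc j))) \<le> z (Suc j) - z j" for j
  proof -
    \<comment> \<open>Only the growth of the power factor is kept; the logarithm is frozen at its
      value at the lower level.\<close>
    have "z (Suc j) - z j \<ge> y (Suc j) powr (\<rho> / \<pi>) * ln (1 + y j) - y j powr (\<rho> / \<pi>) * ln (1 + y j)"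
      unfolding z_def using ym[of j "Suc j"] y0[of j] by (auto intro!: mult_left_mono)
    also have "y (Suc j) powr (\<rho> / \<pi>) * ln (1 + y j) - y j powr (\<rho> / \<pi>) * ln (1 + y j)
        = \<kappa> powr (\<rho> / \<pi>) * (1 - 2 powr (- \<rho>)) * 2 powr (\<rho> * real (Suc j)) * ln (1 + y j)"
      unfolding yp by (simp add: powr_add powr_minus algebra_simps divide_simps)
    finally have 1: "\<kappa> powr (\<rho> / \<pi>) * (1 - 2 powr (- \<rho>)) * 2 powr (\<rho> * real (Suc j)) * ln (1 + y j) \<le> z (Suc j) - z j" .
    have "(real (Suc j) + 1) / 2 * (\<kappa> * ln 2 * min 1 \<pi> / 2) \<le> (real j + 1) * (\<kappa> * ln 2 * min 1 \<pi> / 2)"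
      using pos by (intro mult_right_mono) auto
    also have "\<dots> \<le> ln (1 + y j)" unfolding y_def using pos by (intro ln_one_plus_powr_ge) auto
    finally have "\<kappa> powr (\<rho> / \<pi>) * (1 - 2 powr (- \<rho>)) * 2 powr (\<rho> * real (Suc j)) * ((real (Suc j) + 1) / 2 * (\<kappa> * ln 2 * min 1 \<pi> / 2))
       \<le> \<kappa> powr (\<rho> / \<pi>) * (1 - 2 powr (- \<rho>)) * 2 powr (\<rho> * real (Suc j)) * ln (1 + y j)"
      using \<rho>1 by (intro mult_left_mono) auto
    with 1 show ?thesis unfolding C_def by (simp add: mult_ac)
  qed
  have "summable (\<lambda>j. C * ((real (Suc j) + 1) * (2 powr (\<rho> * real (Suc j)) * v (y (Suc j)))))"
  proof (rule summable_comparison_test'[OF sm, where N = 0])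
    fix j
    show "norm (C * ((real (Suc j) + 1) * (2 powr (\<rho> * real (Suc j)) * v (y (Suc j))))) \<le> (z (Suc j) - z j) * v (y (Suc j))"
      using mult_right_mono[OF diff[of j] v_nonneg[of "y (Suc j)"]] C v_nonneg by (simp add: mult_ac)
  qed
  then have "summable (\<lambda>j. (real (Suc j) + 1) * (2 powr (\<rho> * real (Suc j)) * v (y (Suc j))))"
    using C by (subst (asm) summable_cmult_iff) auto
  then show ?thesis unfolding y_def by (subst (asm) summable_Suc_iff)
qed

lemma integral_of_log_levels:
  assumes tt: "transformed_tail v (\<lambda>x. x powr (\<rho> / \<pi>) * ln (1 + x)) c" and pos: "\<rho> > 0" "\<pi> > 0"
    and sm: "summable (\<lambda>j. (real j + 1) * (2 powr (\<rho> * real j) * v (2 powr (\<pi> * real j))))"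
  shows "(\<integral>\<^sup>+ t. indicator {0..} t * ennreal (c t) \<partial>lborel) < \<infinity>"
proof -
  define y where "y j = (2::real) powr (\<pi> * real j)" for j
  define z where "z j = y j powr (\<rho> / \<pi>) * ln (1 + y j)" for j
  have y0: "y j > 0" for j by (simp add: y_def)
  have ym: "y i \<le> y j" if "i \<le> j" for i j using pos that by (simp add: y_def)
  have yp: "y j powr (\<rho> / \<pi>) = 2 powr (\<rho> * real j)" for j
    using pos by (simp add: y_def powr_powr mult.commute)
  have zm: "mono z" unfolding mono_def z_def
    using ym y0 pos by (auto intro!: mult_mono powr_mono2 simp: add_pos_pos less_imp_le)
  have z0: "0 \<le> z j" for j using y0[of j] by (simp add: z_def less_imp_le)
  have lim: "filterlim z at_top sequentially" unfolding z_def y_def using pos by real_asymp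
  define C where "C = 2 powr \<rho> * ((1 + \<pi>) * 2)"
  have C: "C > 0" unfolding C_def using pos by simp
  have diff: "z (Suc j) - z j \<le> C * ((real j + 1) * 2 powr (\<rho> * real j))" for j
  proof -
    \<comment> \<open>The levels grow geometrically, so dropping z j loses only a constant
      factor.\<close>
    have "z (Suc j) - z j \<le> z (Suc j)" using z0[of j] by simp
    also have "\<dots> \<le> 2 powr (\<rho> * real (Suc j)) * ((1 + \<pi>) * (real (Suc j) + 1))"
      unfolding z_def yp using ln_one_plus_powr_le[OF pos(2), of "Suc j"]
      by (intro mult_left_mono) (auto simp: y_def)
    also have "\<dots> \<le> 2 powr (\<rho> * real (Suc j)) * ((1 + \<pi>) * (2 * (real j + 1)))"
      using pos by (intro mult_left_mono) auto
    also have "\<dots> = C * ((real j + 1) * 2 powr (\<rho> * real j))"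
      by (simp add: C_def powr_add algebra_simps)
    finally show ?thesis .
  qed
  show ?thesis
  proof (rule integral_of_summable_levels[where z = z and w = "\<lambda>j. v (y j)"])
    show "summable (\<lambda>j. (z (Suc j) - z j) * v (y j))"
    proof (rule summable_comparison_test'[OF summable_mult[OF sm, of C], where N = 0])
      fix j
      have "z j \<le> z (Suc j)" using zm by (simp add: monoD)
      then show "norm ((z (Suc j) - z j) * v (y j)) \<le> C * ((real j + 1) * (2 powr (\<rho> * real j) * v (2 powr (\<pi> * real j))))"
        using mult_right_mono[OF diff[of j] v_nonneg[of "y j"]] v_nonneg by (simp add: mult_ac y_def)
    qed
    show "c t \<le> v (y j)" if "z j \<le> t" for j t
      using tt y0[of j] that unfolding transformed_tail_def z_def by force
  qed (use tt z0 zm lim in \<open>auto simp: v_nonneg transformed_tail_def\<close>)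
qed

end

section \<open>Row sums of tails and the dyadic double sum\<close>

definition moment_function :: "real \<Rightarrow> real \<Rightarrow> real \<Rightarrow> real \<Rightarrow> real" where
  "moment_function r p \<beta> x =
     (if \<beta> < - p / r then x powr ((r - 1) / (p + \<beta>))
      else if \<beta> = - p / r then x powr (r / p) * ln (1 + x)
      else x powr (r / p))"

text \<open>With k = n - i the weight is comparable to k^\<beta> n^(-\<gamma>), so the argument of
  \<open>v\<close> is a fixed threshold divided by the weight. The value k = n is absent because the
  partial sums start at i = 1.\<close>

definition row_sum :: "(real \<Rightarrow> real) \<Rightarrow> real \<Rightarrow> real \<Rightarrow> real \<Rightarrow> nat \<Rightarrow> real" where
  "row_sum v \<gamma> \<beta> \<kappa> n = (\<Sum>k=1..<n. v (\<kappa> * real n powr \<gamma> * real k powr (- \<beta>)))"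

lemma sum_dyadic_blocks:
  fixes f :: "nat \<Rightarrow> real"
  shows "(\<Sum>n=1..<2 ^ N. f n) = (\<Sum>A<N. \<Sum>n=2 ^ A..<2 ^ Suc A. f n)"
proof (induction N)
  case (Suc N)
  have "(\<Sum>n=1..<2 ^ Suc N. f n) = (\<Sum>n=1..<2 ^ N. f n) + (\<Sum>n=2 ^ N..<2 ^ Suc N. f n)"
    by (rule sum.atLeastLessThan_concat[symmetric]) auto
  with Suc show ?case by simp
qed simp

lemma powr_dyadic_block:
  fixes e :: real
  assumes "n \<in> {2 ^ A..<2 ^ Suc A}"
  shows "min 1 (2 powr e) * 2 powr (e * real A) \<le> real n powr e"
    and "real n powr e \<le> max 1 (2 powr e) * 2 powr (e * real A)"
proof -
  have "2 ^ A \<le> n" "n \<le> 2 * 2 ^ A" using assms by auto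
  then have "real (2 ^ A) \<le> real n" "real n \<le> real (2 * 2 ^ A)" by (simp_all only: of_nat_le_iff)
  then have n: "2 ^ A \<le> real n" "real n \<le> 2 * 2 ^ A" by simp_all
  have A: "((2::real) ^ A) powr e = 2 powr (e * real A)"
    by (simp add: powr_realpow[symmetric] powr_powr mult.commute)
  have A2: "(2 * (2::real) ^ A) powr e = 2 powr e * 2 powr (e * real A)"
    by (simp add: powr_mult A)
  have pos: "real n > 0" "(2::real)^A > 0" using n(1) by (auto intro: less_le_trans[rotated])
  show "min 1 (2 powr e) * 2 powr (e * real A) \<le> real n powr e"
  proof (cases "e \<ge> 0")
    case True
    have "min 1 (2 powr e) * 2 powr (e * real A) \<le> 1 * 2 powr (e * real A)" by (intro mult_right_mono) auto
    also have "\<dots> \<le> real n powr e" using powr_mono2[OF True _ n(1)] by (simp add: A)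
    finally show ?thesis .
  next
    case False
    have "min 1 (2 powr e) * 2 powr (e * real A) \<le> 2 powr e * 2 powr (e * real A)" by (intro mult_right_mono) auto
    also have "\<dots> \<le> real n powr e" using powr_mono2'[OF _ pos(1) n(2), of e] False by (simp add: A2)
    finally show ?thesis .
  qed
  show "real n powr e \<le> max 1 (2 powr e) * 2 powr (e * real A)"
  proof (cases "e \<ge> 0")
    case True
    have "real n powr e \<le> 2 powr e * 2 powr (e * real A)" using powr_mono2[OF True _ n(2)] by (simp add: A2)
    also have "\<dots> \<le> max 1 (2 powr e) * 2 powr (e * real A)" by (intro mult_right_mono) auto
    finally show ?thesis .
  next
    case False
    have "real n powr e \<le> 1 * 2 powr (e * real A)" using powr_mono2'[OF _ pos(2) n(1), of e] False by (simp add: A)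
    also have "\<dots> \<le> max 1 (2 powr e) * 2 powr (e * real A)" by (intro mult_right_mono) auto
    finally show ?thesis .
  qed
qed

text \<open>The regimes of (i) are the possible orders of (r - 1) / (p + \<beta>) and r / p, after
  clearing denominators.\<close>

lemma exponent_dichotomy:
  fixes r p \<beta> :: real
  assumes "r > 1" "p > 0" "p + \<beta> > 0"
  shows "\<beta> < - p / r \<longleftrightarrow> r * (p + \<beta>) < (r - 1) * p" and "\<beta> = - p / r \<longleftrightarrow> (r - 1) * p = r * (p + \<beta>)"
proof -
  have "\<beta> < - p / r \<longleftrightarrow> \<beta> * r < - p" "\<beta> = - p / r \<longleftrightarrow> \<beta> * r = - p"
    using pos_less_divide_eq[of r \<beta> "- p"] eq_divide_eq[of \<beta> "- p" r] assms by auto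
  then show "\<beta> < - p / r \<longleftrightarrow> r * (p + \<beta>) < (r - 1) * p" and "\<beta> = - p / r \<longleftrightarrow> (r - 1) * p = r * (p + \<beta>)"
    by (auto simp: algebra_simps)
qed

text \<open>Recovers a row sum x from 1 - exp (- x), with a factor that is harmless while x stays
  bounded. It is a rearrangement of 1 + x \<le> exp x.\<close>

lemma one_minus_exp_ge:
  fixes x :: real
  assumes "x \<ge> 0"
  shows "x \<le> (1 + x) * (1 - exp (- x))"
proof -
  have "(1 + x) * exp (- x) \<le> exp x * exp (- x)" using assms by (intro mult_right_mono) auto
  also have "\<dots> = 1" by (simp add: exp_minus)
  finally show ?thesis by (simp add: algebra_simps)
qed

context tail_function
begin

lemma tail_function_scale: "\<kappa> > 0 \<Longrightarrow> tail_function (\<lambda>x. v (\<kappa> * x))"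
  by unfold_locales (auto intro: v_nonneg v_le_1 v_antimono)

lemma row_sum_nonneg: "row_sum v \<gamma> \<beta> \<kappa> n \<ge> 0"
  by (simp add: row_sum_def sum_nonneg v_nonneg)

lemma dyadic_bounded_of_moment:
  assumes tt: "transformed_tail v (moment_function r p \<beta>) c" and par: "r > 1" "p > 0" "p + \<beta> > 0"
    and \<kappa>: "0 < \<kappa>" "\<kappa> \<le> 1"
    and fin: "(\<integral>\<^sup>+ t. indicator {0..} t * ennreal (c t) \<partial>lborel) < \<infinity>"
  shows "dyadic_bounded r p (r - 1) (p + \<beta>) (\<lambda>x. v (\<kappa> * x))"
proof -
  interpret s: tail_function "\<lambda>x. v (\<kappa> * x)" using \<kappa> by (intro tail_function_scale)
  consider "\<beta> < - p / r" | "\<beta> = - p / r" | "\<beta> > - p / r" by linarith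
  then show ?thesis
  proof cases
    case 1
    have "moment_function r p \<beta> = (\<lambda>x. x powr ((r - 1) / (p + \<beta>)))" using 1 by (simp add: moment_function_def fun_eq_iff)
    then have "summable (\<lambda>j. 2 powr ((r - 1) * real j) * v (\<kappa> * 2 powr ((p + \<beta>) * real j)))"
      using tt par \<kappa> fin by (intro power_levels_of_integral[where c = c]) auto
    \<comment> \<open>Here (r - 1) / (p + \<beta>) is the larger ratio, so the criterion is applied
      with the two pairs of exponents exchanged.\<close>
    then have "dyadic_bounded (r - 1) (p + \<beta>) r p (\<lambda>x. v (\<kappa> * x))"
      using par 1 exponent_dichotomy[OF par] by (intro s.dyadic_bounded_of_single_sum) auto
    then show ?thesis by (simp add: dyadic_bounded_swap)
  next
    case 2
    have "moment_function r p \<beta> = (\<lambda>x. x powr (r / p) * ln (1 + x))" using 2 by (simp add: moment_function_def fun_eq_iff)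
    then have "summable (\<lambda>j. (real j + 1) * (2 powr (r * real j) * v (\<kappa> * 2 powr (p * real j))))"
      using tt par \<kappa> fin by (intro log_levels_of_integral[where c = c]) auto
    moreover have "p + \<beta> \<le> p" using 2 par by simp
    ultimately show ?thesis
      using par 2 exponent_dichotomy[OF par] by (intro s.dyadic_bounded_of_weighted_sum) auto
  next
    case 3
    have "moment_function r p \<beta> = (\<lambda>x. x powr (r / p))" using 3 by (auto simp: moment_function_def fun_eq_iff)
    then have "summable (\<lambda>j. 2 powr (r * real j) * v (\<kappa> * 2 powr (p * real j)))"
      using tt par \<kappa> fin by (intro power_levels_of_integral[where c = c]) auto
    moreover have "(r - 1) * p < r * (p + \<beta>)" using 3 exponent_dichotomy[OF par] by linarith
    ultimately show ?thesis
      using par by (intro s.dyadic_bounded_of_single_sum) auto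
  qed
qed

lemma moment_of_dyadic_bounded:
  assumes tt: "transformed_tail v (moment_function r p \<beta>) c" and par: "r > 1" "p > 0" "p + \<beta> > 0"
    and D: "dyadic_bounded r p (r - 1) (p + \<beta>) v"
  shows "(\<integral>\<^sup>+ t. indicator {0..} t * ennreal (c t) \<partial>lborel) < \<infinity>"
proof -
  consider "\<beta> < - p / r" | "\<beta> = - p / r" | "\<beta> > - p / r" by linarith
  then show ?thesis
  proof cases
    case 1
    have "moment_function r p \<beta> = (\<lambda>x. x powr ((r - 1) / (p + \<beta>)))" using 1 by (simp add: moment_function_def fun_eq_iff)
    moreover have "summable (\<lambda>j. 2 powr ((r - 1) * real j) * v (2 powr ((p + \<beta>) * real j)))"
      using D by (intro single_sum_of_dyadic_bounded[of _ _ r p]) (simp add: dyadic_bounded_swap)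
    ultimately show ?thesis
      using tt par by (intro integral_of_power_levels) auto
  next
    case 2
    have "moment_function r p \<beta> = (\<lambda>x. x powr (r / p) * ln (1 + x))" using 2 by (simp add: moment_function_def fun_eq_iff)
    moreover have "p + \<beta> \<le> p" using 2 par by simp
    then have "summable (\<lambda>j. (real j + 1) * (2 powr (r * real j) * v (2 powr (p * real j))))"
      using par 2 exponent_dichotomy[OF par] D by (intro weighted_sum_of_dyadic_bounded[of p "p + \<beta>" r "r - 1"]) auto
    ultimately show ?thesis
      using tt par by (intro integral_of_log_levels) auto
  next
    case 3
    have "moment_function r p \<beta> = (\<lambda>x. x powr (r / p))" using 3 by (auto simp: moment_function_def fun_eq_iff)
    moreover have "summable (\<lambda>j. 2 powr (r * real j) * v (2 powr (p * real j)))"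
      using D by (rule single_sum_of_dyadic_bounded)
    ultimately show ?thesis
      using tt par by (intro integral_of_power_levels) auto
  qed
qed

text \<open>For n of dyadic size A and k of size b \<le> A put d = A - b. Then n^\<gamma>
  k^(-\<beta>) has size 2^(pb + \<gamma> d), and the 2^(A + b) pairs, each of weight about 2^((r -
  2) A), have total weight 2^(rb + (r - 1) d). The two minima in the condition on \<kappa>' absorb
  the variation inside the blocks.\<close>

lemma summable_row_sums_of_dyadic_bounded:
  assumes D: "dyadic_bounded r p (r - 1) (p + \<beta>) (\<lambda>x. v (\<kappa>' * x))"
    and \<kappa>': "\<kappa>' \<le> \<kappa> * (min 1 (2 powr (p + \<beta>)) * min 1 (2 powr (- \<beta>)))" and \<kappa>: "\<kappa> > 0"
  shows "summable (\<lambda>n. real n powr (r - 2) * row_sum v (p + \<beta>) \<beta> \<kappa> n)"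
proof -
  define \<gamma> where "\<gamma> = p + \<beta>"
  define M where "M = max 1 (2 powr (r - 2))"
  define T where "T b d = 2 powr (r * real b + (r - 1) * real d) * v (\<kappa>' * 2 powr (p * real b + \<gamma> * real d))" for b d :: nat
  have T0: "T b d \<ge> 0" for b d by (simp add: T_def v_nonneg)
  obtain K where K: "(\<Sum>b<N. \<Sum>d<N. T b d) \<le> K" for N
    using D unfolding dyadic_bounded_def T_def \<gamma>_def by blast
  have M: "M > 0" by (simp add: M_def)
  define h where "h n = real n powr (r - 2) * row_sum v \<gamma> \<beta> \<kappa> n" for n
  have h0: "h n \<ge> 0" for n by (simp add: h_def row_sum_nonneg)
  have entry: "v (\<kappa> * real n powr \<gamma> * real k powr (- \<beta>)) \<le> v (\<kappa>' * 2 powr (p * real b + \<gamma> * real (A - b)))"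
    if n: "n \<in> {2 ^ A..<2 ^ Suc A}" and k: "k \<in> {2 ^ b..<2 ^ Suc b}" and "b \<le> A" for n k A b
  proof -
    have e: "2 powr (p * real b + \<gamma> * real (A - b)) = 2 powr (\<gamma> * real A) * 2 powr (- \<beta> * real b)"
      using \<open>b \<le> A\<close> by (simp add: \<gamma>_def powr_add[symmetric] algebra_simps)
    have "\<kappa>' * 2 powr (p * real b + \<gamma> * real (A - b))
        \<le> \<kappa> * (min 1 (2 powr \<gamma>) * min 1 (2 powr (- \<beta>))) * (2 powr (\<gamma> * real A) * 2 powr (- \<beta> * real b))"
      unfolding e using \<kappa>' by (intro mult_right_mono) (auto simp: \<gamma>_def)
    also have "\<kappa> * (min 1 (2 powr \<gamma>) * min 1 (2 powr (- \<beta>))) * (2 powr (\<gamma> * real A) * 2 powr (- \<beta> * real b))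
        = \<kappa> * ((min 1 (2 powr \<gamma>) * 2 powr (\<gamma> * real A)) * (min 1 (2 powr (- \<beta>)) * 2 powr (- \<beta> * real b)))"
      by (simp only: mult_ac)
    also have "\<dots> \<le> \<kappa> * (real n powr \<gamma> * real k powr (- \<beta>))"
      using powr_dyadic_block(1)[OF n, of \<gamma>] powr_dyadic_block(1)[OF k, of "-\<beta>"] \<kappa>
      by (intro mult_left_mono mult_mono) auto
    finally show ?thesis by (intro v_antimono) (simp add: mult.assoc)
  qed
  have row: "row_sum v \<gamma> \<beta> \<kappa> n \<le> (\<Sum>b\<le>A. 2 ^ b * v (\<kappa>' * 2 powr (p * real b + \<gamma> * real (A - b))))"
    if n: "n \<in> {2 ^ A..<2 ^ Suc A}" for n A
  proof -
    have "row_sum v \<gamma> \<beta> \<kappa> n \<le> (\<Sum>k=1..<2 ^ Suc A. v (\<kappa> * real n powr \<gamma> * real k powr (- \<beta>)))"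
      unfolding row_sum_def using n by (intro sum_mono2) (auto simp: v_nonneg)
    also have "\<dots> = (\<Sum>b<Suc A. \<Sum>k=2 ^ b..<2 ^ Suc b. v (\<kappa> * real n powr \<gamma> * real k powr (- \<beta>)))"
      by (rule sum_dyadic_blocks)
    also have "\<dots> \<le> (\<Sum>b<Suc A. \<Sum>k=(2::nat) ^ b..<2 ^ Suc b. v (\<kappa>' * 2 powr (p * real b + \<gamma> * real (A - b))))"
      using n by (intro sum_mono entry) auto
    also have "\<dots> = (\<Sum>b\<le>A. 2 ^ b * v (\<kappa>' * 2 powr (p * real b + \<gamma> * real (A - b))))"
      by (simp add: lessThan_Suc_atMost)
    finally show ?thesis .
  qed
  have block: "(\<Sum>n=2 ^ A..<2 ^ Suc A. h n) \<le> M * (\<Sum>b\<le>A. T b (A - b))" for A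
  proof -
    have "(\<Sum>n=2 ^ A..<2 ^ Suc A. h n) \<le> (\<Sum>n=(2::nat) ^ A..<2 ^ Suc A. M * 2 powr ((r - 2) * real A) *
        (\<Sum>b\<le>A. 2 ^ b * v (\<kappa>' * 2 powr (p * real b + \<gamma> * real (A - b)))))"
      unfolding h_def M_def by (intro sum_mono mult_mono powr_dyadic_block row) (auto simp: row_sum_nonneg)
    also have "\<dots> = 2 ^ A * (M * 2 powr ((r - 2) * real A) *
        (\<Sum>b\<le>A. 2 ^ b * v (\<kappa>' * 2 powr (p * real b + \<gamma> * real (A - b)))))" by simp
    also have "\<dots> = M * (\<Sum>b\<le>A. (2 ^ A * 2 powr ((r - 2) * real A) * 2 ^ b) * v (\<kappa>' * 2 powr (p * real b + \<gamma> * real (A - b))))"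
      by (simp add: sum_distrib_left mult_ac)
    also have "\<dots> = M * (\<Sum>b\<le>A. T b (A - b))"
    proof -
      have "(2::real) ^ A * 2 powr ((r - 2) * real A) * 2 ^ b = 2 powr (r * real b + (r - 1) * real (A - b))" if "b \<le> A" for b
        using that by (simp add: powr_realpow[symmetric] powr_add[symmetric] algebra_simps)
      then show ?thesis unfolding T_def by simp
    qed
    finally show ?thesis .
  qed
  show ?thesis unfolding \<gamma>_def[symmetric] h_def[symmetric]
  proof (rule summableI_nonneg_bounded[where x = "M * K"])
    fix N :: nat
    have "(\<Sum>n<N. h n) \<le> (\<Sum>n=1..<2 ^ N. h n)"
    proof -
      have "h 0 = 0" by (simp add: h_def row_sum_def)
      then have "(\<Sum>n<N. h n) = (\<Sum>n=1..<N. h n)"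
        by (cases N) (simp_all add: lessThan_atLeast0 sum.atLeast_Suc_lessThan)
      also have "\<dots> \<le> (\<Sum>n=1..<2 ^ N. h n)"
        using less_exp[of N] h0 by (intro sum_mono2) auto
      finally show ?thesis .
    qed
    also have "\<dots> \<le> (\<Sum>A<N. M * (\<Sum>b\<le>A. T b (A - b)))"
      unfolding sum_dyadic_blocks by (intro sum_mono block)
    also have "\<dots> = M * (\<Sum>(b, d)\<in>{(i, j). i + j < N}. T b d)"
      by (simp add: sum_distrib_left sum.triangle_reindex)
    also have "(\<Sum>(b, d)\<in>{(i, j). i + j < N}. T b d) \<le> (\<Sum>(b, d)\<in>{..<N} \<times> {..<N}. T b d)"
      using T0 by (intro sum_mono2) auto
    also have "\<dots> \<le> K" using K[of N] by (simp add: sum.cartesian_product)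
    finally show "(\<Sum>n<N. h n) \<le> M * K" using M by simp
  qed (rule h0)
qed

text \<open>The reverse comparison takes n one dyadic block higher: for n \<ge> 2^(A + 1) the row
  contains the full k-blocks 0 to A. The move multiplies the argument by
  \<open>2 powr (p + \<beta>)\<close>, which is the last factor in the condition on
  \<kappa>.\<close>

lemma dyadic_bounded_of_summable_row_sums:
  assumes sm: "summable (\<lambda>n. real n powr (r - 2) * row_sum v (p + \<beta>) \<beta> \<kappa> n)" and \<kappa>: "\<kappa> > 0"
    and \<kappa>1: "\<kappa> * (max 1 (2 powr (p + \<beta>)) * max 1 (2 powr (- \<beta>))) * 2 powr (p + \<beta>) \<le> 1"
  shows "dyadic_bounded r p (r - 1) (p + \<beta>) v"
proof -
  define \<gamma> where "\<gamma> = p + \<beta>"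
  define m where "m = min 1 ((2::real) powr (r - 2)) * 2 powr (r - 1)"
  define T where "T b d = 2 powr (r * real b + (r - 1) * real d) * v (2 powr (p * real b + \<gamma> * real d))" for b d :: nat
  have T0: "T b d \<ge> 0" for b d by (simp add: T_def v_nonneg)
  have m: "m > 0" by (simp add: m_def)
  define h where "h n = real n powr (r - 2) * row_sum v \<gamma> \<beta> \<kappa> n" for n
  have h0: "h n \<ge> 0" for n by (simp add: h_def row_sum_nonneg)
  have smh: "summable h" using sm by (simp add: h_def[abs_def] \<gamma>_def)
  have entry: "v (2 powr (p * real b + \<gamma> * real (A - b))) \<le> v (\<kappa> * real n powr \<gamma> * real k powr (- \<beta>))"
    if n: "n \<in> {2 ^ Suc A..<2 ^ Suc (Suc A)}" and k: "k \<in> {2 ^ b..<2 ^ Suc b}" and "b \<le> A" for n k A b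
  proof -
    have "\<kappa> * (real n powr \<gamma> * real k powr (- \<beta>))
      \<le> \<kappa> * ((max 1 (2 powr \<gamma>) * 2 powr (\<gamma> * real (Suc A))) * (max 1 (2 powr (- \<beta>)) * 2 powr (- \<beta> * real b)))"
      using powr_dyadic_block(2)[OF n, of \<gamma>] powr_dyadic_block(2)[OF k, of "-\<beta>"] \<kappa>
      by (intro mult_left_mono mult_mono) auto
    also have "\<dots> = \<kappa> * (max 1 (2 powr \<gamma>) * max 1 (2 powr (- \<beta>))) * (2 powr (\<gamma> * real (Suc A)) * 2 powr (- \<beta> * real b))"
      by (simp only: mult_ac)
    also have "2 powr (\<gamma> * real (Suc A)) * 2 powr (- \<beta> * real b) = 2 powr \<gamma> * 2 powr (p * real b + \<gamma> * real (A - b))"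
      using \<open>b \<le> A\<close> by (simp add: \<gamma>_def powr_add[symmetric] algebra_simps)
    also have "\<kappa> * (max 1 (2 powr \<gamma>) * max 1 (2 powr (- \<beta>))) * (2 powr \<gamma> * 2 powr (p * real b + \<gamma> * real (A - b)))
       \<le> 1 * 2 powr (p * real b + \<gamma> * real (A - b))"
      using \<kappa>1 unfolding mult.assoc[symmetric] \<gamma>_def by (intro mult_right_mono) auto
    finally show ?thesis by (intro v_antimono) (simp add: mult.assoc)
  qed
  have row: "(\<Sum>b\<le>A. 2 ^ b * v (2 powr (p * real b + \<gamma> * real (A - b)))) \<le> row_sum v \<gamma> \<beta> \<kappa> n"
    if n: "n \<in> {2 ^ Suc A..<2 ^ Suc (Suc A)}" for n A
  proof -
    have "(\<Sum>b\<le>A. 2 ^ b * v (2 powr (p * real b + \<gamma> * real (A - b))))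
      = (\<Sum>b<Suc A. \<Sum>k=(2::nat) ^ b..<2 ^ Suc b. v (2 powr (p * real b + \<gamma> * real (A - b))))"
      by (simp add: lessThan_Suc_atMost)
    also have "\<dots> \<le> (\<Sum>b<Suc A. \<Sum>k=2 ^ b..<2 ^ Suc b. v (\<kappa> * real n powr \<gamma> * real k powr (- \<beta>)))"
      using n by (intro sum_mono entry) auto
    also have "\<dots> = (\<Sum>k=1..<2 ^ Suc A. v (\<kappa> * real n powr \<gamma> * real k powr (- \<beta>)))"
      by (rule sum_dyadic_blocks[symmetric])
    also have "\<dots> \<le> row_sum v \<gamma> \<beta> \<kappa> n"
      unfolding row_sum_def using n by (intro sum_mono2) (auto simp: v_nonneg)
    finally show ?thesis .
  qed
  have block: "m * (\<Sum>b\<le>A. T b (A - b)) \<le> (\<Sum>n=2 ^ Suc A..<2 ^ Suc (Suc A). h n)" for A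
  proof -
    have "m * (\<Sum>b\<le>A. T b (A - b)) = m * (\<Sum>b\<le>A. (2 powr ((r - 1) * real A) * 2 ^ b) * v (2 powr (p * real b + \<gamma> * real (A - b))))"
    proof -
      have "(2::real) powr ((r - 1) * real A) * 2 ^ b = 2 powr (r * real b + (r - 1) * real (A - b))" if "b \<le> A" for b
        using that by (simp add: powr_realpow[symmetric] powr_add[symmetric] algebra_simps)
      then show ?thesis unfolding T_def by simp
    qed
    also have "\<dots> = (m * 2 powr ((r - 1) * real A)) * (\<Sum>b\<le>A. 2 ^ b * v (2 powr (p * real b + \<gamma> * real (A - b))))"
      by (simp add: sum_distrib_left mult_ac)
    also have "m * 2 powr ((r - 1) * real A) = 2 ^ Suc A * (min 1 (2 powr (r - 2)) * 2 powr ((r - 2) * real (Suc A)))"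
    proof -
      have e: "2 powr (r - 1) * 2 powr ((r - 1) * real A) = (2::real) ^ Suc A * 2 powr ((r - 2) * real (Suc A))"
        by (simp add: powr_realpow[symmetric] powr_add[symmetric] algebra_simps del: power_Suc)
      show ?thesis unfolding m_def mult.assoc e by (simp only: mult.left_commute)
    qed
    also have "\<dots> * (\<Sum>b\<le>A. 2 ^ b * v (2 powr (p * real b + \<gamma> * real (A - b))))
      = (\<Sum>n=(2::nat) ^ Suc A..<2 ^ Suc (Suc A). (min 1 (2 powr (r - 2)) * 2 powr ((r - 2) * real (Suc A))) *
          (\<Sum>b\<le>A. 2 ^ b * v (2 powr (p * real b + \<gamma> * real (A - b)))))" by simp
    also have "\<dots> \<le> (\<Sum>n=2 ^ Suc A..<2 ^ Suc (Suc A). h n)"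
      unfolding h_def by (intro sum_mono mult_mono powr_dyadic_block row) (auto intro!: sum_nonneg mult_nonneg_nonneg simp: v_nonneg)
    finally show ?thesis .
  qed
  have "(\<Sum>b<N. \<Sum>d<N. T b d) \<le> suminf h / m" for N
  proof -
    have "m * (\<Sum>b<N. \<Sum>d<N. T b d) = m * (\<Sum>(b, d)\<in>{..<N} \<times> {..<N}. T b d)"
      by (simp add: sum.cartesian_product)
    \<comment> \<open>The square of side N lies inside the triangle b + d < 2N, which is what the
      blocks A < 2N cover.\<close>
    also have "(\<Sum>(b, d)\<in>{..<N} \<times> {..<N}. T b d) \<le> (\<Sum>(b, d)\<in>{(i, j). i + j < 2 * N}. T b d)"
    proof (rule sum_mono2)
      have "{(i, j). i + j < 2 * N} \<subseteq> {..<2 * N} \<times> {..<2 * N}" by auto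
      then show "finite {(i, j). i + j < 2 * N}" by (rule finite_subset) auto
    qed (use T0 in auto)
    also have "m * (\<Sum>(b, d)\<in>{(i, j). i + j < 2 * N}. T b d) = (\<Sum>A<2 * N. m * (\<Sum>b\<le>A. T b (A - b)))"
      by (simp add: sum_distrib_left sum.triangle_reindex)
    also have "\<dots> \<le> (\<Sum>A<2 * N. \<Sum>n=2 ^ Suc A..<2 ^ Suc (Suc A). h n)" by (intro sum_mono block)
    also have "\<dots> \<le> (\<Sum>A<Suc (2 * N). \<Sum>n=2 ^ A..<2 ^ Suc A. h n)"
      unfolding sum.lessThan_Suc_shift[of _ "2 * N"] using h0 by (simp add: sum_nonneg)
    also have "\<dots> = (\<Sum>n=1..<2 ^ Suc (2 * N). h n)" by (rule sum_dyadic_blocks[symmetric])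
    also have "\<dots> \<le> suminf h" using smh h0 by (intro sum_le_suminf) auto
    finally show ?thesis using m by (simp add: field_simps)
  qed
  then show ?thesis unfolding dyadic_bounded_def T_def \<gamma>_def by blast
qed

text \<open>Comparing \<open>m\<close> with all \<open>n\<close> in \<open>[m, 2m)\<close> shows that the row sums are eventually at most \<open>1\<close>;
  a single \<open>n\<close> would not suffice, because \<open>n\<^bsup>r-2\<^esup>\<close> tends to \<open>0\<close> when \<open>r < 2\<close>.\<close>
lemma summable_row_sums_of_exp:
  assumes sm: "\<And>\<kappa>. \<kappa> > 0 \<Longrightarrow> summable (\<lambda>n. real n powr (r - 2) * (1 - exp (- row_sum v \<gamma> \<beta> \<kappa> n)))"
    and r: "r > 1" and \<gamma>: "\<gamma> > 0" and \<kappa>: "\<kappa> > 0"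
  shows "summable (\<lambda>n. real n powr (r - 2) * row_sum v \<gamma> \<beta> \<kappa> n)"
proof -
  \<comment> \<open>The factor makes up for n < 2m: the threshold at n with \<kappa>' stays below
    the threshold at m with \<kappa>.\<close>
  define \<kappa>' where "\<kappa>' = \<kappa> * 2 powr (- \<gamma>)"
  have \<kappa>': "\<kappa>' > 0" using \<kappa> by (simp add: \<kappa>'_def)
  define h where "h n = real n powr (r - 2) * (1 - exp (- row_sum v \<gamma> \<beta> \<kappa>' n))" for n
  have h0: "h n \<ge> 0" for n by (simp add: h_def row_sum_nonneg)
  have smh: "summable h" using sm[OF \<kappa>'] by (simp add: h_def[abs_def])
  define c where "c = min 1 ((2::real) powr (r - 2))"
  have c: "c > 0" by (simp add: c_def)
  have cmp: "row_sum v \<gamma> \<beta> \<kappa> m \<le> row_sum v \<gamma> \<beta> \<kappa>' n" if "m \<le> n" "n < 2 * m" for m n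
  proof -
    have "row_sum v \<gamma> \<beta> \<kappa> m \<le> (\<Sum>k=1..<m. v (\<kappa>' * real n powr \<gamma> * real k powr (- \<beta>)))"
      unfolding row_sum_def
    proof (intro sum_mono v_antimono mult_right_mono)
      have "real n powr \<gamma> \<le> (2 * real m) powr \<gamma>" using that \<gamma> by (intro powr_mono2) auto
      then have "\<kappa>' * real n powr \<gamma> \<le> \<kappa>' * (2 * real m) powr \<gamma>" using \<kappa>' by (intro mult_left_mono) auto
      also have "\<dots> = \<kappa> * real m powr \<gamma>" by (simp add: \<kappa>'_def powr_mult powr_minus)
      finally show "\<kappa>' * real n powr \<gamma> \<le> \<kappa> * real m powr \<gamma>" .
    qed auto
    also have "\<dots> \<le> row_sum v \<gamma> \<beta> \<kappa>' n"
      unfolding row_sum_def using that by (intro sum_mono2) (auto simp: v_nonneg)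
    finally show ?thesis .
  qed
  have low: "c * real m powr (r - 2) \<le> real n powr (r - 2)" if "m \<le> n" "n < 2 * m" for m n
  proof (cases "r \<ge> 2")
    case True
    have "c * real m powr (r - 2) \<le> 1 * real m powr (r - 2)" by (intro mult_right_mono) (auto simp: c_def)
    also have "\<dots> \<le> real n powr (r - 2)" using that True by (simp add: powr_mono2)
    finally show ?thesis .
  next
    case False
    have "c * real m powr (r - 2) \<le> 2 powr (r - 2) * real m powr (r - 2)" by (intro mult_right_mono) (auto simp: c_def)
    also have "\<dots> = (2 * real m) powr (r - 2)" by (simp add: powr_mult)
    also have "\<dots> \<le> real n powr (r - 2)" using that False by (intro powr_mono2') auto
    finally show ?thesis .
  qed
  \<comment> \<open>Adding the m indices of [m, 2m) raises the weight from m^(r-2) to m^(r-1), which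
    tends to infinity for every r > 1.\<close>
  have bound: "1 - exp (- row_sum v \<gamma> \<beta> \<kappa> m) \<le> suminf h / c * real m powr (1 - r)" if "m > 0" for m
  proof -
    have "c * (real m powr (r - 1) * (1 - exp (- row_sum v \<gamma> \<beta> \<kappa> m)))
      = (\<Sum>n=m..<2*m. c * real m powr (r - 2) * (1 - exp (- row_sum v \<gamma> \<beta> \<kappa> m)))"
      using that by (simp add: powr_mult_base)
    also have "\<dots> \<le> (\<Sum>n=m..<2*m. h n)"
      unfolding h_def using low cmp by (intro sum_mono mult_mono) (auto simp: row_sum_nonneg)
    also have "\<dots> \<le> suminf h" using smh h0 by (intro sum_le_suminf) auto
    finally have *: "c * real m powr (r - 1) * (1 - exp (- row_sum v \<gamma> \<beta> \<kappa> m)) \<le> suminf h" by (simp add: mult.assoc)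
    moreover have "real m powr (1 - r) = 1 / real m powr (r - 1)"
      by (metis minus_diff_eq powr_minus_divide)
    ultimately have "suminf h / c * real m powr (1 - r) = suminf h / (c * real m powr (r - 1))"
      and "0 < c * real m powr (r - 1)" using c that by simp_all
    then show ?thesis
      using * by (simp add: pos_le_divide_eq mult.commute del: mult_less_0_iff)
  qed
  have "((\<lambda>m. real m powr (1 - r)) \<longlongrightarrow> 0) sequentially" using r by real_asymp
  then have "((\<lambda>m. suminf h / c * real m powr (1 - r)) \<longlongrightarrow> 0) sequentially"
    by (rule tendsto_mult_right_zero)
  then have ev: "eventually (\<lambda>m. suminf h / c * real m powr (1 - r) < 1 / 2) sequentially"
    by (rule order_tendstoD) simp
  have "eventually (\<lambda>m. row_sum v \<gamma> \<beta> \<kappa> m \<le> 2 * (1 - exp (- row_sum v \<gamma> \<beta> \<kappa> m))) sequentially"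
    using ev eventually_gt_at_top[of 0]
  proof eventually_elim
    case (elim m)
    define x where "x = row_sum v \<gamma> \<beta> \<kappa> m"
    have x: "x \<ge> 0" by (simp add: x_def row_sum_nonneg)
    have e: "1 - exp (- x) \<le> 1 / 2" using bound[OF elim(2)] elim(1) unfolding x_def by linarith
    \<comment> \<open>From 1 - exp (- x) \<le> 1/2 follows x \<le> (1 + x)/2, hence x \<le> 1, and
      then the factor 1 + x is at most 2.\<close>
    have "(1 + x) * (1 - exp (- x)) \<le> (1 + x) * (1 / 2)" using e x by (intro mult_left_mono) auto
    then have "x \<le> 1" using one_minus_exp_ge[OF x] by simp
    then have "(1 + x) * (1 - exp (- x)) \<le> 2 * (1 - exp (- x))" using x by (intro mult_right_mono) auto
    then show ?case using one_minus_exp_ge[OF x] by (simp add: x_def)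
  qed
  then have "eventually (\<lambda>n. norm (real n powr (r - 2) * row_sum v \<gamma> \<beta> \<kappa> n) \<le>
      2 * (real n powr (r - 2) * (1 - exp (- row_sum v \<gamma> \<beta> \<kappa> n)))) sequentially"
  proof eventually_elim
    case (elim n)
    then show ?case
      using mult_left_mono[OF elim, of "real n powr (r - 2)"] by (simp add: row_sum_nonneg algebra_simps)
  qed
  then show ?thesis using summable_mult[OF sm[OF \<kappa>], of 2] by (rule summable_comparison_test_ev)
qed

end

section \<open>Sublinear expectations\<close>

locale sublinear_expectation =
  fixes F :: "'a set set" and H :: "('a \<Rightarrow> real) set" and E :: "('a \<Rightarrow> real) \<Rightarrow> ereal"
  assumes sublinear: "sublinear_space F H E"
begin

lemma sigma: "sigma_algebra UNIV F"
  using sublinear unfolding sublinear_space_def by blast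

lemma H_measurable: "Y \<in> H \<Longrightarrow> Y \<in> borel_measurable (msp F)"
  using sublinear unfolding sublinear_space_def by blast

lemma indicator_H: "A \<in> F \<Longrightarrow> indicator A \<in> H"
  using sublinear unfolding sublinear_space_def by blast

lemma loc_lip_H: "loc_lip (length Ys) \<phi> \<Longrightarrow> set Ys \<subseteq> H \<Longrightarrow> (\<lambda>\<omega>. \<phi> (map (\<lambda>Y. Y \<omega>) Ys)) \<in> H"
  using sublinear unfolding sublinear_space_def by blast

lemma E_mono: "Y \<in> H \<Longrightarrow> Z \<in> H \<Longrightarrow> (\<And>\<omega>. Y \<omega> \<le> Z \<omega>) \<Longrightarrow> E Y \<le> E Z"
  using sublinear unfolding sublinear_space_def by blast

lemma E_const: "E (\<lambda>_. c) = ereal c"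
  using sublinear unfolding sublinear_space_def by blast

lemma E_scale: "Y \<in> H \<Longrightarrow> c \<ge> 0 \<Longrightarrow> E (\<lambda>\<omega>. c * Y \<omega>) = ereal c * E Y"
  using sublinear unfolding sublinear_space_def by blast

lemma E_add: "Y \<in> H \<Longrightarrow> Z \<in> H \<Longrightarrow> \<not> (E Y = \<infinity> \<and> E Z = -\<infinity>) \<Longrightarrow> \<not> (E Y = -\<infinity> \<and> E Z = \<infinity>)
    \<Longrightarrow> E (\<lambda>\<omega>. Y \<omega> + Z \<omega>) \<le> E Y + E Z"
  using sublinear unfolding sublinear_space_def by blast

lemma E_countable: "Y \<in> H \<Longrightarrow> (\<And>n. Yn n \<in> H) \<Longrightarrow> (\<And>n \<omega>. Yn n \<omega> \<ge> 0) \<Longrightarrow> (\<And>\<omega>. Y \<omega> \<ge> 0)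
    \<Longrightarrow> (\<And>\<omega>. ereal (Y \<omega>) \<le> (\<Sum>n. ereal (Yn n \<omega>))) \<Longrightarrow> E Y \<le> (\<Sum>n. E (Yn n))"
  using sublinear unfolding sublinear_space_def by blast

lemma space_msp: "space (msp F) = UNIV" and sets_msp: "sets (msp F) = F"
proof -
  interpret sigma_algebra UNIV F by (rule sigma)
  show "space (msp F) = UNIV" unfolding msp_def by simp
  show "sets (msp F) = F" unfolding msp_def using sigma_sets_eq by simp
qed

lemma vimage_F: "Y \<in> H \<Longrightarrow> A \<in> sets borel \<Longrightarrow> {\<omega>. Y \<omega> \<in> A} \<in> F"
  using measurable_sets[OF H_measurable, of Y A] by (simp add: space_msp sets_msp vimage_def)

lemma const_H: "(\<lambda>_. c) \<in> H"
proof -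
  have "loc_lip 0 (\<lambda>_. c)" unfolding loc_lip_def by (rule exI[of _ 0]) simp
  then show ?thesis using loc_lip_H[of "[]" "\<lambda>_. c"] by simp
qed

lemma lipschitz_H:
  assumes "Y \<in> H" and L: "\<And>x y. \<bar>f x - f y\<bar> \<le> L * \<bar>x - y :: real\<bar>"
  shows "(\<lambda>\<omega>. f (Y \<omega>)) \<in> H"
proof -
  have "loc_lip 1 (\<lambda>x. f (hd x))"
    unfolding loc_lip_def
  \<comment> \<open>With exponent 0 the growth factor is the constant 3.\<close>
  proof (rule exI[of _ "\<bar>L\<bar>"], rule exI[of _ 0], intro allI impI)
    fix x y :: "real list" assume "length x = 1" "length y = 1"
    then obtain u w where xy: "x = [u]" "y = [w]" by (auto simp: length_Suc_conv)
    have "\<bar>f u - f w\<bar> \<le> \<bar>L\<bar> * 3 * \<bar>u - w\<bar>"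
      using L[of u w] mult_right_mono[of L "\<bar>L\<bar> * 3" "\<bar>u - w\<bar>"] by linarith
    then show "\<bar>f (hd x) - f (hd y)\<bar> \<le> \<bar>L\<bar> * (1 + lnorm x ^ 0 + lnorm y ^ 0) * lnorm (ldiff x y)"
      by (simp add: xy lnorm_def ldiff_def)
  qed
  then show ?thesis using loc_lip_H[of "[Y]" "\<lambda>x. f (hd x)"] assms(1) by simp
qed

lemma lnorm2: "\<bar>a\<bar> \<le> lnorm [a, b]" "\<bar>b\<bar> \<le> lnorm [a, b]"
  by (simp_all add: lnorm_def real_le_rsqrt)

lemma add_H:
  assumes "Y \<in> H" "Z \<in> H" shows "(\<lambda>\<omega>. Y \<omega> + Z \<omega>) \<in> H"
proof -
  have "loc_lip 2 (\<lambda>x. x ! 0 + x ! 1)"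
    unfolding loc_lip_def
  proof (rule exI[of _ 1], rule exI[of _ 0], intro allI impI)
    fix x y :: "real list" assume "length x = 2" "length y = 2"
    then obtain a b c d where xy: "x = [a, b]" "y = [c, d]" by (auto simp: length_Suc_conv numeral_2_eq_2)
    show "\<bar>x ! 0 + x ! 1 - (y ! 0 + y ! 1)\<bar> \<le> 1 * (1 + lnorm x ^ 0 + lnorm y ^ 0) * lnorm (ldiff x y)"
      using lnorm2(1)[of "a - c" "b - d"] lnorm2(2)[of "b - d" "a - c"] by (simp add: xy ldiff_def)
  qed
  then show ?thesis using loc_lip_H[of "[Y, Z]" "\<lambda>x. x ! 0 + x ! 1"] assms by (simp add: numeral_2_eq_2)
qed

text \<open>The identity ab - cd = a(b - d) + d(a - c) shows that the product has a Lipschitz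
  constant of linear growth, hence the exponent 1.\<close>

lemma mult_H:
  assumes "Y \<in> H" "Z \<in> H" shows "(\<lambda>\<omega>. Y \<omega> * Z \<omega>) \<in> H"
proof -
  have "loc_lip 2 (\<lambda>x. x ! 0 * x ! 1)"
    unfolding loc_lip_def
  proof (rule exI[of _ 1], rule exI[of _ 1], intro allI impI)
    fix x y :: "real list" assume "length x = 2" "length y = 2"
    then obtain a b c d where xy: "x = [a, b]" "y = [c, d]" by (auto simp: length_Suc_conv numeral_2_eq_2)
    have D: "\<bar>a - c\<bar> \<le> lnorm [a - c, b - d]" "\<bar>b - d\<bar> \<le> lnorm [a - c, b - d]" by (rule lnorm2)+
    have "\<bar>a * b - c * d\<bar> = \<bar>a * (b - d) + d * (a - c)\<bar>" by (simp add: algebra_simps)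
    also have "\<dots> \<le> \<bar>a\<bar> * \<bar>b - d\<bar> + \<bar>d\<bar> * \<bar>a - c\<bar>" by (metis abs_mult abs_triangle_ineq)
    also have "\<dots> \<le> lnorm [a, b] * lnorm [a - c, b - d] + lnorm [c, d] * lnorm [a - c, b - d]"
      using lnorm2[of a b] lnorm2[of d c] lnorm2[of c d] D by (intro add_mono mult_mono) auto
    also have "\<dots> \<le> (1 + lnorm [a, b] + lnorm [c, d]) * lnorm [a - c, b - d]"
      using D by (simp add: algebra_simps)
    finally show "\<bar>x ! 0 * x ! 1 - (y ! 0 * y ! 1)\<bar> \<le> 1 * (1 + lnorm x ^ 1 + lnorm y ^ 1) * lnorm (ldiff x y)"
      by (simp add: xy ldiff_def)
  qed
  then show ?thesis using loc_lip_H[of "[Y, Z]" "\<lambda>x. x ! 0 * x ! 1"] assms by (simp add: numeral_2_eq_2)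
qed

lemma cmult_H: "Y \<in> H \<Longrightarrow> (\<lambda>\<omega>. c * Y \<omega>) \<in> H"
  by (intro mult_H const_H)

section \<open>Bounded random variables and the capacity of events\<close>

definition Hb :: "('a \<Rightarrow> real) set" where
  "Hb = {Y \<in> H. \<exists>B. \<forall>\<omega>. \<bar>Y \<omega>\<bar> \<le> B}"

text \<open>\<open>real_of_ereal\<close> sends infinite values to 0, so \<open>e\<close> carries the
  meaning of \<open>E\<close> only where \<open>E\<close> is finite; on \<open>Hb\<close> this is
  \<open>E_eq_e\<close>.\<close>

definition e :: "('a \<Rightarrow> real) \<Rightarrow> real" where "e Y = real_of_ereal (E Y)"

lemma HbI: "Y \<in> H \<Longrightarrow> (\<And>\<omega>. \<bar>Y \<omega>\<bar> \<le> B) \<Longrightarrow> Y \<in> Hb"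
  unfolding Hb_def by blast

lemma Hb_H: "Y \<in> Hb \<Longrightarrow> Y \<in> H" by (simp add: Hb_def)

lemma E_eq_e:
  assumes "Y \<in> Hb" shows "E Y = ereal (e Y)"
proof -
  obtain B where "Y \<in> H" and B: "\<bar>Y \<omega>\<bar> \<le> B" for \<omega> using assms by (auto simp: Hb_def)
  have "Y \<omega> \<le> B" "- B \<le> Y \<omega>" for \<omega> using B[of \<omega>] by auto
  then have "E Y \<le> ereal B" "ereal (- B) \<le> E Y"
    using E_mono[OF \<open>Y \<in> H\<close> const_H] E_mono[OF const_H \<open>Y \<in> H\<close>] by (simp_all add: E_const)
  then have "\<bar>E Y\<bar> \<noteq> \<infinity>" by auto
  then show ?thesis by (simp add: e_def ereal_real')
qed

lemma const_Hb: "(\<lambda>_. c) \<in> Hb"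
  by (rule HbI[OF const_H order.refl])

lemma indicator_Hb: "A \<in> F \<Longrightarrow> indicator A \<in> Hb"
  by (rule HbI[OF indicator_H, of _ 1]) (auto simp: indicator_def)

lemma add_Hb: "Y \<in> Hb \<Longrightarrow> Z \<in> Hb \<Longrightarrow> (\<lambda>\<omega>. Y \<omega> + Z \<omega>) \<in> Hb"
proof -
  assume a: "Y \<in> Hb" "Z \<in> Hb"
  then obtain B C where B: "\<bar>Y \<omega>\<bar> \<le> B" and C: "\<bar>Z \<omega>\<bar> \<le> C" for \<omega> by (auto simp: Hb_def)
  have "\<bar>Y \<omega> + Z \<omega>\<bar> \<le> B + C" for \<omega>
    using B[of \<omega>] C[of \<omega>] by linarith
  then show ?thesis using a HbI[OF add_H[of Y Z], of "B + C"] by (simp add: Hb_H)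
qed

lemma mult_Hb: "Y \<in> Hb \<Longrightarrow> Z \<in> Hb \<Longrightarrow> (\<lambda>\<omega>. Y \<omega> * Z \<omega>) \<in> Hb"
proof -
  assume a: "Y \<in> Hb" "Z \<in> Hb"
  then obtain B C where B: "\<bar>Y \<omega>\<bar> \<le> B" and C: "\<bar>Z \<omega>\<bar> \<le> C" for \<omega> by (auto simp: Hb_def)
  have "\<bar>Y \<omega> * Z \<omega>\<bar> \<le> B * C" for \<omega>
    unfolding abs_mult using B[of \<omega>] C[of \<omega>] by (intro mult_mono) auto
  then show ?thesis using a HbI[OF mult_H[of Y Z], of "B * C"] by (simp add: Hb_H)
qed

lemma cmult_Hb: "Y \<in> Hb \<Longrightarrow> (\<lambda>\<omega>. c * Y \<omega>) \<in> Hb"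
  by (intro mult_Hb const_Hb)

lemma e_mono: "Y \<in> Hb \<Longrightarrow> Z \<in> Hb \<Longrightarrow> (\<And>\<omega>. Y \<omega> \<le> Z \<omega>) \<Longrightarrow> e Y \<le> e Z"
  using E_mono[of Y Z] by (simp add: Hb_H E_eq_e)

lemma e_const: "e (\<lambda>_. c) = c" by (simp add: e_def E_const)

lemma e_scale: "Y \<in> Hb \<Longrightarrow> c \<ge> 0 \<Longrightarrow> e (\<lambda>\<omega>. c * Y \<omega>) = c * e Y"
  using E_scale[of Y c] by (simp add: Hb_H E_eq_e cmult_Hb)

lemma e_add: "Y \<in> Hb \<Longrightarrow> Z \<in> Hb \<Longrightarrow> e (\<lambda>\<omega>. Y \<omega> + Z \<omega>) \<le> e Y + e Z"
  using E_add[of Y Z] by (simp add: Hb_H E_eq_e add_Hb)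

text \<open>The upper bound is sub-additivity. The lower bound is sub-additivity again, applied to
  bY = - a + (a + bY).\<close>

lemma e_affine:
  assumes Y: "Y \<in> Hb" and "b \<ge> 0" shows "e (\<lambda>\<omega>. a + b * Y \<omega>) = a + b * e Y"
proof (rule antisym)
  note bY = cmult_Hb[OF Y, of b]
  show "e (\<lambda>\<omega>. a + b * Y \<omega>) \<le> a + b * e Y"
    using e_add[OF const_Hb[of a] bY] assms by (simp add: e_const e_scale)
  show "a + b * e Y \<le> e (\<lambda>\<omega>. a + b * Y \<omega>)"
    using e_add[OF const_Hb[of "- a"] add_Hb[OF const_Hb[of a] bY]] assms by (simp add: e_const e_scale)
qed

lemma e_nonneg: "Y \<in> Hb \<Longrightarrow> (\<And>\<omega>. 0 \<le> Y \<omega>) \<Longrightarrow> 0 \<le> e Y"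
  using e_mono[OF const_Hb[of 0], of Y] by (simp add: e_const)

definition V :: "'a set \<Rightarrow> real" where "V A = e (indicator A)"

text \<open>For A in \<open>F\<close> the indicator is itself an admissible majorant, so the infimum
  is attained.\<close>

lemma cap_eq:
  assumes "A \<in> F" shows "cap H E A = ereal (V A)"
proof -
  have "cap H E A = E (indicator A)"
    unfolding cap_def
  proof (rule antisym)
    show "Inf {E \<xi> |\<xi>. \<xi> \<in> H \<and> (\<forall>\<omega>. indicator A \<omega> \<le> \<xi> \<omega>)} \<le> E (indicator A)"
      using indicator_H[OF assms] by (intro Inf_lower) auto
    show "E (indicator A) \<le> Inf {E \<xi> |\<xi>. \<xi> \<in> H \<and> (\<forall>\<omega>. indicator A \<omega> \<le> \<xi> \<omega>)}"
      using indicator_H[OF assms] by (intro Inf_greatest) (auto intro: E_mono)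
  qed
  then show ?thesis by (simp add: V_def E_eq_e indicator_Hb assms)
qed

lemma V_mono: "A \<in> F \<Longrightarrow> B \<in> F \<Longrightarrow> A \<subseteq> B \<Longrightarrow> V A \<le> V B"
  unfolding V_def by (intro e_mono indicator_Hb) (auto simp: indicator_def)

lemma V_nonneg: "A \<in> F \<Longrightarrow> 0 \<le> V A"
  unfolding V_def by (intro e_nonneg indicator_Hb) auto

lemma V_le_1: "A \<in> F \<Longrightarrow> V A \<le> 1"
  using e_mono[OF indicator_Hb const_Hb[of 1], of A] unfolding V_def by (simp add: e_const indicator_def)

lemma F_Un: "A \<in> F \<Longrightarrow> B \<in> F \<Longrightarrow> A \<union> B \<in> F"
  using sigma by (metis sets_msp sets.Un)

lemma V_Un: "A \<in> F \<Longrightarrow> B \<in> F \<Longrightarrow> V (A \<union> B) \<le> V A + V B"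
proof -
  assume AB: "A \<in> F" "B \<in> F"
  then have "V (A \<union> B) \<le> e (\<lambda>\<omega>. indicator A \<omega> + indicator B \<omega>)"
    unfolding V_def by (intro e_mono indicator_Hb add_Hb F_Un) (auto simp: indicator_def)
  also have "\<dots> \<le> V A + V B" unfolding V_def using AB by (intro e_add indicator_Hb)
  finally show ?thesis .
qed

text \<open>Membership in \<open>F\<close> belongs to the conclusion because the induction carries
  it along; later proofs also use it alone, to see that finite unions are events.\<close>

lemma V_UN:
  assumes "finite I" "\<And>i. i \<in> I \<Longrightarrow> A i \<in> F"
  shows "(\<Union>i\<in>I. A i) \<in> F \<and> V (\<Union>i\<in>I. A i) \<le> (\<Sum>i\<in>I. V (A i))"
  using assms
proof (induction I)
  case empty
  have "{} \<in> F" by (metis sets.empty_sets sets_msp)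
  moreover have "V {} = 0" unfolding V_def using e_const[of 0] by (simp add: indicator_def[abs_def])
  ultimately show ?case by simp
next
  case (insert i I)
  then show ?case using F_Un[of "A i" "\<Union>i\<in>I. A i"] V_Un[of "A i" "\<Union>i\<in>I. A i"] by fastforce
qed

end

section \<open>Independence and maximal inequalities\<close>

text \<open>Stopping replaces the maximum of the partial products by a single random variable, to which the
  independence of the next factor can be applied one step at a time.\<close>
primrec stopped_product :: "real \<Rightarrow> (nat \<Rightarrow> real \<Rightarrow> real) \<Rightarrow> nat \<Rightarrow> (nat \<Rightarrow> real) \<Rightarrow> real" where
  "stopped_product L k 0 x = 1"
| "stopped_product L k (Suc n) x =
     (if L < stopped_product L k n x then stopped_product L k n x
      else stopped_product L k n x * k (Suc n) (x (Suc n)))"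

lemma stopped_product_cong:
  "(\<And>i. i \<in> {1..n} \<Longrightarrow> x i = y i) \<Longrightarrow> stopped_product L k n x = stopped_product L k n y"
  by (induction n) auto

lemma stopped_product_nonneg:
  "(\<And>i y. 0 \<le> k i y) \<Longrightarrow> 0 \<le> stopped_product L k n x"
  by (induction n) auto

lemma stopped_product_measurable:
  assumes "\<And>i. k i \<in> borel_measurable borel" and "n \<le> m"
  shows "stopped_product L k n \<in> borel_measurable (PiM {1..m} (\<lambda>_. borel))"
  using \<open>n \<le> m\<close>
proof (induction n)
  case 0
  then show ?case by simp
next
  case (Suc n)
  then have [measurable]: "stopped_product L k n \<in> borel_measurable (PiM {1..m} (\<lambda>_. borel))"
    "(\<lambda>x. x (Suc n)) \<in> measurable (PiM {1..m} (\<lambda>_. borel)) borel"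
    by (auto intro!: measurable_component_singleton)
  note [measurable] = assms(1)
  have "(\<lambda>x. stopped_product L k (Suc n) x) \<in> borel_measurable (PiM {1..m} (\<lambda>_. borel))"
    unfolding stopped_product.simps by measurable
  then show ?case by simp
qed

text \<open>Used contrapositively: once a partial product has exceeded L, the stopped product is
  frozen at the first such value and so lies above L.\<close>

lemma stopped_product_cases:
  "L < stopped_product L k n x \<or>
   (stopped_product L k n x = (\<Prod>i=1..n. k i (x i)) \<and> (\<forall>j\<le>n. (\<Prod>i=1..j. k i (x i)) \<le> L))"
proof (induction n)
  case (Suc n)
  then show ?case by (auto simp: le_Suc_eq not_less)
qed auto

context sublinear_expectation
begin

lemma ident_e:
  assumes "ident_distr H E Y X" "\<psi> \<in> borel_measurable borel"
    and "(\<lambda>\<omega>. \<psi> (Y \<omega>)) \<in> Hb" "(\<lambda>\<omega>. \<psi> (X \<omega>)) \<in> Hb"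
  shows "e (\<lambda>\<omega>. \<psi> (Y \<omega>)) = e (\<lambda>\<omega>. \<psi> (X \<omega>))"
proof -
  have "E (\<lambda>\<omega>. \<psi> (Y \<omega>)) = E (\<lambda>\<omega>. \<psi> (X \<omega>))"
    using assms unfolding ident_distr_def by (auto simp: Hb_H E_eq_e)
  then show ?thesis by (simp add: e_def)
qed

lemma ident_V:
  assumes "ident_distr H E Y X" "Y \<in> H" "X \<in> H" "A \<in> sets borel"
  shows "V {\<omega>. Y \<omega> \<in> A} = V {\<omega>. X \<omega> \<in> A}"
proof -
  have i: "(\<lambda>\<omega>. indicator A (Z \<omega>) :: real) = indicator {\<omega>. Z \<omega> \<in> A}" for Z :: "'a \<Rightarrow> real"
    by (auto simp: indicator_def)
  have "(\<lambda>\<omega>. indicator A (Z \<omega>) :: real) \<in> Hb" if "Z \<in> H" for Z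
    unfolding i using that assms(4) by (intro indicator_Hb vimage_F)
  then show ?thesis
    using ident_e[OF assms(1), of "indicator A"] assms unfolding V_def by (simp add: i)
qed

text \<open>For \<psi> = g + h k the inner expectation is g + h e(k) by \<open>e_affine\<close>,
  hence again a bounded member of \<open>H\<close> as a function of the past. Nonnegativity makes it
  agree with the expectation of the absolute value. All premises of \<open>indep_vec\<close> then
  hold.\<close>

lemma e_indep_affine:
  assumes ind: "indep_seq H E Xs"
    and g: "g \<in> borel_measurable (PiM {1..n} (\<lambda>_. borel))" "\<And>x. 0 \<le> g x"
    and h: "h \<in> borel_measurable (PiM {1..n} (\<lambda>_. borel))" "\<And>x. 0 \<le> h x"
    and k: "k \<in> borel_measurable borel" "\<And>y. 0 \<le> k y"
    and gH: "(\<lambda>\<omega>. g (restrict (\<lambda>i. Xs i \<omega>) {1..n})) \<in> Hb"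
    and hH: "(\<lambda>\<omega>. h (restrict (\<lambda>i. Xs i \<omega>) {1..n})) \<in> Hb"
    and kH: "(\<lambda>\<omega>. k (Xs (Suc n) \<omega>)) \<in> Hb"
  shows "e (\<lambda>\<omega>. g (restrict (\<lambda>i. Xs i \<omega>) {1..n}) + h (restrict (\<lambda>i. Xs i \<omega>) {1..n}) * k (Xs (Suc n) \<omega>))
    = e (\<lambda>\<omega>. g (restrict (\<lambda>i. Xs i \<omega>) {1..n}) + h (restrict (\<lambda>i. Xs i \<omega>) {1..n}) * e (\<lambda>\<omega>. k (Xs (Suc n) \<omega>)))"
\<comment> \<open>\<open>indep_seq\<close> speaks of n \<ge> 1. For n = 0 the restricted past is a
  single point, and \<open>e_affine\<close> takes the place of independence.\<close>
proof (cases "n = 0")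
  case True
  then show ?thesis using e_affine[OF kH] h(2) by (simp add: e_const restrict_def)
next
  case False
  define \<psi> where "\<psi> x y = g x + h x * k y" for x y
  define Xv where "Xv \<omega> = restrict (\<lambda>i. Xs i \<omega>) {1..n}" for \<omega>
  define c where "c = e (\<lambda>\<omega>. k (Xs (Suc n) \<omega>))"
  have \<psi>0: "0 \<le> \<psi> x y" for x y using g(2) h(2) k(2) by (simp add: \<psi>_def)
  have \<psi>Hb: "(\<lambda>\<omega>. \<psi> x (Xs (Suc n) \<omega>)) \<in> Hb" for x
    unfolding \<psi>_def by (intro add_Hb const_Hb cmult_Hb kH)
  have \<psi>e: "e (\<lambda>\<omega>. \<psi> x (Xs (Suc n) \<omega>)) = g x + h x * c" for x
    unfolding \<psi>_def c_def using h(2) by (intro e_affine kH)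
  have E\<psi>: "E (\<lambda>\<omega>. \<psi> x (Xs (Suc n) \<omega>)) = ereal (g x + h x * c)" for x
    by (simp add: E_eq_e \<psi>Hb \<psi>e)
  have c0: "0 \<le> c" unfolding c_def using kH k(2) by (intro e_nonneg) auto
  have mainHb: "(\<lambda>\<omega>. \<psi> (Xv \<omega>) (Xs (Suc n) \<omega>)) \<in> Hb"
    unfolding \<psi>_def Xv_def by (intro add_Hb mult_Hb gH hH kH)
  have barHb: "(\<lambda>\<omega>. g (Xv \<omega>) + h (Xv \<omega>) * c) \<in> Hb"
    unfolding Xv_def by (intro add_Hb mult_Hb gH hH const_Hb)
  have meas: "case_prod \<psi> \<in> borel_measurable (PiM {1..n} (\<lambda>_. borel) \<Otimes>\<^sub>M borel)"
  proof -
    note [measurable] = g(1) h(1) k(1)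
    show ?thesis unfolding \<psi>_def by measurable
  qed
  have iv: "indep_vec H E Xs {1..n} (Xs (Suc n))" using ind False by (simp add: indep_seq_def)
  have "E (\<lambda>\<omega>. \<psi> (Xv \<omega>) (Xs (Suc n) \<omega>)) = E (\<lambda>\<omega>. real_of_ereal (E (\<lambda>\<omega>'. \<psi> (Xv \<omega>) (Xs (Suc n) \<omega>'))))"
    using iv[unfolded indep_vec_def Let_def, rule_format, of \<psi>] meas mainHb[THEN Hb_H] barHb[THEN Hb_H]
      E_eq_e[OF barHb] Hb_H[OF \<psi>Hb] \<psi>0 c0 g(2) h(2)
    unfolding Xv_def[symmetric] by (simp add: E\<psi>)
  then have "e (\<lambda>\<omega>. \<psi> (Xv \<omega>) (Xs (Suc n) \<omega>)) = e (\<lambda>\<omega>. g (Xv \<omega>) + h (Xv \<omega>) * c)"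
    unfolding E\<psi> by (simp add: e_def)
  then show ?thesis unfolding Xv_def \<psi>_def c_def .
qed

end

locale iid_sequence = sublinear_expectation F H E
  for F :: "'a set set" and H :: "('a \<Rightarrow> real) set" and E :: "('a \<Rightarrow> real) \<Rightarrow> ereal" +
  fixes Xs :: "nat \<Rightarrow> 'a \<Rightarrow> real" and X :: "'a \<Rightarrow> real"
  assumes XH: "X \<in> H" and XsH: "n \<ge> 1 \<Longrightarrow> Xs n \<in> H"
    and indep: "indep_seq H E Xs"
    and ident: "n \<ge> 1 \<Longrightarrow> ident_distr H E (Xs n) X"
begin

text \<open>1 - V is the conjugate capacity of the complement, and on it independence acts as an
  exact product. The indicator of the union grows by (1 - 1_B) 1_A; conditioning replaces 1_A by its
  capacity q, and q + (1 - q) 1_B has a nonnegative coefficient, so \<open>e_affine\<close> applies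
  once more.\<close>

lemma V_union_indep:
  assumes A: "\<And>i. A i \<in> sets borel"
  shows "V {\<omega>. \<exists>i\<in>{1..n}. Xs i \<omega> \<in> A i} = 1 - (\<Prod>i=1..n. 1 - V {\<omega>. Xs i \<omega> \<in> A i})"
proof (induction n)
  case 0
  then show ?case unfolding V_def using e_const[of 0] by (simp add: indicator_def[abs_def])
next
  case (Suc n)
  define B where "B m = {\<omega>. \<exists>i\<in>{1..m}. Xs i \<omega> \<in> A i}" for m
  define u :: "(nat \<Rightarrow> real) \<Rightarrow> real" where "u x = indicator {x. \<exists>i\<in>{1..n}. x i \<in> A i} x" for x
  have BF: "B m \<in> F" for m
  proof -
    have "B m = (\<Union>i\<in>{1..m}. {\<omega>. Xs i \<omega> \<in> A i})" by (auto simp: B_def)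
    also have "\<dots> \<in> F" using V_UN[of "{1..m}" "\<lambda>i. {\<omega>. Xs i \<omega> \<in> A i}"] A XsH vimage_F by auto
    finally show ?thesis .
  qed
  have um: "u \<in> borel_measurable (PiM {1..n} (\<lambda>_. borel))"
  proof -
    have [measurable]: "Measurable.pred (PiM {1..n} (\<lambda>_. borel)) (\<lambda>x. x i \<in> A i)" if "i \<in> {1..n}" for i
      using that A by measurable
    have "(\<lambda>x. if \<exists>i\<in>{1..n}. x i \<in> A i then 1 else 0 :: real) \<in> borel_measurable (PiM {1..n} (\<lambda>_. borel))"
      by measurable
    also have "(\<lambda>x. if \<exists>i\<in>{1..n}. x i \<in> A i then 1 else 0 :: real) = u" by (auto simp: u_def indicator_def)
    finally show ?thesis .
  qed
  have uX: "u (restrict (\<lambda>i. Xs i \<omega>) {1..n}) = indicator (B n) \<omega>" for \<omega>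
    by (auto simp: u_def B_def indicator_def)
  have kX: "(\<lambda>\<omega>. indicator (A (Suc n)) (Xs (Suc n) \<omega>) :: real) = indicator {\<omega>. Xs (Suc n) \<omega> \<in> A (Suc n)}"
    by (auto simp: indicator_def)
  have SF: "{\<omega>. Xs (Suc n) \<omega> \<in> A (Suc n)} \<in> F" using A XsH by (intro vimage_F) auto
  have 1: "(\<lambda>\<omega>. 1 - indicator (B n) \<omega> :: real) \<in> Hb"
    using add_Hb[OF const_Hb[of 1] cmult_Hb[OF indicator_Hb[OF BF[of n]], of "-1"]] by simp
  define q where "q = V {\<omega>. Xs (Suc n) \<omega> \<in> A (Suc n)}"
  have q: "q \<le> 1" unfolding q_def by (intro V_le_1 SF)
  have "V (B (Suc n)) = e (\<lambda>\<omega>. u (restrict (\<lambda>i. Xs i \<omega>) {1..n}) +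
      (1 - u (restrict (\<lambda>i. Xs i \<omega>) {1..n})) * indicator (A (Suc n)) (Xs (Suc n) \<omega>))"
    unfolding V_def uX by (intro arg_cong[where f = e] ext) (auto simp: B_def indicator_def atLeastAtMostSuc_conv)
  also have "\<dots> = e (\<lambda>\<omega>. u (restrict (\<lambda>i. Xs i \<omega>) {1..n}) +
      (1 - u (restrict (\<lambda>i. Xs i \<omega>) {1..n})) * e (\<lambda>\<omega>. indicator (A (Suc n)) (Xs (Suc n) \<omega>)))"
  proof (rule e_indep_affine[OF indep um])
    show "(\<lambda>x. 1 - u x) \<in> borel_measurable (PiM {1..n} (\<lambda>_. borel))" using um by measurable
    show "(\<lambda>\<omega>. u (restrict (\<lambda>i. Xs i \<omega>) {1..n})) \<in> Hb" unfolding uX by (rule indicator_Hb[OF BF])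
    show "(\<lambda>\<omega>. 1 - u (restrict (\<lambda>i. Xs i \<omega>) {1..n})) \<in> Hb" unfolding uX by (rule 1)
    show "(\<lambda>\<omega>. indicator (A (Suc n)) (Xs (Suc n) \<omega>) :: real) \<in> Hb" unfolding kX by (rule indicator_Hb[OF SF])
  qed (use A in \<open>auto simp: u_def indicator_def[of "{x. _ x}"]\<close>)
  also have "\<dots> = e (\<lambda>\<omega>. q + (1 - q) * indicator (B n) \<omega>)"
    unfolding uX kX q_def V_def by (simp add: algebra_simps)
  also have "\<dots> = q + (1 - q) * V (B n)"
    using e_affine[OF indicator_Hb[OF BF[of n]], of "1 - q" q] q by (simp add: V_def)
  finally have "1 - V (B (Suc n)) = (1 - V (B n)) * (1 - q)" by (simp add: algebra_simps)
  then show ?case using Suc unfolding B_def q_def by simp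
qed

text \<open>A step multiplies the running part h by the expectation q of the new factor and leaves
  the stopped part g alone. Both multipliers are at most max 1 q, which explains the maximum in the
  bound.\<close>

lemma stopped_product_H:
  assumes k: "\<And>i. k i \<in> borel_measurable borel" "\<And>i y. 0 \<le> k i y"
    and kH: "\<And>i. i \<ge> 1 \<Longrightarrow> (\<lambda>\<omega>. k i (Xs i \<omega>)) \<in> Hb"
  shows "(\<lambda>\<omega>. stopped_product L k n (\<lambda>i. Xs i \<omega>)) \<in> Hb \<and>
    e (\<lambda>\<omega>. stopped_product L k n (\<lambda>i. Xs i \<omega>)) \<le> (\<Prod>i=1..n. max 1 (e (\<lambda>\<omega>. k i (Xs i \<omega>))))"
proof (induction n)
  case 0
  then show ?case by (simp add: const_Hb e_const)
next
  case (Suc n)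
  define Z where "Z = (\<lambda>\<omega>. stopped_product L k n (\<lambda>i. Xs i \<omega>))"
  define S where "S = {\<omega>. Z \<omega> \<in> {L<..}}"
  define g where "g x = (if L < stopped_product L k n x then stopped_product L k n x else 0)" for x
  define h where "h x = (if L < stopped_product L k n x then 0 else stopped_product L k n x)" for x
  define q where "q = e (\<lambda>\<omega>. k (Suc n) (Xs (Suc n) \<omega>))"
  have ZH: "Z \<in> Hb" and Ze: "e Z \<le> (\<Prod>i=1..n. max 1 (e (\<lambda>\<omega>. k i (Xs i \<omega>))))"
    using Suc by (simp_all add: Z_def)
  have Z0: "0 \<le> Z \<omega>" for \<omega> unfolding Z_def by (intro stopped_product_nonneg k)
  have S: "S \<in> F" "{\<omega>. Z \<omega> \<in> {..L}} \<in> F" unfolding S_def by (rule vimage_F[OF Hb_H[OF ZH]], simp)+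
  have res: "stopped_product L k n (restrict (\<lambda>i. Xs i \<omega>) {1..n}) = Z \<omega>" for \<omega>
    unfolding Z_def by (rule stopped_product_cong) simp
  have gX: "g (restrict (\<lambda>i. Xs i \<omega>) {1..n}) = indicator S \<omega> * Z \<omega>" for \<omega>
    by (simp only: g_def res) (simp add: S_def)
  have hX: "h (restrict (\<lambda>i. Xs i \<omega>) {1..n}) = indicator {\<omega>. Z \<omega> \<in> {..L}} \<omega> * Z \<omega>" for \<omega>
    by (simp only: h_def res) (simp add: indicator_def)
  note [measurable] = stopped_product_measurable[OF k(1) order.refl]
  have gh_meas: "g \<in> borel_measurable (PiM {1..n} (\<lambda>_. borel))" "h \<in> borel_measurable (PiM {1..n} (\<lambda>_. borel))"
    unfolding g_def[abs_def] h_def[abs_def] by measurable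
  have gH: "(\<lambda>\<omega>. g (restrict (\<lambda>i. Xs i \<omega>) {1..n})) \<in> Hb" and hH: "(\<lambda>\<omega>. h (restrict (\<lambda>i. Xs i \<omega>) {1..n})) \<in> Hb"
    unfolding gX hX using S by (auto intro!: mult_Hb indicator_Hb ZH)
  have kSuc: "(\<lambda>\<omega>. k (Suc n) (Xs (Suc n) \<omega>)) \<in> Hb" using kH by simp
  have split: "stopped_product L k (Suc n) (\<lambda>i. Xs i \<omega>) = g (restrict (\<lambda>i. Xs i \<omega>) {1..n}) +
      h (restrict (\<lambda>i. Xs i \<omega>) {1..n}) * k (Suc n) (Xs (Suc n) \<omega>)" for \<omega>
    unfolding gX hX by (simp add: S_def Z_def)
  have "e (\<lambda>\<omega>. stopped_product L k (Suc n) (\<lambda>i. Xs i \<omega>))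
      = e (\<lambda>\<omega>. g (restrict (\<lambda>i. Xs i \<omega>) {1..n}) + h (restrict (\<lambda>i. Xs i \<omega>) {1..n}) * q)"
    unfolding split q_def
    by (intro e_indep_affine indep gh_meas gH hH kSuc k) (auto simp: g_def h_def stopped_product_nonneg k)
  also have "\<dots> \<le> e (\<lambda>\<omega>. max 1 q * Z \<omega>)"
  proof (intro e_mono add_Hb mult_Hb gH hH const_Hb ZH)
    fix \<omega>
    have "1 * Z \<omega> \<le> max 1 q * Z \<omega>" "q * Z \<omega> \<le> max 1 q * Z \<omega>" by (intro mult_right_mono Z0; simp)+
    then show "g (restrict (\<lambda>i. Xs i \<omega>) {1..n}) + h (restrict (\<lambda>i. Xs i \<omega>) {1..n}) * q \<le> max 1 q * Z \<omega>"
      unfolding gX hX by (simp add: S_def indicator_def mult.commute)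
  qed
  also have "\<dots> = max 1 q * e Z" using ZH by (intro e_scale) auto
  also have "\<dots> \<le> max 1 q * (\<Prod>i=1..n. max 1 (e (\<lambda>\<omega>. k i (Xs i \<omega>))))" using Ze by (intro mult_left_mono) auto
  also have "\<dots> = (\<Prod>i=1..Suc n. max 1 (e (\<lambda>\<omega>. k i (Xs i \<omega>))))" by (simp add: q_def mult.commute)
  finally show ?case unfolding split using gH hH kSuc by (auto intro!: add_Hb mult_Hb)
qed

text \<open>Markov's inequality for the stopped product, which lies above L on the whole of
  A.\<close>

lemma V_max_product:
  assumes k: "\<And>i. k i \<in> borel_measurable borel" "\<And>i y. 0 \<le> k i y"
    and kH: "\<And>i. i \<ge> 1 \<Longrightarrow> (\<lambda>\<omega>. k i (Xs i \<omega>)) \<in> Hb" and L: "L > 0"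
    and A: "A \<in> F" "\<And>\<omega>. \<omega> \<in> A \<Longrightarrow> \<exists>j\<le>n. L < (\<Prod>i=1..j. k i (Xs i \<omega>))"
  shows "V A \<le> (\<Prod>i=1..n. max 1 (e (\<lambda>\<omega>. k i (Xs i \<omega>)))) / L"
proof -
  define Z where "Z = (\<lambda>\<omega>. stopped_product L k n (\<lambda>i. Xs i \<omega>))"
  have ZH: "Z \<in> Hb" and Ze: "e Z \<le> (\<Prod>i=1..n. max 1 (e (\<lambda>\<omega>. k i (Xs i \<omega>))))"
    using stopped_product_H[where k = k and L = L and n = n] k kH by (simp_all add: Z_def)
  have Z0: "0 \<le> Z \<omega>" for \<omega> unfolding Z_def by (intro stopped_product_nonneg k)
  have "V A \<le> e (\<lambda>\<omega>. (1 / L) * Z \<omega>)"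
    unfolding V_def
  proof (intro e_mono indicator_Hb cmult_Hb ZH A)
    fix \<omega>
    show "indicator A \<omega> \<le> (1 / L) * Z \<omega>"
    proof (cases "\<omega> \<in> A")
      case True
      then obtain j where "j \<le> n" "L < (\<Prod>i=1..j. k i (Xs i \<omega>))" using A(2) by blast
      then have "L < Z \<omega>" unfolding Z_def using stopped_product_cases[of L k n "\<lambda>i. Xs i \<omega>"] by fastforce
      then show ?thesis using L True by simp
    qed (use Z0 L in simp)
  qed
  also have "\<dots> = e Z / L" using e_scale[OF ZH, of "1 / L"] L by simp
  also have "\<dots> \<le> (\<Prod>i=1..n. max 1 (e (\<lambda>\<omega>. k i (Xs i \<omega>)))) / L"
    using Ze L by (intro divide_right_mono) auto
  finally show ?thesis .
qed

end

section \<open>Truncation and exponential moments\<close>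

definition trunc :: "real \<Rightarrow> real \<Rightarrow> real" where "trunc \<delta> y = max (- \<delta>) (min \<delta> y)"

lemma trunc_eq: "\<bar>y\<bar> \<le> \<delta> \<Longrightarrow> trunc \<delta> y = y"
  and abs_trunc_le: "\<delta> \<ge> 0 \<Longrightarrow> \<bar>trunc \<delta> y\<bar> \<le> \<delta>"
  and abs_trunc_le_abs: "\<delta> \<ge> 0 \<Longrightarrow> \<bar>trunc \<delta> y\<bar> \<le> \<bar>y\<bar>"
  and trunc_lipschitz: "\<bar>trunc \<delta> x - trunc \<delta> y\<bar> \<le> \<bar>x - y\<bar>"
  by (auto simp: trunc_def max_def min_def abs_if split: if_splits)

text \<open>From x^q = x^(q - s) x^s, with the first factor bounded through x \<le> \<delta>. With q
  = 1 and q = 2 it reduces moments of a truncated variable to the moment of order s.\<close>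

lemma powr_split:
  fixes x y s q :: real
  assumes "0 \<le> x" "x \<le> \<delta>" "x \<le> y" "0 \<le> s" "s \<le> q" "q > 0"
  shows "x powr q \<le> \<delta> powr (q - s) * y powr s"
proof (cases "x = 0")
  case False
  have "x powr q = x powr (q - s) * x powr s" by (simp add: powr_add[symmetric])
  also have "\<dots> \<le> \<delta> powr (q - s) * y powr s" using assms by (intro mult_mono powr_mono2) auto
  finally show ?thesis .
qed (use assms in simp)

lemma trunc_square_le:
  assumes "\<delta> > 0" "0 \<le> s" "s \<le> 2" shows "(trunc \<delta> y)\<^sup>2 \<le> \<delta> powr (2 - s) * \<bar>y\<bar> powr s"
  using powr_split[of "\<bar>trunc \<delta> y\<bar>" \<delta> "\<bar>y\<bar>" s 2] abs_trunc_le[of \<delta> y] abs_trunc_le_abs[of \<delta> y] assms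
  by simp

lemma abs_trunc_le_powr:
  assumes "\<delta> > 0" "0 \<le> s" "s \<le> 1" shows "\<bar>trunc \<delta> y\<bar> \<le> \<delta> powr (1 - s) * \<bar>y\<bar> powr s"
  using powr_split[of "\<bar>trunc \<delta> y\<bar>" \<delta> "\<bar>y\<bar>" s 1] abs_trunc_le[of \<delta> y] abs_trunc_le_abs[of \<delta> y] assms
  by simp

lemma trunc_error_le_powr:
  assumes "\<delta> > 0" "1 \<le> s" shows "\<bar>trunc \<delta> y - y\<bar> \<le> \<delta> powr (1 - s) * \<bar>y\<bar> powr s"
proof (cases "\<bar>y\<bar> \<le> \<delta>")
  case False
  have "\<bar>trunc \<delta> y - y\<bar> \<le> \<bar>y\<bar>" using assms False by (auto simp: trunc_def max_def min_def abs_if)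
  also have "\<bar>y\<bar> = \<bar>y\<bar> powr (1 - s) * \<bar>y\<bar> powr s" using False assms by (simp add: powr_add[symmetric])
  also have "\<dots> \<le> \<delta> powr (1 - s) * \<bar>y\<bar> powr s"
    using False assms by (intro mult_right_mono powr_mono2') auto
  finally show ?thesis .
qed (simp add: trunc_eq)

text \<open>The linear coefficient is exactly 1, so the mean enters without loss. For u \<le> 0 the
  bound comes from (1 - u)(1 + u + u^2) = 1 - u^3 \<ge> 1 together with 1 - u \<le> exp (-
  u).\<close>

lemma exp_le_quadratic:
  fixes u a :: real
  assumes "\<bar>u\<bar> \<le> a" shows "exp u \<le> 1 + u + exp a * u\<^sup>2"
proof -
  have a: "1 \<le> exp a" using assms by simp
  then have sq: "u\<^sup>2 \<le> exp a * u\<^sup>2" using mult_right_mono[of 1 "exp a" "u\<^sup>2"] by simp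
  consider "u \<ge> 1" | "0 \<le> u" "u \<le> 1" | "u \<le> 0" by linarith
  then show ?thesis
  proof cases
    case 1
    have "exp u \<le> exp a * 1" using assms by simp
    also have "\<dots> \<le> exp a * u\<^sup>2" using 1 by (intro mult_left_mono) auto
    finally show ?thesis using 1 by simp
  next
    case 2
    then show ?thesis using exp_bound[of u] sq by linarith
  next
    case 3
    have "1 \<le> (1 - u) * (1 + u + u\<^sup>2)"
    proof -
      have "(1 - u) * (1 + u + u\<^sup>2) = 1 + (- u) * u\<^sup>2" by (simp add: algebra_simps power2_eq_square)
      then show ?thesis using 3 mult_nonneg_nonneg[of "- u" "u\<^sup>2"] by simp
    qed
    also have "\<dots> \<le> exp (- u) * (1 + u + u\<^sup>2)"
    proof (rule mult_right_mono)
      show "1 - u \<le> exp (- u)" using exp_ge_add_one_self[of "- u"] by simp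
      have "0 \<le> (u + 1)\<^sup>2 + u\<^sup>2 + 1" by simp
      then show "0 \<le> 1 + u + u\<^sup>2" by (simp add: power2_eq_square algebra_simps)
    qed
    finally have "exp u * 1 \<le> exp u * (exp (- u) * (1 + u + u\<^sup>2))" by (intro mult_left_mono) auto
    then have "exp u \<le> 1 + u + u\<^sup>2"
      unfolding mult.assoc[symmetric] exp_add[symmetric] by simp
    then show ?thesis using sq by linarith
  qed
qed

text \<open>Serves to place exponentials of truncated variables in \<open>H\<close>.\<close>

lemma exp_lipschitz:
  fixes x y c :: real
  assumes "x \<le> c" "y \<le> c" shows "\<bar>exp x - exp y\<bar> \<le> exp c * \<bar>x - y\<bar>"
proof -
  have *: "exp y - exp x \<le> exp c * (y - x)" if "x \<le> y" "y \<le> c" for x y :: real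
  proof -
    have "1 - exp (x - y) \<le> y - x" using exp_ge_add_one_self[of "x - y"] by linarith
    then have "exp y * (1 - exp (x - y)) \<le> exp y * (y - x)" by (intro mult_left_mono) auto
    also have "\<dots> \<le> exp c * (y - x)" using that by (intro mult_right_mono) auto
    finally show ?thesis by (simp add: algebra_simps exp_diff)
  qed
  show ?thesis using *[of x y] *[of y x] assms by (cases "x \<le> y") auto
qed

context sublinear_expectation
begin

lemma sum_H: "finite I \<Longrightarrow> (\<And>i. i \<in> I \<Longrightarrow> Y i \<in> H) \<Longrightarrow> (\<lambda>\<omega>. \<Sum>i\<in>I. Y i \<omega>) \<in> H"
  by (induction I rule: finite_induct) (auto intro: const_H add_H)

definition abs_tail :: "('a \<Rightarrow> real) \<Rightarrow> real \<Rightarrow> real" where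
  "abs_tail Y x = V {\<omega>. Y \<omega> \<in> {y. x < \<bar>y\<bar>}}"

lemma abs_gt_borel: "{y :: real. x < \<bar>y\<bar>} \<in> sets borel"
  by measurable

lemma tail_function_abs_tail:
  assumes "Y \<in> H" shows "tail_function (abs_tail Y)"
proof
  note F = vimage_F[OF assms abs_gt_borel]
  fix x y :: real
  show "0 \<le> abs_tail Y x" unfolding abs_tail_def by (rule V_nonneg[OF F])
  show "abs_tail Y x \<le> 1" unfolding abs_tail_def by (rule V_le_1[OF F])
  show "abs_tail Y y \<le> abs_tail Y x" if "x \<le> y" unfolding abs_tail_def using that by (intro V_mono F) auto
qed

text \<open>The majorant \<open>\<bar>W\<bar>\<^bsup>s\<^esup>\<close> need not belong to \<open>H\<close> (for \<open>s < 1\<close> it is not locally Lipschitz), so it is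
  replaced by a series of indicators.\<close>
lemma E_le_moment:
  fixes p s :: real
  assumes W: "W \<in> H" and p: "p > 0" and s: "s > 0"
    and sm: "summable (\<lambda>j. 2 powr (p * s * real (Suc j)) * abs_tail W (2 powr (p * real j)))"
    and h: "h \<in> H" "\<And>\<omega>. 0 \<le> h \<omega>" "\<And>\<omega>. h \<omega> \<le> c * \<bar>W \<omega>\<bar> powr s" and c: "c \<ge> 0"
  shows "E h \<le> ereal (c * (1 + (\<Sum>j. 2 powr (p * s * real (Suc j)) * abs_tail W (2 powr (p * real j)))))"
proof -
  define S where "S j = {\<omega>. W \<omega> \<in> {y. 2 powr (p * real j) < \<bar>y\<bar>}}" for j :: nat
  define f where "f n = (case n of 0 \<Rightarrow> c | Suc j \<Rightarrow> c * 2 powr (p * s * real (Suc j)) * V (S j))" for n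
  \<comment> \<open>Index 0 covers |W| \<le> 1 by the constant c, and index j + 1 covers 2^(pj) <
    |W| \<le> 2^(p(j+1)). At every point a single term of the series already dominates h.\<close>
  define Yn :: "nat \<Rightarrow> 'a \<Rightarrow> real"
    where "Yn n = (case n of 0 \<Rightarrow> (\<lambda>_. c) | Suc j \<Rightarrow> (\<lambda>\<omega>. c * 2 powr (p * s * real (Suc j)) * indicator (S j) \<omega>))" for n
  have SF: "S j \<in> F" for j unfolding S_def by (rule vimage_F[OF W abs_gt_borel])
  have Yn0: "0 \<le> Yn n \<omega>" for n \<omega> using c by (auto simp: Yn_def split: nat.split)
  have YnH: "Yn n \<in> H" for n
    unfolding Yn_def by (cases n) (auto intro!: const_H cmult_H indicator_H SF)
  have EYn: "E (Yn n) = ereal (f n)" for n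
  proof (cases n)
    case (Suc j)
    then have "Yn n = (\<lambda>\<omega>. c * 2 powr (p * s * real (Suc j)) * indicator (S j) \<omega>)" by (simp add: Yn_def)
    then show ?thesis using c Suc
      by (simp only: E_scale[OF indicator_H[OF SF]]) (simp add: f_def V_def E_eq_e indicator_Hb SF E_scale indicator_H)
  qed (simp add: Yn_def f_def E_const)
  have smf: "summable f"
  proof (subst summable_Suc_iff[symmetric])
    show "summable (\<lambda>n. f (Suc n))"
      using summable_mult[OF sm, of c] by (simp add: f_def S_def abs_tail_def mult.assoc)
  qed
  have le: "ereal (h \<omega>) \<le> (\<Sum>n. ereal (Yn n \<omega>))" for \<omega>
  proof -
    have "\<exists>n. h \<omega> \<le> Yn n \<omega>"
    proof (cases "\<bar>W \<omega>\<bar> \<le> 1")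
      case True
      have "h \<omega> \<le> c * 1" using h(3)[of \<omega>] mult_left_mono[OF powr_le1[of s "\<bar>W \<omega>\<bar>"] c] s True by simp
      then show ?thesis by (intro exI[of _ 0]) (simp add: Yn_def)
    next
      case False
      define n where "n = (LEAST j::nat. \<bar>W \<omega>\<bar> \<le> 2 powr (p * real j))"
      have "filterlim (\<lambda>j. 2 powr (p * real j)) at_top sequentially" using p by real_asymp
      then have "\<exists>j. \<bar>W \<omega>\<bar> \<le> 2 powr (p * real j)" by (auto simp: filterlim_at_top eventually_sequentially)
      then have n: "\<bar>W \<omega>\<bar> \<le> 2 powr (p * real n)" unfolding n_def by (metis (mono_tags, lifting) LeastI)
      then obtain j where j: "n = Suc j" using False by (cases n) auto
      have "2 powr (p * real j) < \<bar>W \<omega>\<bar>"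
        using not_less_Least[of j "\<lambda>j. \<bar>W \<omega>\<bar> \<le> 2 powr (p * real j)"] j unfolding n_def by simp
      then have "Yn n \<omega> = c * 2 powr (p * s * real n)" using j by (simp add: Yn_def S_def)
      moreover have "\<bar>W \<omega>\<bar> powr s \<le> (2 powr (p * real n)) powr s" using n s by (intro powr_mono2) auto
      then have "c * \<bar>W \<omega>\<bar> powr s \<le> c * 2 powr (p * s * real n)"
        using c by (intro mult_left_mono) (auto simp: powr_powr mult_ac)
      ultimately show ?thesis using h(3)[of \<omega>] by (intro exI[of _ n]) linarith
    qed
    then obtain n where "h \<omega> \<le> Yn n \<omega>" ..
    also have "ereal (Yn n \<omega>) \<le> (\<Sum>n. ereal (Yn n \<omega>))"
      using sum_le_suminf[of "\<lambda>n. ereal (Yn n \<omega>)" "{n}"] Yn0 by (simp add: summable_ereal_pos)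
    finally show ?thesis by simp
  qed
  have "E h \<le> (\<Sum>n. E (Yn n))"
    using h(1,2) YnH Yn0 le by (intro E_countable)
  also have "\<dots> = ereal (suminf f)" unfolding EYn using smf by (rule suminf_ereal')
  also have "suminf f = f 0 + (\<Sum>n. f (Suc n))" using suminf_split_head[OF smf] by simp
  also have "(\<Sum>n. f (Suc n)) = c * (\<Sum>j. 2 powr (p * s * real (Suc j)) * abs_tail W (2 powr (p * real j)))"
    using suminf_mult[OF sm, of c] by (simp add: f_def S_def abs_tail_def mult.assoc)
  finally show ?thesis by (simp add: f_def algebra_simps)
qed

lemma trunc_Hb:
  assumes "W \<in> H" "\<delta> \<ge> 0" shows "(\<lambda>\<omega>. trunc \<delta> (b * W \<omega>)) \<in> Hb"
proof (rule HbI)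
  show "(\<lambda>\<omega>. trunc \<delta> (b * W \<omega>)) \<in> H"
    using trunc_lipschitz by (intro lipschitz_H[where L = 1 and f = "trunc \<delta>"] cmult_H assms) auto
  show "\<bar>trunc \<delta> (b * W \<omega>)\<bar> \<le> \<delta>" for \<omega> using assms by (intro abs_trunc_le)
qed

lemma exp_trunc_Hb:
  assumes "W \<in> H" "\<delta> \<ge> 0" "t \<ge> 0" shows "(\<lambda>\<omega>. exp (t * trunc \<delta> (b * W \<omega>))) \<in> Hb"
proof (rule HbI)
  have le: "t * trunc \<delta> y \<le> t * \<delta>" for y
    using abs_trunc_le[OF assms(2), of y] assms(3) by (intro mult_left_mono) auto
  show "(\<lambda>\<omega>. exp (t * trunc \<delta> (b * W \<omega>))) \<in> H"
  proof (rule lipschitz_H[where f = "\<lambda>y. exp (t * trunc \<delta> y)"])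
    fix x y
    have "\<bar>exp (t * trunc \<delta> x) - exp (t * trunc \<delta> y)\<bar> \<le> exp (t * \<delta>) * \<bar>t * trunc \<delta> x - t * trunc \<delta> y\<bar>"
      by (intro exp_lipschitz le)
    also have "\<bar>t * trunc \<delta> x - t * trunc \<delta> y\<bar> = t * \<bar>trunc \<delta> x - trunc \<delta> y\<bar>"
      using assms by (simp add: right_diff_distrib[symmetric] abs_mult)
    also have "exp (t * \<delta>) * (t * \<bar>trunc \<delta> x - trunc \<delta> y\<bar>) \<le> exp (t * \<delta>) * (t * \<bar>x - y\<bar>)"
      using assms by (intro mult_left_mono trunc_lipschitz) auto
    finally show "\<bar>exp (t * trunc \<delta> x) - exp (t * trunc \<delta> y)\<bar> \<le> (exp (t * \<delta>) * t) * \<bar>x - y\<bar>"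
      by (simp add: mult.assoc)
  qed (intro cmult_H assms)
  show "\<bar>exp (t * trunc \<delta> (b * W \<omega>))\<bar> \<le> exp (t * \<delta>)" for \<omega> using le by simp
qed

text \<open>Expand exp (tY) to second order for the truncated Y. The square is controlled by the
  s-th moment; the mean is small either because |Y| is (s \<le> 1) or because Y is close to a
  variable of nonpositive expectation (s \<ge> 1). The assumption \<open>M\<close> states that the
  s-th absolute moment is at most K, phrased through the members of \<open>H\<close> below a
  multiple of the power, since the power itself may lie outside \<open>H\<close>.\<close>

lemma e_exp_trunc_le:
  assumes W: "W \<in> H" and \<delta>: "\<delta> > 0" and t: "t \<ge> 0" and b: "b > 0" and s: "0 < s" "s \<le> 2" and K: "K \<ge> 0"
    and M: "\<And>h c. h \<in> H \<Longrightarrow> c \<ge> 0 \<Longrightarrow> (\<And>\<omega>. 0 \<le> h \<omega>) \<Longrightarrow> (\<And>\<omega>. h \<omega> \<le> c * \<bar>W \<omega>\<bar> powr s) \<Longrightarrow> E h \<le> ereal (c * K)"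
    and mean: "s \<le> 1 \<or> 1 \<le> s \<and> E W \<le> 0"
  shows "e (\<lambda>\<omega>. exp (t * trunc \<delta> (b * W \<omega>)))
    \<le> exp (b powr s * (K * (t * \<delta> powr (1 - s) + t\<^sup>2 * exp (t * \<delta>) * \<delta> powr (2 - s))))"
proof -
  define Y where "Y \<omega> = trunc \<delta> (b * W \<omega>)" for \<omega>
  have YH: "Y \<in> Hb" unfolding Y_def[abs_def] using W \<delta> by (intro trunc_Hb) auto
  have Y\<delta>: "\<bar>Y \<omega>\<bar> \<le> \<delta>" for \<omega> unfolding Y_def using \<delta> by (intro abs_trunc_le) auto
  have bW: "\<bar>b * W \<omega>\<bar> powr s = b powr s * \<bar>W \<omega>\<bar> powr s" for \<omega> using b by (simp add: abs_mult powr_mult)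
  have sq: "e (\<lambda>\<omega>. (Y \<omega>)\<^sup>2) \<le> \<delta> powr (2 - s) * b powr s * K"
  proof -
    have H2: "(\<lambda>\<omega>. (Y \<omega>)\<^sup>2) \<in> Hb" unfolding power2_eq_square by (intro mult_Hb YH)
    have "E (\<lambda>\<omega>. (Y \<omega>)\<^sup>2) \<le> ereal (\<delta> powr (2 - s) * b powr s * K)"
    proof (rule M[OF Hb_H[OF H2]])
      show "(Y \<omega>)\<^sup>2 \<le> \<delta> powr (2 - s) * b powr s * \<bar>W \<omega>\<bar> powr s" for \<omega>
        using trunc_square_le[of \<delta> s "b * W \<omega>"] \<delta> s unfolding bW Y_def by (simp add: mult.assoc)
    qed auto
    then show ?thesis by (simp add: E_eq_e H2)
  qed
  have mn: "e Y \<le> \<delta> powr (1 - s) * b powr s * K"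
    using mean
  proof
    assume s1: "s \<le> 1"
    have aH: "(\<lambda>\<omega>. \<bar>Y \<omega>\<bar>) \<in> H" by (rule lipschitz_H[where L = 1, OF Hb_H[OF YH]]) simp
    have "E Y \<le> E (\<lambda>\<omega>. \<bar>Y \<omega>\<bar>)" by (intro E_mono Hb_H[OF YH] aH) simp
    also have "\<dots> \<le> ereal (\<delta> powr (1 - s) * b powr s * K)"
    proof (rule M[OF aH])
      show "\<bar>Y \<omega>\<bar> \<le> \<delta> powr (1 - s) * b powr s * \<bar>W \<omega>\<bar> powr s" for \<omega>
        using abs_trunc_le_powr[of \<delta> s "b * W \<omega>"] \<delta> s s1 unfolding bW Y_def by (simp add: mult.assoc)
    qed auto
    finally show ?thesis by (simp add: E_eq_e YH)
  next
    assume s1: "1 \<le> s \<and> E W \<le> 0"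
    define D where "D \<omega> = \<bar>Y \<omega> - b * W \<omega>\<bar>" for \<omega>
    have DH: "D \<in> H"
      using lipschitz_H[where L = 1 and f = abs and Y = "\<lambda>\<omega>. Y \<omega> + (- b) * W \<omega>"] add_H[OF Hb_H[OF YH] cmult_H[OF W, of "- b"]]
      by (simp add: D_def[abs_def])
    have ED: "E D \<le> ereal (\<delta> powr (1 - s) * b powr s * K)"
    proof (rule M[OF DH])
      show "D \<omega> \<le> \<delta> powr (1 - s) * b powr s * \<bar>W \<omega>\<bar> powr s" for \<omega>
        using trunc_error_le_powr[of \<delta> s "b * W \<omega>"] \<delta> s1 unfolding bW Y_def D_def by (simp add: mult.assoc)
    qed (auto simp: D_def)
    have ED0: "0 \<le> E D" using E_mono[OF const_H DH, of 0] by (simp add: D_def E_const zero_ereal_def)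
    have EW: "E (\<lambda>\<omega>. b * W \<omega>) \<le> 0"
      using s1 b by (simp add: E_scale W mult_nonneg_nonpos ereal_mult_le_0_iff)
    have "E Y \<le> E (\<lambda>\<omega>. b * W \<omega> + D \<omega>)" by (intro E_mono Hb_H[OF YH] add_H cmult_H W DH) (simp add: D_def)
    also have "\<dots> \<le> E (\<lambda>\<omega>. b * W \<omega>) + E D"
      using EW ED ED0 by (intro E_add cmult_H W DH) auto
    also have "\<dots> \<le> 0 + ereal (\<delta> powr (1 - s) * b powr s * K)" by (intro add_mono EW ED)
    finally show ?thesis by (simp add: E_eq_e YH)
  qed
  have HQ: "(\<lambda>\<omega>. (Y \<omega>)\<^sup>2) \<in> Hb" unfolding power2_eq_square by (intro mult_Hb YH)
  define q where "q = t\<^sup>2 * exp (t * \<delta>)"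
  have "e (\<lambda>\<omega>. exp (t * Y \<omega>)) \<le> e (\<lambda>\<omega>. (1 + t * Y \<omega>) + q * (Y \<omega>)\<^sup>2)"
  proof (rule e_mono)
    show "(\<lambda>\<omega>. exp (t * Y \<omega>)) \<in> Hb" unfolding Y_def using W \<delta> t by (intro exp_trunc_Hb) auto
    show "(\<lambda>\<omega>. (1 + t * Y \<omega>) + q * (Y \<omega>)\<^sup>2) \<in> Hb" by (intro add_Hb const_Hb cmult_Hb YH HQ)
    fix \<omega>
    have "\<bar>t * Y \<omega>\<bar> \<le> t * \<delta>" using Y\<delta>[of \<omega>] t by (simp add: abs_mult mult_left_mono)
    from exp_le_quadratic[OF this] show "exp (t * Y \<omega>) \<le> (1 + t * Y \<omega>) + q * (Y \<omega>)\<^sup>2"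
      by (simp add: q_def power_mult_distrib mult_ac)
  qed
  also have "\<dots> \<le> e (\<lambda>\<omega>. 1 + t * Y \<omega>) + e (\<lambda>\<omega>. q * (Y \<omega>)\<^sup>2)"
    by (intro e_add add_Hb const_Hb cmult_Hb YH HQ)
  also have "\<dots> = 1 + t * e Y + q * e (\<lambda>\<omega>. (Y \<omega>)\<^sup>2)"
    using e_affine[OF YH t, of 1] e_scale[OF HQ, of q] by (simp add: q_def)
  also have "\<dots> \<le> 1 + t * (\<delta> powr (1 - s) * b powr s * K) + q * (\<delta> powr (2 - s) * b powr s * K)"
    using mn sq t by (intro add_mono mult_left_mono) (auto simp: q_def)
  also have "\<dots> = 1 + b powr s * (K * (t * \<delta> powr (1 - s) + q * \<delta> powr (2 - s)))" by (simp add: algebra_simps)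
  also have "\<dots> \<le> exp (b powr s * (K * (t * \<delta> powr (1 - s) + q * \<delta> powr (2 - s))))" by (rule exp_ge_add_one_self)
  finally show ?thesis unfolding Y_def q_def .
qed

end

context iid_sequence
begin

sublocale tail: tail_function "abs_tail X"
  by (rule tail_function_abs_tail[OF XH])

lemma V_abs_gt:
  assumes "i \<ge> 1" "b > 0"
  shows "V {\<omega>. Xs i \<omega> \<in> {y. \<delta> < \<bar>b * y\<bar>}} = abs_tail X (\<delta> / b)"
proof -
  have "{y. \<delta> < \<bar>b * y\<bar>} = {y. \<delta> / b < \<bar>y\<bar>}" using assms(2) by (auto simp: abs_mult field_simps)
  then show ?thesis
    using ident_V[OF ident[OF assms(1)] XsH[OF assms(1)] XH abs_gt_borel] by (simp add: abs_tail_def)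
qed

lemma weighted_sum_H: "(\<lambda>\<omega>. \<Sum>i=1..j. b i * Xs i \<omega>) \<in> H"
  by (intro sum_H cmult_H XsH) auto

lemma max_sum_F: "{\<omega>. \<exists>j\<le>m. \<epsilon> < \<bar>\<Sum>i=1..j. b i * Xs i \<omega>\<bar>} \<in> F"
proof -
  have "{\<omega>. \<exists>j\<le>m. \<epsilon> < \<bar>\<Sum>i=1..j. b i * Xs i \<omega>\<bar>}
      = (\<Union>j\<in>{..m}. {\<omega>. (\<Sum>i=1..j. b i * Xs i \<omega>) \<in> {y. \<epsilon> < \<bar>y\<bar>}})" by auto
  also have "\<dots> \<in> F" by (intro V_UN[THEN conjunct1] vimage_F weighted_sum_H abs_gt_borel) auto
  finally show ?thesis .
qed

text \<open>An exponential Markov bound at level exp (t \<epsilon>): exponentials of partial sums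
  are partial products, so \<open>V_max_product\<close> handles the maximum over j. The sign
  \<sigma> is a parameter because a sublinear bound for a sum gives none for its negative.\<close>

lemma V_max_trunc_le:
  fixes b :: "nat \<Rightarrow> real"
  assumes b: "\<And>i. i \<in> {1..m} \<Longrightarrow> b i > 0" and \<sigma>: "\<sigma> = 1 \<or> \<sigma> = - 1"
    and \<delta>: "\<delta> > 0" and t: "t > 0" and s: "0 < s" "s \<le> 2" and K: "K \<ge> 0"
    and M: "\<And>h c. h \<in> H \<Longrightarrow> c \<ge> 0 \<Longrightarrow> (\<And>\<omega>. 0 \<le> h \<omega>) \<Longrightarrow> (\<And>\<omega>. h \<omega> \<le> c * \<bar>X \<omega>\<bar> powr s) \<Longrightarrow> E h \<le> ereal (c * K)"
    and mean: "s \<le> 1 \<or> 1 \<le> s \<and> E X \<le> 0 \<and> E (\<lambda>\<omega>. - X \<omega>) \<le> 0"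
  shows "{\<omega>. \<exists>j\<le>m. \<epsilon> < (\<Sum>i=1..j. trunc \<delta> (b i * (\<sigma> * Xs i \<omega>)))} \<in> F \<and>
    V {\<omega>. \<exists>j\<le>m. \<epsilon> < (\<Sum>i=1..j. trunc \<delta> (b i * (\<sigma> * Xs i \<omega>)))}
    \<le> exp ((\<Sum>i=1..m. b i powr s) * (K * (t * \<delta> powr (1 - s) + t\<^sup>2 * exp (t * \<delta>) * \<delta> powr (2 - s))) - t * \<epsilon>)"
proof
  define Q where "Q = K * (t * \<delta> powr (1 - s) + t\<^sup>2 * exp (t * \<delta>) * \<delta> powr (2 - s))"
  have Q: "Q \<ge> 0" unfolding Q_def using K t by simp
  define k where "k i y = exp (t * trunc \<delta> (b i * (\<sigma> * y)))" for i y
  define A where "A = {\<omega>. \<exists>j\<le>m. \<epsilon> < (\<Sum>i=1..j. trunc \<delta> (b i * (\<sigma> * Xs i \<omega>)))}"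
  define W where "W \<omega> = \<sigma> * X \<omega>" for \<omega>
  have WH: "W \<in> H" unfolding W_def[abs_def] by (intro cmult_H XH)
  have aW: "\<bar>W \<omega>\<bar> = \<bar>X \<omega>\<bar>" for \<omega> using \<sigma> by (auto simp: W_def)
  have EW: "s \<le> 1 \<or> 1 \<le> s \<and> E W \<le> 0"
    using mean \<sigma> by (auto simp: W_def[abs_def])
  have \<sigma>X: "(\<lambda>\<omega>. \<sigma> * Xs i \<omega>) \<in> H" if "i \<ge> 1" for i by (intro cmult_H XsH that)
  have cont: "continuous_on UNIV (\<lambda>y. trunc \<delta> (b i * (\<sigma> * y)))" for i
    unfolding trunc_def by (intro continuous_intros)
  have km: "k i \<in> borel_measurable borel" for i
    unfolding k_def[abs_def] by (intro borel_measurable_continuous_onI continuous_intros cont)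
  have kH: "(\<lambda>\<omega>. k i (Xs i \<omega>)) \<in> Hb" if "i \<ge> 1" for i
    unfolding k_def using exp_trunc_Hb[OF \<sigma>X[OF that]] \<delta> t by simp
  have AF: "A \<in> F"
  proof -
    have "A = (\<Union>j\<in>{..m}. {\<omega>. (\<Sum>i=1..j. trunc \<delta> (b i * (\<sigma> * Xs i \<omega>))) \<in> {\<epsilon><..}})" by (auto simp: A_def)
    also have "\<dots> \<in> F"
      using \<delta> by (intro V_UN[THEN conjunct1] vimage_F sum_H Hb_H[OF trunc_Hb] \<sigma>X) auto
    finally show ?thesis .
  qed
  then show "{\<omega>. \<exists>j\<le>m. \<epsilon> < (\<Sum>i=1..j. trunc \<delta> (b i * (\<sigma> * Xs i \<omega>)))} \<in> F" by (simp add: A_def)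
  have ek: "e (\<lambda>\<omega>. k i (Xs i \<omega>)) \<le> exp (b i powr s * Q)" if "i \<in> {1..m}" for i
  proof -
    have "e (\<lambda>\<omega>. k i (Xs i \<omega>)) = e (\<lambda>\<omega>. k i (X \<omega>))"
      using that \<delta> t exp_trunc_Hb[OF WH, of \<delta> t "b i"]
      by (intro ident_e ident km kH) (auto simp: k_def W_def)
    also have "\<dots> = e (\<lambda>\<omega>. exp (t * trunc \<delta> (b i * W \<omega>)))" by (simp add: k_def W_def)
    also have "\<dots> \<le> exp (b i powr s * Q)"
      unfolding Q_def by (rule e_exp_trunc_le[OF WH \<delta> less_imp_le[OF t] b[OF that] s K _ EW]) (use M in \<open>auto simp: aW\<close>)
    finally show ?thesis .
  qed
  have "V A \<le> (\<Prod>i=1..m. max 1 (e (\<lambda>\<omega>. k i (Xs i \<omega>)))) / exp (t * \<epsilon>)"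
  proof (rule V_max_product[OF km _ kH _ AF])
    fix \<omega> assume "\<omega> \<in> A"
    then obtain j where j: "j \<le> m" "\<epsilon> < (\<Sum>i=1..j. trunc \<delta> (b i * (\<sigma> * Xs i \<omega>)))" by (auto simp: A_def)
    show "\<exists>j\<le>m. exp (t * \<epsilon>) < (\<Prod>i=1..j. k i (Xs i \<omega>))"
    proof (intro exI conjI)
      have "exp (t * \<epsilon>) < exp (t * (\<Sum>i=1..j. trunc \<delta> (b i * (\<sigma> * Xs i \<omega>))))" using j t by simp
      also have "\<dots> = (\<Prod>i=1..j. k i (Xs i \<omega>))" by (simp add: k_def sum_distrib_left exp_sum)
      finally show "exp (t * \<epsilon>) < (\<Prod>i=1..j. k i (Xs i \<omega>))" .
    qed (rule j)
  qed (auto simp: k_def)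
  \<comment> \<open>Q \<ge> 0 makes each exponential at least 1, so it also dominates the maximum
    with 1.\<close>
  also have "(\<Prod>i=1..m. max 1 (e (\<lambda>\<omega>. k i (Xs i \<omega>)))) \<le> (\<Prod>i=1..m. exp (b i powr s * Q))"
    using ek Q by (intro prod_mono) auto
  also have "\<dots> = exp ((\<Sum>i=1..m. b i powr s) * Q)" by (simp add: exp_sum sum_distrib_right)
  finally have "V A \<le> exp ((\<Sum>i=1..m. b i powr s) * Q - t * \<epsilon>)" by (simp add: exp_diff divide_right_mono)
  then show "V {\<omega>. \<exists>j\<le>m. \<epsilon> < (\<Sum>i=1..j. trunc \<delta> (b i * (\<sigma> * Xs i \<omega>)))}
    \<le> exp ((\<Sum>i=1..m. b i powr s) * (K * (t * \<delta> powr (1 - s) + t\<^sup>2 * exp (t * \<delta>) * \<delta> powr (2 - s))) - t * \<epsilon>)"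
    unfolding A_def Q_def .
qed

end

section \<open>Power sums, Choquet integrals, and two-sided bounds for the maximal partial
  sum\<close>

lemma sum_powr_le:
  fixes u :: real
  assumes "n \<ge> 1"
  shows "(\<Sum>k=1..<n. real k powr u) \<le> real n powr (max 0 (1 + u)) * (1 + ln (real n))"
proof -
  define m where "m = max 0 (1 + u)"
  have "(\<Sum>k=1..<n. real k powr u) \<le> (\<Sum>k=1..n. real n powr m * inverse (real k))"
  proof (rule order.trans[OF sum_mono2[of "{1..n}"] sum_mono])
    fix k assume k: "k \<in> {1..n}"
    \<comment> \<open>Splitting off 1/k leaves the exponent 1 + u, and the harmonic sum then covers
      all signs of 1 + u at once. The extra logarithm is later beaten by a negative power of
      n.\<close>
    have "real k powr u = real k powr (1 + u) * inverse (real k)"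
      using k by (simp add: powr_add field_simps)
    also have "real k powr (1 + u) \<le> real k powr m" using k by (intro powr_mono) (auto simp: m_def)
    also have "real k powr m \<le> real n powr m" using k by (intro powr_mono2) (auto simp: m_def)
    finally show "real k powr u \<le> real n powr m * inverse (real k)" by (simp add: mult_right_mono)
  qed auto
  also have "\<dots> = real n powr m * harm n" by (simp add: harm_def sum_distrib_left)
  \<comment> \<open>The sequence harm (m + 1) - ln (m + 1) decreases from its value 1 at m =
    0.\<close>
  also have "harm n \<le> 1 + ln (real n)"
    using decseqD[OF decseq_harm_diff_ln, of 0 "n - 1"] assms by (simp add: harm_def)
  finally show ?thesis by (simp add: m_def mult_left_mono)
qed

lemma moment_function_mono:
  assumes "r > 1" "p > 0" "p + \<beta> > 0" "0 \<le> x" "x \<le> y"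
  shows "moment_function r p \<beta> x \<le> moment_function r p \<beta> y"
  using assms unfolding moment_function_def by (auto intro!: mult_mono powr_mono2)

lemma moment_function_nonneg: "0 \<le> x \<Longrightarrow> 0 \<le> moment_function r p \<beta> x"
  by (simp add: moment_function_def)

lemma moment_function_measurable: "(\<lambda>y. moment_function r p \<beta> \<bar>y\<bar>) \<in> borel_measurable borel"
  unfolding moment_function_def by (cases "\<beta> < - p / r"; cases "\<beta> = - p / r") simp_all

context sublinear_expectation
begin

lemma choquet_finite_iff:
  assumes X: "X \<in> H" and f: "f \<in> borel_measurable borel" "\<And>y. 0 \<le> f y"
  shows "choquet H E (\<lambda>\<omega>. f (X \<omega>)) < \<infinity> \<longleftrightarrow>
    (\<integral>\<^sup>+ t. indicator {0..} t * ennreal (V {\<omega>. t < f (X \<omega>)}) \<partial>lborel) < \<infinity>"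
proof -
  define I where "I = (\<integral>\<^sup>+ t. indicator {0..} t * ennreal (V {\<omega>. t < f (X \<omega>)}) \<partial>lborel)"
  have F: "{\<omega>. t < f (X \<omega>)} \<in> F" for t
  proof -
    have "{y. t < f y} \<in> sets borel" using f(1) by measurable
    from vimage_F[OF X this] show ?thesis by simp
  qed
  have cap: "cap H E {\<omega>. t < f (X \<omega>)} = ereal (V {\<omega>. t < f (X \<omega>)})" for t
    by (rule cap_eq[OF F])
  \<comment> \<open>For t < 0 the event is the whole space, of capacity 1, so the second integral of
    \<open>choquet\<close> vanishes.\<close>
  have neg: "indicator {..<0} t * e2ennreal (1 - cap H E {\<omega>. t < f (X \<omega>)}) = 0" for t :: real
  proof (cases "t < 0")
    case True
    then have "{\<omega>. t < f (X \<omega>)} = UNIV" using f(2) by (auto intro: less_le_trans)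
    moreover have "V UNIV = 1" using e_const[of 1] by (simp add: V_def indicator_def[abs_def])
    ultimately have "cap H E {\<omega>. t < f (X \<omega>)} = 1" unfolding cap by (simp add: one_ereal_def)
    then show ?thesis by simp
  qed simp
  have "choquet H E (\<lambda>\<omega>. f (X \<omega>)) = enn2ereal I"
    unfolding choquet_def I_def neg by (simp add: cap e2ennreal_ereal zero_ennreal.rep_eq)
  then show ?thesis unfolding I_def[symmetric] by (cases I) auto
qed

lemma transformed_tail_abs_tail:
  assumes X: "X \<in> H" and f: "(\<lambda>y. f \<bar>y\<bar>) \<in> borel_measurable borel"
    and mono: "\<And>x y. 0 \<le> x \<Longrightarrow> x \<le> y \<Longrightarrow> f x \<le> f y"
  shows "transformed_tail (abs_tail X) f (\<lambda>t. V {\<omega>. t < f \<bar>X \<omega>\<bar>})"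
proof -
  have F: "{\<omega>. t < f \<bar>X \<omega>\<bar>} \<in> F" for t
  proof -
    have "{y. t < f \<bar>y\<bar>} \<in> sets borel" using f by measurable
    from vimage_F[OF X this] show ?thesis by simp
  qed
  note XF = vimage_F[OF X abs_gt_borel]
  show ?thesis
    unfolding transformed_tail_def abs_tail_def
  proof (intro conjI allI impI V_nonneg V_le_1 F V_mono XF)
    fix y t :: real assume y: "0 \<le> y"
    show "{\<omega>. X \<omega> \<in> {z. y < \<bar>z\<bar>}} \<subseteq> {\<omega>. t < f \<bar>X \<omega>\<bar>}" if "t < f y"
      using mono[OF y] that by (force intro: less_le_trans)
    show "{\<omega>. t < f \<bar>X \<omega>\<bar>} \<subseteq> {\<omega>. X \<omega> \<in> {z. y < \<bar>z\<bar>}}" if "f y \<le> t"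
    proof clarify
      fix \<omega> assume "t < f \<bar>X \<omega>\<bar>"
      then have "\<not> \<bar>X \<omega>\<bar> \<le> y" using mono[of "\<bar>X \<omega>\<bar>" y] that by linarith
      then show "y < \<bar>X \<omega>\<bar>" by simp
    qed
  qed
qed

end

context iid_sequence
begin

text \<open>Outside the event G that some summand exceeds \<delta>, truncation changes nothing. The
  event is therefore covered by G and the two one-sided deviation events of the truncated sums, and
  sub-additivity bounds G by the sum of the tails.\<close>

lemma V_max_le:
  fixes b :: "nat \<Rightarrow> real"
  assumes b: "\<And>i. i \<in> {1..m} \<Longrightarrow> b i > 0"
    and \<delta>: "\<delta> > 0" and t: "t > 0" and s: "0 < s" "s \<le> 2" and K: "K \<ge> 0"
    and M: "\<And>h c. h \<in> H \<Longrightarrow> c \<ge> 0 \<Longrightarrow> (\<And>\<omega>. 0 \<le> h \<omega>) \<Longrightarrow> (\<And>\<omega>. h \<omega> \<le> c * \<bar>X \<omega>\<bar> powr s) \<Longrightarrow> E h \<le> ereal (c * K)"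
    and mean: "s \<le> 1 \<or> 1 \<le> s \<and> E X \<le> 0 \<and> E (\<lambda>\<omega>. - X \<omega>) \<le> 0"
  shows "V {\<omega>. \<exists>j\<le>m. \<epsilon> < \<bar>\<Sum>i=1..j. b i * Xs i \<omega>\<bar>}
    \<le> (\<Sum>i=1..m. abs_tail X (\<delta> / b i)) +
      2 * exp ((\<Sum>i=1..m. b i powr s) * (K * (t * \<delta> powr (1 - s) + t\<^sup>2 * exp (t * \<delta>) * \<delta> powr (2 - s))) - t * \<epsilon>)"
proof -
  define G where "G = (\<Union>i\<in>{1..m}. {\<omega>. Xs i \<omega> \<in> {y. \<delta> < \<bar>b i * y\<bar>}})"
  define A where "A \<sigma> = {\<omega>. \<exists>j\<le>m. \<epsilon> < (\<Sum>i=1..j. trunc \<delta> (b i * (\<sigma> * Xs i \<omega>)))}" for \<sigma> :: real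
  define R where "R = exp ((\<Sum>i=1..m. b i powr s) * (K * (t * \<delta> powr (1 - s) + t\<^sup>2 * exp (t * \<delta>) * \<delta> powr (2 - s))) - t * \<epsilon>)"
  have A: "A \<sigma> \<in> F \<and> V (A \<sigma>) \<le> R" if "\<sigma> = 1 \<or> \<sigma> = - 1" for \<sigma>
    unfolding A_def R_def by (rule V_max_trunc_le[OF b that \<delta> t s K M mean])
  have GF: "{\<omega>. Xs i \<omega> \<in> {y. \<delta> < \<bar>b i * y\<bar>}} \<in> F" if "i \<in> {1..m}" for i
  proof (rule vimage_F)
    show "{y. \<delta> < \<bar>b i * y\<bar>} \<in> sets borel" by measurable
  qed (use XsH that in auto)
  have G: "G \<in> F" "V G \<le> (\<Sum>i=1..m. abs_tail X (\<delta> / b i))"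
  proof -
    have *: "G \<in> F \<and> V G \<le> (\<Sum>i=1..m. V {\<omega>. Xs i \<omega> \<in> {y. \<delta> < \<bar>b i * y\<bar>}})"
      unfolding G_def by (intro V_UN GF) auto
    then show "G \<in> F" by simp
    have "(\<Sum>i=1..m. V {\<omega>. Xs i \<omega> \<in> {y. \<delta> < \<bar>b i * y\<bar>}}) = (\<Sum>i=1..m. abs_tail X (\<delta> / b i))"
      using b by (intro sum.cong refl V_abs_gt) auto
    then show "V G \<le> (\<Sum>i=1..m. abs_tail X (\<delta> / b i))" using * by simp
  qed
  have sub: "{\<omega>. \<exists>j\<le>m. \<epsilon> < \<bar>\<Sum>i=1..j. b i * Xs i \<omega>\<bar>} \<subseteq> G \<union> (A 1 \<union> A (- 1))"
  proof
    fix \<omega> assume "\<omega> \<in> {\<omega>. \<exists>j\<le>m. \<epsilon> < \<bar>\<Sum>i=1..j. b i * Xs i \<omega>\<bar>}"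
    then obtain j where j: "j \<le> m" "\<epsilon> < \<bar>\<Sum>i=1..j. b i * Xs i \<omega>\<bar>" by auto
    show "\<omega> \<in> G \<union> (A 1 \<union> A (- 1))"
    proof (cases "\<omega> \<in> G")
      case False
      then have le: "\<bar>b i * Xs i \<omega>\<bar> \<le> \<delta>" if "i \<in> {1..m}" for i using that by (auto simp: G_def not_less)
      have "trunc \<delta> (b i * (1 * Xs i \<omega>)) = b i * Xs i \<omega>" "trunc \<delta> (b i * (- 1 * Xs i \<omega>)) = - (b i * Xs i \<omega>)"
        if "i \<in> {1..j}" for i
        using le[of i] that j by (auto simp: trunc_eq)
      then have "(\<Sum>i=1..j. trunc \<delta> (b i * (1 * Xs i \<omega>))) = (\<Sum>i=1..j. b i * Xs i \<omega>)"
        "(\<Sum>i=1..j. trunc \<delta> (b i * (- 1 * Xs i \<omega>))) = - (\<Sum>i=1..j. b i * Xs i \<omega>)"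
        unfolding sum_negf[symmetric] by (auto intro!: sum.cong)
      then have "\<epsilon> < (\<Sum>i=1..j. trunc \<delta> (b i * (1 * Xs i \<omega>))) \<or> \<epsilon> < (\<Sum>i=1..j. trunc \<delta> (b i * (- 1 * Xs i \<omega>)))"
        using j(2) by linarith
      then show ?thesis using j(1) unfolding A_def by blast
    qed simp
  qed
  have "V {\<omega>. \<exists>j\<le>m. \<epsilon> < \<bar>\<Sum>i=1..j. b i * Xs i \<omega>\<bar>} \<le> V (G \<union> (A 1 \<union> A (- 1)))"
    using sub G A by (intro V_mono F_Un max_sum_F) auto
  also have "\<dots> \<le> V G + (V (A 1) + V (A (- 1)))"
    using V_Un[of G "A 1 \<union> A (- 1)"] V_Un[of "A 1" "A (- 1)"] G(1) A[of 1] A[of "- 1"] F_Un[of "A 1" "A (- 1)"] by simp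
  also have "\<dots> \<le> (\<Sum>i=1..m. abs_tail X (\<delta> / b i)) + 2 * R"
    using G(2) A[of 1] A[of "- 1"] by simp
  finally show ?thesis unfolding R_def .
qed

text \<open>A summand is the difference of two consecutive partial sums, so if it exceeds 2
  \<epsilon> one of them exceeds \<epsilon>. The capacity that some summand is that large is given
  exactly by \<open>V_union_indep\<close>, and 1 - x \<le> exp (- x) turns the product into a
  sum.\<close>

lemma V_max_ge:
  fixes b :: "nat \<Rightarrow> real"
  assumes b: "\<And>i. i \<in> {1..m} \<Longrightarrow> b i > 0"
  shows "1 - exp (- (\<Sum>i=1..m. abs_tail X (2 * \<epsilon> / b i))) \<le> V {\<omega>. \<exists>j\<le>m. \<epsilon> < \<bar>\<Sum>i=1..j. b i * Xs i \<omega>\<bar>}"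
proof -
  define A where "A i = {y. 2 * \<epsilon> < \<bar>b i * y\<bar>}" for i
  have A: "A i \<in> sets borel" for i unfolding A_def by measurable
  have tail: "V {\<omega>. Xs i \<omega> \<in> A i} = abs_tail X (2 * \<epsilon> / b i)" if "i \<in> {1..m}" for i
    unfolding A_def using that b by (intro V_abs_gt) auto
  have "(\<Prod>i=1..m. 1 - V {\<omega>. Xs i \<omega> \<in> A i}) \<le> (\<Prod>i=1..m. exp (- abs_tail X (2 * \<epsilon> / b i)))"
  proof (intro prod_mono conjI)
    fix i assume i: "i \<in> {1..m}"
    show "0 \<le> 1 - V {\<omega>. Xs i \<omega> \<in> A i}" using tail.v_le_1 by (simp add: tail[OF i])
    show "1 - V {\<omega>. Xs i \<omega> \<in> A i} \<le> exp (- abs_tail X (2 * \<epsilon> / b i))"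
      using exp_ge_add_one_self[of "- abs_tail X (2 * \<epsilon> / b i)"] by (simp add: tail[OF i])
  qed
  also have "\<dots> = exp (- (\<Sum>i=1..m. abs_tail X (2 * \<epsilon> / b i)))" by (simp add: exp_sum[symmetric] sum_negf)
  finally have "1 - exp (- (\<Sum>i=1..m. abs_tail X (2 * \<epsilon> / b i))) \<le> V {\<omega>. \<exists>i\<in>{1..m}. Xs i \<omega> \<in> A i}"
    unfolding V_union_indep[of A, OF A] by simp
  also have "\<dots> \<le> V {\<omega>. \<exists>j\<le>m. \<epsilon> < \<bar>\<Sum>i=1..j. b i * Xs i \<omega>\<bar>}"
  proof (intro V_mono max_sum_F)
    have "{\<omega>. \<exists>i\<in>{1..m}. Xs i \<omega> \<in> A i} = (\<Union>i\<in>{1..m}. {\<omega>. Xs i \<omega> \<in> A i})" by auto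
    also have "\<dots> \<in> F" using XsH by (intro V_UN[THEN conjunct1] vimage_F A) auto
    finally show "{\<omega>. \<exists>i\<in>{1..m}. Xs i \<omega> \<in> A i} \<in> F" .
    show "{\<omega>. \<exists>i\<in>{1..m}. Xs i \<omega> \<in> A i} \<subseteq> {\<omega>. \<exists>j\<le>m. \<epsilon> < \<bar>\<Sum>i=1..j. b i * Xs i \<omega>\<bar>}"
    proof clarify
      fix \<omega> i assume i: "i \<in> {1..m}" "Xs i \<omega> \<in> A i"
      then obtain k where k: "i = Suc k" by (cases i) auto
      have "2 * \<epsilon> < \<bar>b i * Xs i \<omega>\<bar>" using i by (simp add: A_def)
      moreover have "(\<Sum>l=1..i. b l * Xs l \<omega>) = (\<Sum>l=1..k. b l * Xs l \<omega>) + b i * Xs i \<omega>"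
        unfolding k by simp
      ultimately have "\<epsilon> < \<bar>\<Sum>l=1..i. b l * Xs l \<omega>\<bar> \<or> \<epsilon> < \<bar>\<Sum>l=1..k. b l * Xs l \<omega>\<bar>" by linarith
      moreover have "i \<le> m" "k \<le> m" using i k by auto
      ultimately show "\<exists>j\<le>m. \<epsilon> < \<bar>\<Sum>i=1..j. b i * Xs i \<omega>\<bar>" by blast
    qed
  qed
  finally show ?thesis .
qed

end

section \<open>Weighted sums\<close>

lemma sum_rev:
  fixes g :: "nat \<Rightarrow> real"
  shows "(\<Sum>i=1..N. g (Suc N - i)) = (\<Sum>k=1..<Suc N. g k)"
  using sum.atLeastAtMost_rev[of g 1 N] by (simp add: atLeastLessThanSuc_atLeastAtMost)

locale weighted_iid_sequence = iid_sequence F H E Xs X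
  for F :: "'a set set" and H :: "('a \<Rightarrow> real) set" and E :: "('a \<Rightarrow> real) \<Rightarrow> ereal"
    and Xs :: "nat \<Rightarrow> 'a \<Rightarrow> real" and X :: "'a \<Rightarrow> real" +
  fixes r p \<beta> c C :: real and a :: "nat \<Rightarrow> nat \<Rightarrow> real"
  assumes r: "r > 1" and p: "p > 1/2" and beta: "\<beta> + p > 0" and c: "0 < c" "c \<le> C"
    and arr: "n \<ge> 1 \<Longrightarrow> i < n \<Longrightarrow>
      c * ((real (n - i) / real n) powr \<beta> * (1 / real n) powr p) \<le> a n i \<and>
      a n i \<le> C * ((real (n - i) / real n) powr \<beta> * (1 / real n) powr p)"
begin

definition \<gamma> :: real where "\<gamma> = p + \<beta>"

text \<open>The model entry ((n - i)/n)^\<beta> (1/n)^p rewritten in k = n - i.\<close>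

definition weight :: "nat \<Rightarrow> nat \<Rightarrow> real" where "weight n k = real k powr \<beta> * real n powr (- \<gamma>)"

text \<open>The index is shifted: \<open>max_prob \<epsilon> n\<close> belongs to row n + 1, whose
  partial sums run over j = 0, ..., n. This fits the series in (ii) once it is indexed from
  0.\<close>

definition max_prob :: "real \<Rightarrow> nat \<Rightarrow> real" where
  "max_prob \<epsilon> n = V {\<omega>. \<exists>j\<le>n. \<epsilon> < \<bar>\<Sum>i=1..j. a (Suc n) i * Xs i \<omega>\<bar>}"

lemma par: "r > 1" "p > 0" "p + \<beta> > 0" and \<gamma>_pos: "\<gamma> > 0" and C_pos: "C > 0"
  using r p beta c by (auto simp: \<gamma>_def)

lemma weight_pos: "1 \<le> k \<Longrightarrow> k < n \<Longrightarrow> weight n k > 0"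
  by (simp add: weight_def)

lemma array_bounds:
  assumes "i < n" shows "c * weight n (n - i) \<le> a n i" and "a n i \<le> C * weight n (n - i)"
proof -
  have "real n powr (- \<gamma>) = inverse (real n powr p * real n powr \<beta>)"
    unfolding \<gamma>_def powr_minus powr_add ..
  then have "(real (n - i) / real n) powr \<beta> * (1 / real n) powr p = weight n (n - i)"
    using assms by (simp add: weight_def powr_divide field_simps del: of_nat_diff)
  then show "c * weight n (n - i) \<le> a n i" "a n i \<le> C * weight n (n - i)" using arr[of n i] assms by auto
qed

lemma array_pos:
  assumes "i \<in> {1..N}" shows "a (Suc N) i > 0"
  using array_bounds(1)[of i "Suc N"] weight_pos[of "Suc N - i" "Suc N"] assms c
  by (intro less_le_trans[OF mult_pos_pos array_bounds(1)]) auto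

lemma divide_weight:
  assumes "1 \<le> k" "k < n" shows "x / (d * weight n k) = x / d * real n powr \<gamma> * real k powr (- \<beta>)"
  using assms by (simp add: weight_def powr_minus field_simps)

lemma max_prob_nonneg: "0 \<le> max_prob \<epsilon> n"
  unfolding max_prob_def by (rule V_nonneg[OF max_sum_F])

lemma summable_max_prob:
  assumes mean: "p \<le> 1 \<Longrightarrow> E X = 0 \<and> - E (\<lambda>\<omega>. - X \<omega>) = 0"
    and D: "\<And>\<kappa>. 0 < \<kappa> \<Longrightarrow> \<kappa> \<le> 1 \<Longrightarrow> dyadic_bounded r p (r - 1) \<gamma> (\<lambda>x. abs_tail X (\<kappa> * x))"
    and \<epsilon>: "\<epsilon> > 0"
  shows "summable (\<lambda>n. real (Suc n) powr (r - 2) * max_prob \<epsilon> n)"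
proof -
  \<comment> \<open>This gives ps = min (2p) r for p \<le> 1 and ps = min p r for p > 1, in both
    cases above 1 and at most r. In the first case s \<ge> 1 and the mean-zero hypothesis acts; in
    the second s \<le> 1.\<close>
  define s where "s = (if p \<le> 1 then min 2 (r / p) else min 1 (r / p))"
  have s: "0 < s" "s \<le> 2" using par by (auto simp: s_def)
  have ps: "1 < p * s" "p * s \<le> r" using p r by (auto simp: s_def min_def field_simps)
  have mean': "s \<le> 1 \<or> 1 \<le> s \<and> E X \<le> 0 \<and> E (\<lambda>\<omega>. - X \<omega>) \<le> 0"
  proof (cases "p \<le> 1")
    case True
    then have "1 \<le> s" using r p by (auto simp: s_def field_simps)
    then show ?thesis using mean[OF True] by simp
  qed (simp add: s_def)
  have smr: "summable (\<lambda>j. 2 powr (r * real j) * abs_tail X (2 powr (p * real j)))"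
    using D[of 1] tail.single_sum_of_dyadic_bounded by simp
  have sms: "summable (\<lambda>j. 2 powr (p * s * real (Suc j)) * abs_tail X (2 powr (p * real j)))"
  proof (rule summable_comparison_test'[OF summable_mult[OF smr, of "2 powr (p * s)"], where N = 0])
    fix j
    have "2 powr (p * s * real (Suc j)) \<le> 2 powr (p * s + r * real j)"
      using mult_right_mono[OF ps(2), of "real j"] by (simp add: algebra_simps)
    then show "norm (2 powr (p * s * real (Suc j)) * abs_tail X (2 powr (p * real j)))
        \<le> 2 powr (p * s) * (2 powr (r * real j) * abs_tail X (2 powr (p * real j)))"
      using tail.v_nonneg by (simp add: powr_add mult_right_mono flip: mult.assoc)
  qed
  define K where "K = 1 + (\<Sum>j. 2 powr (p * s * real (Suc j)) * abs_tail X (2 powr (p * real j)))"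
  have K: "K \<ge> 0" unfolding K_def using tail.v_nonneg sms by (intro add_nonneg_nonneg suminf_nonneg) auto
  have M: "E h \<le> ereal (d * K)"
    if "h \<in> H" "d \<ge> 0" "\<And>\<omega>. 0 \<le> h \<omega>" "\<And>\<omega>. h \<omega> \<le> d * \<bar>X \<omega>\<bar> powr s" for h d
    unfolding K_def using E_le_moment[OF XH par(2) s(1) _ that(1,3,4,2)] sms by simp
  \<comment> \<open>By \<open>sum_powr_le\<close> the s-th powers of the weights of row n sum to at
    most a constant times n^(-2\<eta>) (1 + ln n), since - \<gamma> s + max 0 (1 + \<beta> s) = -
    min (\<gamma> s) (ps - 1).\<close>
  define \<eta> where "\<eta> = min (\<gamma> * s) (p * s - 1) / 2"
  have \<eta>: "\<eta> > 0" using \<gamma>_pos s ps by (simp add: \<eta>_def)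
  \<comment> \<open>With t \<epsilon> = r ln n this makes exp (t \<delta>) = n^\<eta>, which uses up
    only half of the decay n^(-2\<eta>), while exp (- t \<epsilon>) = n^(-r).\<close>
  define \<delta> where "\<delta> = \<eta> * \<epsilon> / r"
  have \<delta>: "\<delta> > 0" using \<eta> \<epsilon> r by (simp add: \<delta>_def)
  define t where "t n = r / \<epsilon> * ln (real n)" for n :: nat
  define Q where "Q n = K * (t n * \<delta> powr (1 - s) + (t n)\<^sup>2 * exp (t n * \<delta>) * \<delta> powr (2 - s))" for n
  define B where "B n = C powr s * (real n powr (- 2 * \<eta>) * (1 + ln (real n)))" for n :: nat
  have expt: "exp (t n * \<delta>) = real n powr \<eta>" if "n \<ge> 1" for n
    using that \<epsilon> r by (simp add: t_def \<delta>_def powr_def)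
  have weights: "(\<Sum>i=1..N. a (Suc N) i powr s) \<le> B (Suc N)" for N
  proof -
    define n where "n = Suc N"
    have "(\<Sum>i=1..N. a n i powr s) \<le> (\<Sum>i=1..N. (C * weight n (n - i)) powr s)"
      using array_bounds(2)[of _ n] array_pos s by (intro sum_mono powr_mono2) (auto simp: n_def less_imp_le)
    also have "\<dots> = (\<Sum>k=1..<n. (C * weight n k) powr s)" unfolding n_def by (rule sum_rev)
    also have "\<dots> = C powr s * (real n powr (- (\<gamma> * s)) * (\<Sum>k=1..<n. real k powr (\<beta> * s)))"
      using C_pos by (simp add: weight_def powr_mult powr_powr sum_distrib_left mult_ac)
    also have "\<dots> \<le> C powr s * (real n powr (- (\<gamma> * s)) * (real n powr (max 0 (1 + \<beta> * s)) * (1 + ln (real n))))"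
      by (intro mult_left_mono sum_powr_le) (auto simp: n_def)
    also have "real n powr (- (\<gamma> * s)) * (real n powr (max 0 (1 + \<beta> * s)) * (1 + ln (real n)))
        = real n powr (- 2 * \<eta>) * (1 + ln (real n))"
    proof -
      have "- (\<gamma> * s) + max 0 (1 + \<beta> * s) = - 2 * \<eta>"
        by (simp add: \<eta>_def \<gamma>_def max_def min_def algebra_simps)
      then show ?thesis by (metis mult.assoc powr_add)
    qed
    finally show ?thesis by (simp add: B_def n_def)
  qed
  have "((\<lambda>n. B n * Q n) \<longlongrightarrow> 0) sequentially"
  proof -
    have "((\<lambda>n. (1 + ln (real n)) * ln (real n) * real n powr (- 2 * \<eta>)) \<longlongrightarrow> 0) sequentially"
      and "((\<lambda>n. (1 + ln (real n)) * (ln (real n))\<^sup>2 * real n powr (- \<eta>)) \<longlongrightarrow> 0) sequentially"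
      using \<eta> by real_asymp+
    then have lim: "((\<lambda>n. C powr s * K * (r / \<epsilon>) * \<delta> powr (1 - s) * ((1 + ln (real n)) * ln (real n) * real n powr (- 2 * \<eta>)) +
        C powr s * K * (r / \<epsilon>)\<^sup>2 * \<delta> powr (2 - s) * ((1 + ln (real n)) * (ln (real n))\<^sup>2 * real n powr (- \<eta>))) \<longlongrightarrow> 0) sequentially"
      by (intro tendsto_add_zero tendsto_mult_right_zero)
    show ?thesis
    proof (rule Lim_transform_eventually[OF lim])
      show "eventually (\<lambda>n. C powr s * K * (r / \<epsilon>) * \<delta> powr (1 - s) * ((1 + ln (real n)) * ln (real n) * real n powr (- 2 * \<eta>)) +
        C powr s * K * (r / \<epsilon>)\<^sup>2 * \<delta> powr (2 - s) * ((1 + ln (real n)) * (ln (real n))\<^sup>2 * real n powr (- \<eta>)) = B n * Q n) sequentially"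
        using eventually_ge_at_top[of 1]
      proof eventually_elim
        case (elim n)
        have e: "real n powr (- \<eta>) = real n powr (- 2 * \<eta>) * real n powr \<eta>" by (simp add: powr_add[symmetric])
        \<comment> \<open>Here u, x, y and z stand for r / \<epsilon>, ln n, n^(-2\<eta>) and
          n^\<eta>.\<close>
        have "c' * k * u * d1 * ((1 + x) * x * y) + c' * k * u\<^sup>2 * d2 * ((1 + x) * x\<^sup>2 * (y * z))
            = c' * (y * (1 + x)) * (k * (u * x * d1 + (u * x)\<^sup>2 * z * d2))" for c' k u d1 d2 x y z :: real
          by (simp add: algebra_simps power2_eq_square)
        then show ?case unfolding B_def Q_def e expt[OF elim] unfolding t_def .
      qed
    qed
  qed
  then have "eventually (\<lambda>n. B n * Q n < 1) sequentially" by (rule order_tendstoD) simp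
  then have ev: "eventually (\<lambda>N. B (Suc N) * Q (Suc N) < 1) sequentially"
    by (rule eventually_compose_filterlim[OF _ filterlim_Suc])
  \<comment> \<open>The deviation term is at most 2e n^(-r), and n^(r-2) n^(-r) = n^(-2) is
    summable.\<close>
  define T where "T n = real n powr (r - 2) * row_sum (abs_tail X) \<gamma> \<beta> (\<delta> / C) n + 2 * exp 1 * real n powr (- 2)" for n
  have sT: "summable T"
    unfolding T_def
  proof (intro summable_add summable_mult)
    \<comment> \<open>The scale asked for by the row-sum lemma, cut at 1 to stay in the range of
      \<open>D\<close>; a smaller scale only enlarges the tails.\<close>
    define \<kappa>' where "\<kappa>' = min 1 (\<delta> / C * (min 1 (2 powr \<gamma>) * min 1 (2 powr (- \<beta>))))"
    have "0 < \<kappa>'" "\<kappa>' \<le> 1" using \<delta> C_pos by (auto simp: \<kappa>'_def)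
    then show "summable (\<lambda>n. real n powr (r - 2) * row_sum (abs_tail X) \<gamma> \<beta> (\<delta> / C) n)"
      using D[of \<kappa>'] \<delta> C_pos unfolding \<gamma>_def
      by (intro tail.summable_row_sums_of_dyadic_bounded[where \<kappa>' = \<kappa>']) (auto simp: \<kappa>'_def \<gamma>_def)
    show "summable (\<lambda>n. real n powr (- 2))" by (subst summable_real_powr_iff) simp
  qed
  show ?thesis
  proof (rule summable_comparison_test_ev)
    show "summable (\<lambda>n. T (Suc n))" using sT by (subst summable_Suc_iff)
    show "eventually (\<lambda>N. norm (real (Suc N) powr (r - 2) * max_prob \<epsilon> N) \<le> T (Suc N)) sequentially"
      using ev eventually_ge_at_top[of 1]
    proof eventually_elim
      case (elim N)
      define n where "n = Suc N"
      have t0: "t n > 0" using elim r \<epsilon> by (simp add: t_def n_def)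
      have Q0: "0 \<le> Q n" unfolding Q_def using K t0 by simp
      have "max_prob \<epsilon> N \<le> (\<Sum>i=1..N. abs_tail X (\<delta> / a n i)) + 2 * exp ((\<Sum>i=1..N. a n i powr s) * Q n - t n * \<epsilon>)"
        unfolding max_prob_def n_def[symmetric] Q_def
        using array_pos by (intro V_max_le \<delta> t0 s K M mean') (auto simp: n_def)
      also have "(\<Sum>i=1..N. abs_tail X (\<delta> / a n i)) \<le> row_sum (abs_tail X) \<gamma> \<beta> (\<delta> / C) n"
      proof -
        have "(\<Sum>i=1..N. abs_tail X (\<delta> / a n i)) \<le> (\<Sum>i=1..N. abs_tail X (\<delta> / (C * weight n (n - i))))"
        proof (intro sum_mono tail.v_antimono divide_left_mono)
          fix i assume i: "i \<in> {1..N}"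
          then show "a n i \<le> C * weight n (n - i)" by (intro array_bounds) (auto simp: n_def)
          show "0 < C * weight n (n - i) * a n i" using i array_pos[OF i] C_pos weight_pos[of "n - i" n] by (auto simp: n_def)
        qed (use \<delta> in auto)
        also have "\<dots> = (\<Sum>k=1..<n. abs_tail X (\<delta> / (C * weight n k)))" unfolding n_def by (rule sum_rev)
        also have "\<dots> = row_sum (abs_tail X) \<gamma> \<beta> (\<delta> / C) n"
          unfolding row_sum_def by (intro sum.cong refl) (simp only: atLeastLessThan_iff divide_weight)
        finally show ?thesis .
      qed
      also have "exp ((\<Sum>i=1..N. a n i powr s) * Q n - t n * \<epsilon>) \<le> exp 1 * real n powr (- r)"
      proof -
        have "(\<Sum>i=1..N. a n i powr s) * Q n \<le> B n * Q n"
          using weights[of N] Q0 by (intro mult_right_mono) (auto simp: n_def)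
        also have "\<dots> \<le> 1" using elim by (simp add: n_def)
        finally have "exp ((\<Sum>i=1..N. a n i powr s) * Q n - t n * \<epsilon>) \<le> exp (1 + (- r) * ln (real n))"
          using \<epsilon> by (simp add: t_def)
        also have "\<dots> = exp 1 * real n powr (- r)" unfolding exp_add by (simp add: powr_def n_def)
        finally show ?thesis .
      qed
      finally have "max_prob \<epsilon> N \<le> row_sum (abs_tail X) \<gamma> \<beta> (\<delta> / C) n + 2 * (exp 1 * real n powr (- r))" by simp
      then have "real n powr (r - 2) * max_prob \<epsilon> N \<le> real n powr (r - 2) * (row_sum (abs_tail X) \<gamma> \<beta> (\<delta> / C) n + 2 * (exp 1 * real n powr (- r)))"
        by (intro mult_left_mono) auto
      also have "\<dots> = real n powr (r - 2) * row_sum (abs_tail X) \<gamma> \<beta> (\<delta> / C) n + 2 * exp 1 * (real n powr (r - 2) * real n powr (- r))"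
        by (simp add: algebra_simps)
      also have "real n powr (r - 2) * real n powr (- r) = real n powr (- 2)" by (simp add: powr_add[symmetric])
      finally show ?case using max_prob_nonneg by (simp add: T_def n_def)
    qed
  qed
qed

lemma dyadic_bounded_of_summable_max_prob:
  assumes sm: "\<And>\<epsilon>. \<epsilon> > 0 \<Longrightarrow> summable (\<lambda>n. real (Suc n) powr (r - 2) * max_prob \<epsilon> n)"
  shows "dyadic_bounded r p (r - 1) \<gamma> (abs_tail X)"
proof -
  \<comment> \<open>At scale 1/M the condition on \<kappa> in
    \<open>dyadic_bounded_of_summable_row_sums\<close> holds with equality.\<close>
  define M where "M = max 1 (2 powr \<gamma>) * max 1 (2 powr (- \<beta>)) * 2 powr \<gamma>"
  have M: "M > 0" by (simp add: M_def)
  have "summable (\<lambda>n. real n powr (r - 2) * row_sum (abs_tail X) \<gamma> \<beta> (1 / M) n)"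
  proof (rule tail.summable_row_sums_of_exp[OF _ r \<gamma>_pos])
    fix \<kappa> :: real assume \<kappa>: "\<kappa> > 0"
    \<comment> \<open>Then 2 \<epsilon> divided by c times the weight is the argument of
      \<open>row_sum\<close> at scale \<kappa>, so (ii) for all \<epsilon> > 0 covers all \<kappa> >
      0.\<close>
    define \<epsilon> where "\<epsilon> = \<kappa> * c / 2"
    have \<epsilon>: "\<epsilon> > 0" using \<kappa> c by (simp add: \<epsilon>_def)
    have le: "1 - exp (- row_sum (abs_tail X) \<gamma> \<beta> \<kappa> (Suc N)) \<le> max_prob \<epsilon> N" for N
    proof -
      define n where "n = Suc N"
      have "row_sum (abs_tail X) \<gamma> \<beta> \<kappa> n = (\<Sum>k=1..<n. abs_tail X (2 * \<epsilon> / (c * weight n k)))"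
        unfolding row_sum_def
      proof (intro sum.cong refl arg_cong[where f = "abs_tail X"])
        fix k assume "k \<in> {1..<n}"
        then show "\<kappa> * real n powr \<gamma> * real k powr (- \<beta>) = 2 * \<epsilon> / (c * weight n k)"
          using divide_weight[of k n "2 * \<epsilon>" c] c by (simp add: \<epsilon>_def)
      qed
      also have "\<dots> = (\<Sum>i=1..N. abs_tail X (2 * \<epsilon> / (c * weight n (n - i))))" unfolding n_def by (rule sum_rev[symmetric])
      also have "\<dots> \<le> (\<Sum>i=1..N. abs_tail X (2 * \<epsilon> / a n i))"
      proof (intro sum_mono tail.v_antimono divide_left_mono)
        fix i assume i: "i \<in> {1..N}"
        then show "c * weight n (n - i) \<le> a n i" by (intro array_bounds) (auto simp: n_def)
        show "0 < a n i * (c * weight n (n - i))" using i array_pos[OF i] c weight_pos[of "n - i" n] by (auto simp: n_def)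
      qed (use \<epsilon> in auto)
      finally have "1 - exp (- row_sum (abs_tail X) \<gamma> \<beta> \<kappa> n) \<le> 1 - exp (- (\<Sum>i=1..N. abs_tail X (2 * \<epsilon> / a n i)))" by simp
      also have "\<dots> \<le> max_prob \<epsilon> N"
        unfolding max_prob_def n_def[symmetric] using array_pos by (intro V_max_ge) (auto simp: n_def)
      finally show ?thesis by (simp add: n_def)
    qed
    have "summable (\<lambda>n. real (Suc n) powr (r - 2) * (1 - exp (- row_sum (abs_tail X) \<gamma> \<beta> \<kappa> (Suc n))))"
    proof (rule summable_comparison_test'[OF sm[OF \<epsilon>], where N = 0])
      fix n
      show "norm (real (Suc n) powr (r - 2) * (1 - exp (- row_sum (abs_tail X) \<gamma> \<beta> \<kappa> (Suc n)))) \<le> real (Suc n) powr (r - 2) * max_prob \<epsilon> n"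
        using le[of n] tail.row_sum_nonneg by (simp add: mult_left_mono abs_mult)
    qed
    then show "summable (\<lambda>n. real n powr (r - 2) * (1 - exp (- row_sum (abs_tail X) \<gamma> \<beta> \<kappa> n)))"
      by (subst (asm) summable_Suc_iff)
  qed (use M in simp)
  then show ?thesis
    using M unfolding \<gamma>_def
    by (intro tail.dyadic_bounded_of_summable_row_sums[where \<kappa> = "1 / M"]) (auto simp: M_def \<gamma>_def)
qed

end

lemma suminf_ereal_finite_iff:
  assumes "\<And>n. 0 \<le> f n" shows "(\<Sum>n. ereal (f n)) < \<infinity> \<longleftrightarrow> summable f"
  using suminf_ereal'[of f] summable_ereal[of f] assms by auto

theorem theorem2:
  fixes F :: "'a set set" and H :: "('a \<Rightarrow> real) set" and E :: "('a \<Rightarrow> real) \<Rightarrow> ereal"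
    and Xs :: "nat \<Rightarrow> 'a \<Rightarrow> real" and X :: "'a \<Rightarrow> real"
    and r p \<beta> :: real and a :: "nat \<Rightarrow> nat \<Rightarrow> real"
  assumes space: "sublinear_space F H E"
    and XH: "X \<in> H" and XsH: "\<forall>n\<ge>1. Xs n \<in> H"
    and indep: "indep_seq H E Xs"
    and ident: "\<forall>n\<ge>1. ident_distr H E (Xs n) X"
    and r: "r > 1" and p: "p > 1/2" and beta: "\<beta> + p > 0"
    and mean: "p \<le> 1 \<Longrightarrow> E X = 0 \<and> - E (\<lambda>\<omega>. - X \<omega>) = 0"
    and arr: "\<exists>c C. 0 < c \<and> c \<le> C \<and> (\<forall>n\<ge>1. \<forall>i<n.
               c * ((real (n - i) / real n) powr \<beta> * (1 / real n) powr p) \<le> a n i \<and>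
               a n i \<le> C * ((real (n - i) / real n) powr \<beta> * (1 / real n) powr p))"
  shows "((if \<beta> < - p / r then choquet H E (\<lambda>\<omega>. \<bar>X \<omega>\<bar> powr ((r - 1) / (p + \<beta>))) < \<infinity>
           else if \<beta> = - p / r then choquet H E (\<lambda>\<omega>. \<bar>X \<omega>\<bar> powr (r / p) * ln (1 + \<bar>X \<omega>\<bar>)) < \<infinity>
           else choquet H E (\<lambda>\<omega>. \<bar>X \<omega>\<bar> powr (r / p)) < \<infinity>)
         \<longleftrightarrow>
         (\<forall>\<epsilon>>0. (\<Sum>n. ereal (real (Suc n) powr (r - 2)) *
             cap H E {\<omega>. (MAX j\<in>{0..<Suc n}. \<bar>\<Sum>i=1..j. a (Suc n) i * Xs i \<omega>\<bar>) > \<epsilon>}) < \<infinity>))"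
    (is "?moment \<longleftrightarrow> ?sums")
proof -
  obtain c C where cC: "0 < c" "c \<le> C" "\<And>n i. n \<ge> 1 \<Longrightarrow> i < n \<Longrightarrow>
      c * ((real (n - i) / real n) powr \<beta> * (1 / real n) powr p) \<le> a n i \<and>
      a n i \<le> C * ((real (n - i) / real n) powr \<beta> * (1 / real n) powr p)"
    using arr by blast
  interpret weighted_iid_sequence F H E Xs X r p \<beta> c C a
    using space XH XsH indep ident r p beta cC by unfold_locales auto
  have sums_iff: "?sums \<longleftrightarrow> (\<forall>\<epsilon>>0. summable (\<lambda>n. real (Suc n) powr (r - 2) * max_prob \<epsilon> n))"
  proof -
    have ev: "{\<omega>. (MAX j\<in>{0..<Suc n}. \<bar>\<Sum>i=1..j. a (Suc n) i * Xs i \<omega>\<bar>) > \<epsilon>}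
        = {\<omega>. \<exists>j\<le>n. \<epsilon> < \<bar>\<Sum>i=1..j. a (Suc n) i * Xs i \<omega>\<bar>}" for \<epsilon> n
      by (subst Max_gr_iff) (auto simp: less_Suc_eq_le)
    have "ereal (real (Suc n) powr (r - 2)) *
        cap H E {\<omega>. (MAX j\<in>{0..<Suc n}. \<bar>\<Sum>i=1..j. a (Suc n) i * Xs i \<omega>\<bar>) > \<epsilon>}
        = ereal (real (Suc n) powr (r - 2) * max_prob \<epsilon> n)" for \<epsilon> n
      unfolding ev max_prob_def cap_eq[OF max_sum_F] by simp
    then show ?thesis using max_prob_nonneg by (simp only: suminf_ereal_finite_iff mult_nonneg_nonneg powr_ge_zero)
  qed
  define mt where "mt t = V {\<omega>. t < moment_function r p \<beta> \<bar>X \<omega>\<bar>}" for t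
  have tt: "transformed_tail (abs_tail X) (moment_function r p \<beta>) mt"
    unfolding mt_def
    by (intro transformed_tail_abs_tail XH moment_function_measurable moment_function_mono par)
  have moment_iff: "?moment \<longleftrightarrow> (\<integral>\<^sup>+ t. indicator {0..} t * ennreal (mt t) \<partial>lborel) < \<infinity>"
  proof -
    have "?moment \<longleftrightarrow> choquet H E (\<lambda>\<omega>. moment_function r p \<beta> \<bar>X \<omega>\<bar>) < \<infinity>"
      by (simp add: moment_function_def)
    also have "\<dots> \<longleftrightarrow> (\<integral>\<^sup>+ t. indicator {0..} t * ennreal (mt t) \<partial>lborel) < \<infinity>"
      unfolding mt_def
      using choquet_finite_iff[OF XH moment_function_measurable] moment_function_nonneg by simp
    finally show ?thesis .
  qed
  show ?thesis
    unfolding moment_iff sums_iff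
  proof
    assume "(\<integral>\<^sup>+ t. indicator {0..} t * ennreal (mt t) \<partial>lborel) < \<infinity>"
    then show "\<forall>\<epsilon>>0. summable (\<lambda>n. real (Suc n) powr (r - 2) * max_prob \<epsilon> n)"
      using summable_max_prob[OF mean] tail.dyadic_bounded_of_moment[OF tt par] unfolding \<gamma>_def by blast
  next
    assume "\<forall>\<epsilon>>0. summable (\<lambda>n. real (Suc n) powr (r - 2) * max_prob \<epsilon> n)"
    then show "(\<integral>\<^sup>+ t. indicator {0..} t * ennreal (mt t) \<partial>lborel) < \<infinity>"
      using dyadic_bounded_of_summable_max_prob tail.moment_of_dyadic_bounded[OF tt par] unfolding \<gamma>_def by blast
  qed
qed

end
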